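(* Let $G$ be a compact abelian group with normalized Haar measure $\mu$ and Pontryagin dual $\hat G$. For all $1\le p\le2$ and $A_\theta\in L^p(G;\mathcal C_p)$, $$\sum_{k\in\hat G}\Big\|\int_G\overline{k(\theta)}A_\theta\,d\mu(\theta)\Big\|_p^q\le\Big(\int_G\|A_\theta\|_p^p\,d\mu(\theta)\Big)^{q/p},$$ where $q$ is conjugate to $p$, i.e. $q=p/(p-1)$ (for $p=1$, $q=\infty$, the inequality is read as $\sup_{k\in\hat G}\|\int_G\overline{k(\theta)}A_\theta\,d\mu(\theta)\|_1\le\int_G\|A_\theta\|_1\,d\mu(\theta)$).
   Context: $H$ is a separable complex Hilbert space. For $1\le p<\infty$, $\|A\|_p=(\operatorname{tr}|A|^p)^{1/p}$ with $|A|=(A^*A)^{1/2}$, and $\mathcal C_p$ is the Schatten class of operators on $H$ with $\|A\|_p<\infty$. The Haar measure $\mu$ of $G$ is normalized by $\mu(G)=1$. $\hat G$ is the (discrete) group of continuous homomorphisms $k:G\to\{z\in\mathbb C:|z|=1\}$. $L^p(G;\mathcal C_p)$ is the Bochner space of strongly measurable $\theta\mapsto A_\theta\in\mathcal C_p$ with $\int_G\|A_\theta\|_p^p\,d\mu(\theta)<\infty$; integrals of operator-valued functions are Bochner integrals. Sums over $\hat G$ are unordered sums. *)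

theory Defs
  imports "HOL-Analysis.Analysis" "HOL-Computational_Algebra.Polynomial"
begin

section \<open>Complex Hilbert spaces\<close>

text \<open>The inner product is conjugate-linear in the first and linear in the second argument;
  completeness is inherited from \<^class>\<open>banach\<close>.\<close>

class complex_hilbert_space = banach +
  fixes scaleC :: "complex \<Rightarrow> 'a \<Rightarrow> 'a"  (infixr \<open>*\<^sub>C\<close> 75)
    and cinner :: "'a \<Rightarrow> 'a \<Rightarrow> complex"
  assumes scaleC_add_right: "c *\<^sub>C (x + y) = c *\<^sub>C x + c *\<^sub>C y"
    and scaleC_add_left: "(c + d) *\<^sub>C x = c *\<^sub>C x + d *\<^sub>C x"
    and scaleC_scaleC: "c *\<^sub>C d *\<^sub>C x = (c * d) *\<^sub>C x"
    and scaleR_scaleC: "r *\<^sub>R x = complex_of_real r *\<^sub>C x"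
    and cinner_commute: "cinner x y = cnj (cinner y x)"
    and cinner_add_right: "cinner x (y + z) = cinner x y + cinner x z"
    and cinner_scaleC_right: "cinner x (c *\<^sub>C y) = c * cinner x y"
    and Re_cinner_self: "Re (cinner x x) = (norm x)\<^sup>2"

definition orthonormal_basis :: "'h::complex_hilbert_space set \<Rightarrow> bool" where
  "orthonormal_basis B \<longleftrightarrow>
     (\<forall>e\<in>B. \<forall>f\<in>B. cinner e f = (if e = f then 1 else 0)) \<and>
     (\<forall>x. (\<forall>e\<in>B. cinner e x = 0) \<longrightarrow> x = 0)"

section \<open>Bounded operators\<close>

text \<open>An element of \<^typ>\<open>'h \<Rightarrow>\<^sub>L 'h\<close> is only bounded and real-linear. The bounded operators on the
  complex space are those that satisfy the following predicate.\<close>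

definition clinear_op :: "('h::complex_hilbert_space \<Rightarrow>\<^sub>L 'h) \<Rightarrow> bool" where
  "clinear_op T \<longleftrightarrow> (\<forall>c x. T (c *\<^sub>C x) = c *\<^sub>C T x)"

lemma norm_scaleC: "norm (c *\<^sub>C x) = cmod c * norm (x::'h::complex_hilbert_space)"
proof -
  have real: "cinner x x = complex_of_real ((norm x)\<^sup>2)"
    using cinner_commute[of x x] Re_cinner_self[of x] by (simp add: complex_eq_iff)
  have "cinner (c *\<^sub>C x) x = cnj c * cinner x x"
    by (metis cinner_commute cinner_scaleC_right complex_cnj_mult)
  then have "cinner (c *\<^sub>C x) (c *\<^sub>C x) = complex_of_real ((cmod c * norm x)\<^sup>2)"
    by (simp add: cinner_scaleC_right real complex_norm_square[symmetric] power_mult_distrib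
        mult.assoc[symmetric])
  then have "(norm (c *\<^sub>C x))\<^sup>2 = (cmod c * norm x)\<^sup>2"
    by (metis Re_cinner_self Re_complex_of_real)
  then show ?thesis
    by (simp add: power2_eq_iff_nonneg)
qed

lift_definition scaleC_op ::
  "complex \<Rightarrow> ('h::complex_hilbert_space \<Rightarrow>\<^sub>L 'h) \<Rightarrow> ('h \<Rightarrow>\<^sub>L 'h)" is "\<lambda>c T x. c *\<^sub>C T x"
proof -
  fix c :: complex and T :: "'h \<Rightarrow> 'h"
  assume T: "bounded_linear T"
  have "bounded_linear (\<lambda>x::'h. c *\<^sub>C x)"
    by (rule bounded_linear_intro[where K = "cmod c"])
      (simp_all add: scaleC_add_right scaleR_scaleC scaleC_scaleC norm_scaleC mult.commute)
  then show "bounded_linear (\<lambda>x. c *\<^sub>C T x)"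
    using T by (rule bounded_linear_compose)
qed

definition adjoint_op :: "('h::complex_hilbert_space \<Rightarrow>\<^sub>L 'h) \<Rightarrow> ('h \<Rightarrow>\<^sub>L 'h)" where
  "adjoint_op T = (THE S. clinear_op S \<and> (\<forall>x y. cinner (T x) y = cinner x (S y)))"

definition op_poly :: "real poly \<Rightarrow> ('h::real_normed_vector \<Rightarrow>\<^sub>L 'h) \<Rightarrow> ('h \<Rightarrow>\<^sub>L 'h)" where
  "op_poly P T = (\<Sum>i\<le>degree P. coeff P i *\<^sub>R (((o\<^sub>L) T ^^ i) id_blinfun))"

text \<open>Continuous functional calculus for the function \<open>t \<mapsto> t\<^sup>r\<close>, to be used with \<open>r > 0\<close> and a
  positive operator \<open>T\<close>, whose spectrum is contained in \<open>[0, \<parallel>T\<parallel>]\<close>: \<open>T\<^sup>r\<close> is the limit in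
  operator norm of \<open>P\<^sub>n(T)\<close> whenever the polynomials \<open>P\<^sub>n\<close> converge to \<open>t\<^sup>r\<close> uniformly
  on this interval. The limit is unique because such \<open>P\<^sub>n\<close> exist (Weierstrass).\<close>

definition op_powr :: "('h::real_normed_vector \<Rightarrow>\<^sub>L 'h) \<Rightarrow> real \<Rightarrow> ('h \<Rightarrow>\<^sub>L 'h)" where
  "op_powr T r = (THE S. \<forall>P::nat \<Rightarrow> real poly.
     uniform_limit {0..norm T} (\<lambda>n. poly (P n)) (\<lambda>t. t powr r) sequentially \<longrightarrow>
     (\<lambda>n. op_poly (P n) T) \<longlonglongrightarrow> S)"

definition op_abs :: "('h::complex_hilbert_space \<Rightarrow>\<^sub>L 'h) \<Rightarrow> ('h \<Rightarrow>\<^sub>L 'h)" where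
  "op_abs T = op_powr (adjoint_op T o\<^sub>L T) (1/2)"

section \<open>Schatten classes\<close>

text \<open>Trace of a positive operator, with values in \<open>[0, \<infinity>]\<close>. It does not depend on the
  orthonormal basis, so an arbitrary one is chosen.\<close>

definition pos_trace :: "('h::complex_hilbert_space \<Rightarrow>\<^sub>L 'h) \<Rightarrow> ennreal" where
  "pos_trace T = (\<Sum>\<^sub>\<infinity>e\<in>(SOME B. orthonormal_basis B). ennreal (Re (cinner e (T e))))"

definition schatten_class :: "real \<Rightarrow> ('h::complex_hilbert_space \<Rightarrow>\<^sub>L 'h) set" where
  "schatten_class p = {T. clinear_op T \<and> pos_trace (op_powr (op_abs T) p) < \<infinity>}"

definition schatten_norm :: "real \<Rightarrow> ('h::complex_hilbert_space \<Rightarrow>\<^sub>L 'h) \<Rightarrow> real" where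
  "schatten_norm p T = enn2real (pos_trace (op_powr (op_abs T) p)) powr (1/p)"

section \<open>Bochner integration in a normed subspace\<close>

text \<open>The library's Bochner integral is tied to a second-countable type with its type-class norm.
  Here the values lie in a subspace \<open>V\<close> with a norm \<open>N\<close> of its own (the Schatten class with its
  norm). The integral \<open>\<integral>\<^sup>+\<close> is used for the norms because \<open>N \<circ> f\<close> is in general only
  almost everywhere equal to a measurable function.\<close>

definition strongly_measurable_in ::
  "'a measure \<Rightarrow> 'v::real_vector set \<Rightarrow> ('v \<Rightarrow> real) \<Rightarrow> ('a \<Rightarrow> 'v) \<Rightarrow> bool" where
  "strongly_measurable_in M V N f \<longleftrightarrow> f \<in> space M \<rightarrow> V \<and>
     (\<exists>s. (\<forall>i. simple_function M (s i) \<and> s i \<in> space M \<rightarrow> V) \<and>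
          (AE x in M. (\<lambda>i. N (f x - s i x)) \<longlonglongrightarrow> 0))"

definition has_bochner_integral_in ::
  "'a measure \<Rightarrow> 'v::real_vector set \<Rightarrow> ('v \<Rightarrow> real) \<Rightarrow> ('a \<Rightarrow> 'v) \<Rightarrow> 'v \<Rightarrow> bool" where
  "has_bochner_integral_in M V N f I \<longleftrightarrow> I \<in> V \<and> strongly_measurable_in M V N f \<and>
     (\<exists>s. (\<forall>i. Bochner_Integration.simple_bochner_integrable M (s i) \<and> s i \<in> space M \<rightarrow> V) \<and>
          (\<lambda>i. \<integral>\<^sup>+x. ennreal (N (f x - s i x)) \<partial>M) \<longlonglongrightarrow> 0 \<and>
          (\<lambda>i. N (Bochner_Integration.simple_bochner_integral M (s i) - I)) \<longlonglongrightarrow> 0)"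

definition bochner_integral_in ::
  "'a measure \<Rightarrow> 'v::real_vector set \<Rightarrow> ('v \<Rightarrow> real) \<Rightarrow> ('a \<Rightarrow> 'v) \<Rightarrow> 'v" where
  "bochner_integral_in M V N f = (THE I. has_bochner_integral_in M V N f I)"

definition Lp_schatten ::
  "'a measure \<Rightarrow> real \<Rightarrow> ('a \<Rightarrow> ('h::complex_hilbert_space \<Rightarrow>\<^sub>L 'h)) set" where
  "Lp_schatten M p = {A. strongly_measurable_in M (schatten_class p) (schatten_norm p) A \<and>
     (\<integral>\<^sup>+x. ennreal (schatten_norm p (A x) powr p) \<partial>M) < \<infinity>}"

section \<open>Haar measure and the dual group\<close>

text \<open>For non-metrizable compact groups, regularity is needed to make the Haar measure unique
  among the invariant Borel probability measures.\<close>

definition normalized_haar_measure :: "'g::topological_ab_group_add measure \<Rightarrow> bool" where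
  "normalized_haar_measure M \<longleftrightarrow> sets M = sets borel \<and> emeasure M UNIV = 1 \<and>
     (\<forall>a. \<forall>E\<in>sets borel. emeasure M ((+) a ` E) = emeasure M E) \<and>
     (\<forall>E\<in>sets borel. emeasure M E = (INF U\<in>{U. open U \<and> E \<subseteq> U}. emeasure M U)) \<and>
     (\<forall>U. open U \<longrightarrow> emeasure M U = (SUP K\<in>{K. compact K \<and> K \<subseteq> U}. emeasure M K))"

definition dual_group :: "('g::topological_ab_group_add \<Rightarrow> complex) set" where
  "dual_group = {k. continuous_on UNIV k \<and> (\<forall>x. cmod (k x) = 1) \<and> (\<forall>x y. k (x + y) = k x * k y)}"

definition schatten_fourier ::
  "'g::topological_ab_group_add measure \<Rightarrow> real \<Rightarrow> ('g \<Rightarrow> ('h::complex_hilbert_space \<Rightarrow>\<^sub>L 'h)) \<Rightarrow>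
    ('g \<Rightarrow> complex) \<Rightarrow> ('h \<Rightarrow>\<^sub>L 'h)" where
  "schatten_fourier M p A k =
     bochner_integral_in M (schatten_class p) (schatten_norm p)
       (\<lambda>\<theta>. scaleC_op (cnj (k \<theta>)) (A \<theta>))"

end

theory Submission
  imports Defs "HOL-Complex_Analysis.Complex_Analysis"
begin

text \<open>The inequality interpolates between two endpoints. For \<open>p = 1\<close> it is the triangle inequality for the
  integral, because characters have modulus one. For \<open>p = 2\<close> it is Bessel's inequality for the
  characters, applied to every matrix coefficient of the operators. The intermediate exponents follow by
  complex interpolation, provided that the Schatten norm, which is defined through the functional
  calculus and a trace, can be evaluated on finite-dimensional data.

  The bridge is the formula \<open>trace_op_abs_powr\<close>: the number \<open>tr |T|\<^sup>p\<close> is the supremum of the finite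
  sums \<open>\<Sum> |\<langle>f\<^sub>i, T e\<^sub>i\<rangle>|\<^sup>p\<close> over all pairs of finite Bessel families, that is, of families with
  \<open>\<Sum> |\<langle>e\<^sub>i, x\<rangle>|\<^sup>2 \<le> \<parallel>x\<parallel>\<^sup>2\<close>. For \<open>p \<ge> 1\<close> the right-hand side visibly is the \<open>p\<close>-th power of a norm that
  is lower semicontinuous, so the triangle inequality and the completeness of the Schatten class cost
  little. To prove the formula no spectral theorem for bounded operators is needed. A polynomial in a
  positive operator \<open>T\<close>, applied to finitely many vectors, only sees a finite-dimensional space spanned
  by vectors \<open>T\<^sup>i x\<close>, where the compression of \<open>T\<close> can be diagonalized (\<open>op_poly_diagonal\<close>). This gives
  the norm bound on which \<open>op_powr\<close> rests, and it reduces identities and inequalities between powers of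
  \<open>T\<close> to scalar ones.

  Once the norm is known through Bessel families, a lower bound for the Schatten norms of finitely many
  Fourier coefficients involves only finitely many vectors. If \<open>A\<close> is a step function, its values can be
  replaced by their restrictions to one finite-dimensional space. There each value has a singular value
  decomposition, and the singular vectors turn the Fourier transform into a finite matrix with scalar
  entries. The triangle inequality and Bessel's inequality become two bounds for this matrix
  (\<open>operator_interpolation\<close>), and \<open>mixed_norm_interpolation\<close>, a Riesz-Thorin theorem for finite
  matrices and mixed norms, gives the estimate in between. The powers of the singular values and of the
  matrix output are made to depend holomorphically on a parameter, and the three lines theorem is applied.

  A general \<open>A\<close> is approximated by step functions. Matrix coefficients of the Fourier coefficients are
  continuous under this approximation (\<open>functional_integral_estimate\<close>), and nothing more is needed,
  because the inequality has been reduced to matrix coefficients.\<close>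

section \<open>Complex inner products\<close>

lemma cinner_add_left: "cinner (x + y) (z::'h::complex_hilbert_space) = cinner x z + cinner y z"
  by (metis cinner_add_right cinner_commute complex_cnj_add)

lemma cinner_scaleC_left: "cinner (c *\<^sub>C x) (y::'h::complex_hilbert_space) = cnj c * cinner x y"
  by (metis cinner_commute cinner_scaleC_right complex_cnj_mult)

lemma cinner_self: "cinner x x = complex_of_real ((norm (x::'h::complex_hilbert_space))\<^sup>2)"
  using cinner_commute[of x x] Re_cinner_self[of x] by (simp add: complex_eq_iff)

lemma scaleC_one [simp]: "1 *\<^sub>C (x::'h::complex_hilbert_space) = x"
  using scaleR_scaleC[of 1 x] by simp

lemma scaleC_zero_left [simp]: "0 *\<^sub>C (x::'h::complex_hilbert_space) = 0"
  using scaleC_add_left[of 0 0 x] by simp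

lemma scaleC_minus_left: "(- c) *\<^sub>C (x::'h::complex_hilbert_space) = - (c *\<^sub>C x)"
  using scaleC_add_left[of c "- c" x] by (simp add: eq_neg_iff_add_eq_0 add.commute)

lemma scaleC_zero_right [simp]: "c *\<^sub>C (0::'h::complex_hilbert_space) = 0"
  using scaleC_add_right[of c 0 "0::'h"] by simp

lemma scaleC_diff_left: "(c - d) *\<^sub>C (x::'h::complex_hilbert_space) = c *\<^sub>C x - d *\<^sub>C x"
  using scaleC_add_left[of "c - d" d x] by simp

lemma scaleC_diff_right: "c *\<^sub>C (x - y) = c *\<^sub>C x - c *\<^sub>C (y::'h::complex_hilbert_space)"
  using scaleC_add_right[of c "x - y" y] by simp

lemma clinear_scaleC_sum:
  "c *\<^sub>C (\<Sum>i\<in>I. f i) = (\<Sum>i\<in>I. c *\<^sub>C (f i::'h::complex_hilbert_space))"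
  by (induction I rule: infinite_finite_induct) (auto simp: scaleC_add_right)

text \<open>The component of \<open>y\<close> orthogonal to \<open>x\<close> has a nonnegative squared norm, which is the Cauchy-Schwarz
  inequality. With it the general facts on bounded bilinear maps (sums, limits, continuity) apply to the
  inner product.\<close>
lemma bounded_bilinear_cinner:
  "bounded_bilinear (cinner :: 'h::complex_hilbert_space \<Rightarrow> 'h \<Rightarrow> complex)"
  and norm_cinner_le: "cmod (cinner (x::'h) y) \<le> norm x * norm y"
proof -
  have CS: "cmod (cinner (x::'h) y) \<le> norm x * norm y" for x y
  proof (cases "cinner x y = 0 \<or> x = 0")
    case True
    moreover have "cinner 0 y = 0" using cinner_add_left[of 0 0 y] by simp
    ultimately show ?thesis by auto
  next
    case False
    define a where "a = cinner x y"
    define n where "n = (norm x)\<^sup>2"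
    have n: "n > 0" using False by (simp add: n_def)
    define z where "z = y + (- (a / of_real n)) *\<^sub>C x"
    have yx: "cinner y x = cnj a" by (simp add: a_def flip: cinner_commute)
    have "cinner z z = cinner y y - a * cnj a / of_real n"
      using n by (simp add: z_def cinner_add_left cinner_add_right cinner_scaleC_left cinner_scaleC_right
          cinner_self[of x] yx flip: a_def n_def)
    then have "(norm z)\<^sup>2 = (norm y)\<^sup>2 - (cmod a)\<^sup>2 / n"
      unfolding cinner_self complex_norm_square[symmetric] of_real_divide[symmetric] of_real_diff[symmetric]
      using of_real_eq_iff by blast
    then have "(cmod a)\<^sup>2 / n \<le> (norm y)\<^sup>2" by (metis diff_ge_0_iff_ge zero_le_power2)
    then have "(cmod a)\<^sup>2 \<le> (norm x * norm y)\<^sup>2"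
      using n by (simp add: n_def field_simps power_mult_distrib)
    then show ?thesis unfolding a_def by (rule power2_le_imp_le) simp
  qed
  show "bounded_bilinear (cinner :: 'h \<Rightarrow> 'h \<Rightarrow> complex)"
  proof
    fix r :: real and a b :: 'h
    show "cinner (r *\<^sub>R a) b = r *\<^sub>R cinner a b" "cinner a (r *\<^sub>R b) = r *\<^sub>R cinner a b"
      by (simp_all add: scaleR_scaleC cinner_scaleC_left cinner_scaleC_right scaleR_conv_of_real)
    show "\<exists>K. \<forall>(a::'h) b. cmod (cinner a b) \<le> norm a * norm b * K"
      using CS by (intro exI[of _ 1]) auto
  qed (rule cinner_add_left cinner_add_right)+
  show "cmod (cinner (x::'h) y) \<le> norm x * norm y" by (rule CS)
qed

interpretation cinner: bounded_bilinear "cinner :: 'h::complex_hilbert_space \<Rightarrow> 'h \<Rightarrow> complex"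
  by (rule bounded_bilinear_cinner)

declare cinner.zero_left [simp] cinner.zero_right [simp]

lemmas cinner_simps = cinner_add_left cinner_add_right cinner_scaleC_left cinner_scaleC_right
  cinner.diff_left cinner.diff_right cinner.zero_left cinner.zero_right cinner.minus_left cinner.minus_right

lemma cinner_ext:
  assumes "\<And>z. cinner z (x::'h::complex_hilbert_space) = cinner z y"
  shows "x = y"
proof -
  have "cinner (x - y) (x - y) = 0" by (simp add: cinner.diff_right assms)
  then show ?thesis by (simp add: cinner_self)
qed

lemma bounded_linear_scaleC: "bounded_linear (\<lambda>x::'h::complex_hilbert_space. c *\<^sub>C x)"
  by (rule bounded_linear_intro[where K = "cmod c"])
    (simp_all add: scaleC_add_right scaleR_scaleC scaleC_scaleC norm_scaleC mult.commute)

lemmas tendsto_scaleC [tendsto_intros] = bounded_linear.tendsto[OF bounded_linear_scaleC]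

lemma continuous_on_scaleC_left: "continuous_on UNIV (\<lambda>c. c *\<^sub>C (x::'h::complex_hilbert_space))"
proof -
  have "bounded_linear (\<lambda>c. c *\<^sub>C x)"
    by (rule bounded_linear_intro[where K = "norm x"])
      (simp_all add: scaleC_add_left scaleR_scaleC scaleC_scaleC norm_scaleC mult.commute scaleR_conv_of_real)
  then show ?thesis by (simp add: bounded_linear.linear linear_continuous_on)
qed

lemma cmod_cinner_commute: "cmod (cinner x y) = cmod (cinner y (x::'h::complex_hilbert_space))"
  by (subst cinner_commute) simp

lemma cnj_mult_self: "cnj z * z = complex_of_real ((cmod z)\<^sup>2)"
  by (metis complex_norm_square mult.commute)

section \<open>Finite orthonormal sets\<close>

definition finite_ortho :: "'h::complex_hilbert_space set \<Rightarrow> bool" where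
  "finite_ortho E \<longleftrightarrow> finite E \<and> (\<forall>e\<in>E. \<forall>f\<in>E. cinner e f = (if e = f then 1 else 0))"

text \<open>For an orthonormal \<open>E\<close> this is the orthogonal projection onto the span of \<open>E\<close>. Finite-dimensional
  subspaces are always given in this way, and \<open>proj E x = x\<close> expresses that \<open>x\<close> lies in the subspace.\<close>
definition proj :: "'h::complex_hilbert_space set \<Rightarrow> 'h \<Rightarrow> 'h" where
  "proj E x = (\<Sum>e\<in>E. cinner e x *\<^sub>C e)"

lemma cinner_ortho_sum:
  assumes "finite_ortho E" "e \<in> E"
  shows "cinner e (\<Sum>f\<in>E. c f *\<^sub>C f) = c e"
proof -
  have "cinner e (\<Sum>f\<in>E. c f *\<^sub>C f) = (\<Sum>f\<in>E. if f = e then c e else 0)"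
    unfolding cinner.sum_right cinner_scaleC_right
    using assms by (intro sum.cong) (auto simp: finite_ortho_def)
  then show ?thesis using assms by (simp add: finite_ortho_def)
qed

lemma cinner_ortho_sums:
  assumes "finite_ortho E"
  shows "cinner (\<Sum>f\<in>E. c f *\<^sub>C f) (\<Sum>f\<in>E. d f *\<^sub>C f) = (\<Sum>f\<in>E. cnj (c f) * d f)"
  unfolding cinner.sum_left cinner_scaleC_left
  by (intro sum.cong refl) (simp add: cinner_ortho_sum[OF assms])

lemma norm_ortho_sum:
  assumes "finite_ortho E"
  shows "(norm (\<Sum>f\<in>E. c f *\<^sub>C f))\<^sup>2 = (\<Sum>f\<in>E. (cmod (c f))\<^sup>2)"
proof -
  have "complex_of_real ((norm (\<Sum>f\<in>E. c f *\<^sub>C f))\<^sup>2) = (\<Sum>f\<in>E. cnj (c f) * c f)"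
    unfolding cinner_self[symmetric] by (rule cinner_ortho_sums[OF assms])
  also have "\<dots> = of_real (\<Sum>f\<in>E. (cmod (c f))\<^sup>2)"
    by (simp only: cnj_mult_self of_real_sum)
  finally show ?thesis using of_real_eq_iff by blast
qed

lemma norm_ortho: "finite_ortho E \<Longrightarrow> e \<in> E \<Longrightarrow> norm e = 1"
proof -
  assume "finite_ortho E" "e \<in> E"
  then have "complex_of_real ((norm e)\<^sup>2) = 1" unfolding cinner_self[symmetric] finite_ortho_def by simp
  then have "(norm e)\<^sup>2 = 1" using of_real_eq_1_iff by blast
  then show "norm e = 1" using norm_ge_zero[of e] by (auto simp: power2_eq_1_iff simp del: norm_ge_zero)
qed

lemma cinner_proj: "finite_ortho E \<Longrightarrow> e \<in> E \<Longrightarrow> cinner e (proj E x) = cinner e x"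
  by (simp add: proj_def cinner_ortho_sum)

lemma norm_proj: "finite_ortho E \<Longrightarrow> (norm (proj E x))\<^sup>2 = (\<Sum>e\<in>E. (cmod (cinner e x))\<^sup>2)"
  by (simp add: proj_def norm_ortho_sum)

lemma cinner_proj_left: "cinner (proj E x) y = (\<Sum>e\<in>E. cnj (cinner e x) * cinner e y)"
  by (simp add: proj_def cinner.sum_left cinner_scaleC_left)

lemma proj_selfadjoint: "cinner (proj E x) y = cinner x (proj E y)"
  unfolding cinner_proj_left
  by (simp add: proj_def cinner.sum_right cinner_scaleC_right cinner_commute[of x] mult.commute)

lemma proj_idem: "finite_ortho E \<Longrightarrow> proj E (proj E x) = proj E x"
  by (subst (1) proj_def) (simp add: cinner_proj flip: proj_def cong: sum.cong)

lemma norm_diff_proj: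
  assumes "finite_ortho E"
  shows "(norm (x - proj E x))\<^sup>2 = (norm x)\<^sup>2 - (\<Sum>e\<in>E. (cmod (cinner e x))\<^sup>2)"
proof -
  have *: "cinner (proj E x) x = cinner (proj E x) (proj E x)"
    by (simp add: proj_selfadjoint proj_idem[OF assms])
  have **: "cinner x (proj E x) = cinner (proj E x) (proj E x)"
    by (simp add: proj_selfadjoint proj_idem[OF assms])
  have "cinner (x - proj E x) (x - proj E x) = cinner x x - cinner (proj E x) (proj E x)"
    by (simp add: cinner_simps * **)
  then show ?thesis unfolding cinner_self norm_proj[OF assms, symmetric] of_real_diff[symmetric]
    using of_real_eq_iff by blast
qed

lemma bessel_ineq:
  "finite_ortho E \<Longrightarrow> (\<Sum>e\<in>E. (cmod (cinner e x))\<^sup>2) \<le> (norm x)\<^sup>2"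
  using norm_diff_proj[of E x] by (smt (verit) zero_le_power2)

lemma proj_add: "proj E (x + y) = proj E x + proj E y"
  by (simp add: proj_def cinner_simps scaleC_add_left sum.distrib)

lemma proj_scaleC: "proj E (c *\<^sub>C x) = c *\<^sub>C proj E x"
  by (simp add: proj_def cinner_simps clinear_scaleC_sum scaleC_scaleC)

lemma proj_diff: "proj E (x - y) = proj E x - proj E y"
  using proj_add[of E "x - y" y] by simp

lemma proj_in: "finite_ortho E \<Longrightarrow> e \<in> E \<Longrightarrow> proj E e = e"
proof -
  assume *: "finite_ortho E" "e \<in> E"
  have "proj E e = (\<Sum>f\<in>E. if f = e then e else 0)"
    unfolding proj_def using * by (intro sum.cong) (auto simp: finite_ortho_def)
  then show ?thesis using * by (simp add: finite_ortho_def)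
qed

lemma proj_sum: "proj E (\<Sum>i\<in>I. c i *\<^sub>C f i) = (\<Sum>i\<in>I. c i *\<^sub>C proj E (f i))"
proof -
  have "proj E 0 = 0" by (simp add: proj_def)
  then show ?thesis
    by (induction I rule: infinite_finite_induct) (auto simp: proj_add proj_scaleC)
qed

lemma finite_ortho_insert:
  assumes "finite_ortho E" "norm v = 1" "\<And>e. e \<in> E \<Longrightarrow> cinner e v = 0"
  shows "finite_ortho (insert v E)"
proof -
  have 1: "cinner v e = 0" if "e \<in> E" for e using assms(3)[OF that] cinner_commute[of v e] by simp
  have 2: "cinner v v = 1" using assms(2) by (simp add: cinner_self)
  then have "v \<notin> E" using 1 by auto
  then show ?thesis using assms 1 2 unfolding finite_ortho_def by auto
qed

lemma proj_mono:
  assumes "finite_ortho F" "E \<subseteq> F" "proj E x = x"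
  shows "proj F x = x"
proof -
  have "finite E" using assms unfolding finite_ortho_def by (auto intro: finite_subset)
  have "proj F (proj E x) = proj E x"
    unfolding proj_def[of E] proj_sum using assms proj_in[OF assms(1)] by (intro sum.cong) auto
  then show ?thesis using assms(3) by simp
qed

text \<open>Gram-Schmidt. Only the inclusion of \<open>S\<close> in the span is recorded, since later arguments are free to
  enlarge the finite-dimensional space.\<close>
lemma ortho_containing:
  assumes "finite (S::'h::complex_hilbert_space set)"
  shows "\<exists>E. finite_ortho E \<and> (\<forall>x\<in>S. proj E x = x)"
  using assms
proof induction
  case empty
  show ?case by (rule exI[of _ "{}"]) (simp add: finite_ortho_def)
next
  case (insert x S)
  then obtain E where E: "finite_ortho E" "\<forall>x\<in>S. proj E x = x" by auto
  define y where "y = x - proj E x"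
  show ?case
  proof (cases "y = 0")
    case True
    then show ?thesis using E by (intro exI[of _ E]) (auto simp: y_def)
  next
    case False
    define v where "v = complex_of_real (1 / norm y) *\<^sub>C y"
    have nv: "norm v = 1" using False by (simp add: v_def norm_scaleC norm_divide)
    have ve: "cinner e v = 0" if "e \<in> E" for e
      using cinner_proj[OF E(1) that] by (simp add: v_def y_def cinner_simps)
    have o: "finite_ortho (insert v E)" by (rule finite_ortho_insert[OF E(1) nv ve])
    have "proj (insert v E) y = y"
    proof -
      have "y = complex_of_real (norm y) *\<^sub>C v" using False by (simp add: v_def scaleC_scaleC)
      then show ?thesis using proj_scaleC proj_in[OF o] by (metis insertI1)
    qed
    moreover have "proj (insert v E) (proj E x) = proj E x"
      by (rule proj_mono[OF o _ proj_idem[OF E(1)]]) auto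
    ultimately have "proj (insert v E) x = x"
      using proj_add[of "insert v E" y "proj E x"] by (simp add: y_def)
    moreover have "proj (insert v E) z = z" if "z \<in> S" for z
      by (rule proj_mono[OF o _]) (use E that in auto)
    ultimately show ?thesis using o by blast
  qed
qed

section \<open>Orthonormal bases\<close>

lemma orthonormal_basis_exists: "\<exists>B::'h::complex_hilbert_space set. orthonormal_basis B"
proof -
  define P where "P = {B::'h set. \<forall>e\<in>B. \<forall>f\<in>B. cinner e f = (if e = f then 1 else 0)}"
  have "\<exists>M\<in>P. \<forall>X\<in>P. M \<subseteq> X \<longrightarrow> X = M"
  proof (rule subset_Zorn)
    fix C assume C: "subset.chain P C"
    have "cinner e f = (if e = f then 1 else 0)" if "e \<in> \<Union>C" "f \<in> \<Union>C" for e f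
    proof -
      from that obtain X Y where XY: "X \<in> C" "Y \<in> C" "e \<in> X" "f \<in> Y" by blast
      then have "X \<subseteq> Y \<or> Y \<subseteq> X" using C by (auto simp: subset.chain_def)
      then obtain Z where "Z \<in> C" "e \<in> Z" "f \<in> Z" using XY by auto
      then show ?thesis using C by (auto simp: subset.chain_def P_def subset_iff)
    qed
    then show "\<exists>U\<in>P. \<forall>X\<in>C. X \<subseteq> U" by (intro bexI[of _ "\<Union>C"]) (auto simp: P_def)
  qed
  then obtain M where M: "M \<in> P" "\<And>X. X \<in> P \<Longrightarrow> M \<subseteq> X \<Longrightarrow> X = M" by blast
  have "x = 0" if x: "\<forall>e\<in>M. cinner e x = 0" for x
  proof (rule ccontr)
    assume "x \<noteq> 0"
    define v where "v = complex_of_real (1 / norm x) *\<^sub>C x"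
    have nv: "cinner v v = 1" using \<open>x \<noteq> 0\<close> by (simp add: v_def norm_scaleC norm_divide cinner_self)
    have "cinner e v = 0" "cinner v e = 0" if "e \<in> M" for e
      using x that cinner_commute[of x e] by (auto simp: v_def cinner_simps)
    then have "insert v M \<in> P" using M(1) nv by (auto simp: P_def)
    then have "v \<in> M" using M(2) by auto
    then show False using nv \<open>\<And>e. e \<in> M \<Longrightarrow> cinner e v = 0\<close> by auto
  qed
  then have "orthonormal_basis M"
    unfolding orthonormal_basis_def using M(1)[unfolded P_def mem_Collect_eq] by blast
  then show ?thesis by blast
qed

lemma orthonormal_basis_cinner:
  "orthonormal_basis B \<Longrightarrow> e \<in> B \<Longrightarrow> f \<in> B \<Longrightarrow> cinner e f = (if e = f then 1 else 0)"
  unfolding orthonormal_basis_def by blast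

lemma orthonormal_basis_finite_ortho:
  "orthonormal_basis B \<Longrightarrow> finite F \<Longrightarrow> F \<subseteq> B \<Longrightarrow> finite_ortho F"
  unfolding finite_ortho_def using orthonormal_basis_cinner by (metis subsetD)

text \<open>Finite sets \<open>F n\<close> whose sums come within \<open>1 / (n + 1)\<close> of the supremum \<open>D\<close> have Cauchy partial vectors.
  A single sequence suffices even for an uncountable \<open>B\<close>: an element outside all \<open>F n\<close> could be added to
  each of them without exceeding \<open>D\<close>, so its coefficient vanishes.\<close>
lemma riesz_fischer:
  fixes B :: "'h::complex_hilbert_space set"
  assumes B: "orthonormal_basis B"
    and C: "\<And>F. finite F \<Longrightarrow> F \<subseteq> B \<Longrightarrow> (\<Sum>e\<in>F. (cmod (c e))\<^sup>2) \<le> C"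
  shows "\<exists>z. (\<forall>e\<in>B. cinner e z = c e) \<and> (norm z)\<^sup>2 \<le> C"
proof -
  let ?s = "\<lambda>F. \<Sum>e\<in>F. (cmod (c e))\<^sup>2"
  let ?z = "\<lambda>F. \<Sum>e\<in>F. c e *\<^sub>C e"
  define D where "D = (SUP F\<in>{F. finite F \<and> F \<subseteq> B}. ?s F)"
  have bdd: "bdd_above (?s ` {F. finite F \<and> F \<subseteq> B})" using C by (intro bdd_aboveI[of _ C]) auto
  have D: "?s F \<le> D" if "finite F" "F \<subseteq> B" for F
    unfolding D_def using that by (intro cSUP_upper bdd) auto
  have DC: "D \<le> C" unfolding D_def using C by (intro cSUP_least) auto
  have "\<exists>F. finite F \<and> F \<subseteq> B \<and> ?s F > D - inverse (Suc n)" for n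
  proof -
    have "D - inverse (Suc n) < D" by simp
    moreover have "{F. finite F \<and> F \<subseteq> B} \<noteq> {}" by blast
    ultimately have "\<exists>F\<in>{F. finite F \<and> F \<subseteq> B}. D - inverse (Suc n) < ?s F"
      using less_cSUP_iff[OF _ bdd, of "D - inverse (Suc n)"] unfolding D_def by meson
    then show ?thesis by blast
  qed
  then obtain G where G: "\<And>n. finite (G n)" "\<And>n. G n \<subseteq> B" "\<And>n. ?s (G n) > D - inverse (Suc n)"
    by metis
  define F where "F n = (\<Union>i\<le>n. G i)" for n
  have F: "finite (F n)" "F n \<subseteq> B" for n using G by (auto simp: F_def)
  have mono: "m \<le> n \<Longrightarrow> F m \<subseteq> F n" for m n by (auto simp: F_def intro: order_trans)
  have sF: "?s (F n) > D - inverse (Suc n)" for n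
  proof -
    have "?s (G n) \<le> ?s (F n)" using F by (intro sum_mono2) (auto simp: F_def)
    then show ?thesis using G(3)[of n] by linarith
  qed
  have diff: "(norm (?z (F n) - ?z (F m)))\<^sup>2 \<le> inverse (Suc m)" if "m \<le> n" for m n
  proof -
    have "?z (F n) - ?z (F m) = ?z (F n - F m)"
      using mono[OF that] F(1) by (simp add: sum_diff)
    also have "(norm \<dots>)\<^sup>2 = ?s (F n - F m)"
      using F(1)[of n] F(2)[of n] by (intro norm_ortho_sum orthonormal_basis_finite_ortho[OF B]) auto
    also have "\<dots> = ?s (F n) - ?s (F m)" using mono[OF that] F(1) by (simp add: sum_diff)
    also have "\<dots> \<le> inverse (Suc m)" using D[OF F, of n] sF[of m] by linarith
    finally show ?thesis .
  qed
  have "Cauchy (\<lambda>n. ?z (F n))"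
  proof (rule metric_CauchyI)
    fix e :: real assume "e > 0"
    then obtain M where M: "inverse (Suc M) < e\<^sup>2" using reals_Archimedean[of "e\<^sup>2"] by auto
    have *: "dist (?z (F n)) (?z (F m)) < e" if "M \<le> m" "m \<le> n" for m n
    proof -
      have "inverse (real (Suc m)) \<le> inverse (real (Suc M))" using that by (intro le_imp_inverse_le) auto
      then have "(norm (?z (F n) - ?z (F m)))\<^sup>2 < e\<^sup>2" using diff[OF that(2)] M by linarith
      then show ?thesis using \<open>e > 0\<close> by (simp add: dist_norm power_less_imp_less_base)
    qed
    show "\<exists>M. \<forall>m\<ge>M. \<forall>n\<ge>M. dist (?z (F m)) (?z (F n)) < e"
    proof (intro exI[of _ M] allI impI)
      fix m n assume "m \<ge> M" "n \<ge> M"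
      then show "dist (?z (F m)) (?z (F n)) < e"
        using *[of m n] *[of n m] by (cases "m \<le> n") (simp_all add: dist_commute)
    qed
  qed
  then obtain z where z: "(\<lambda>n. ?z (F n)) \<longlonglongrightarrow> z" using Cauchy_convergent convergent_def by blast
  have "cinner e z = c e" if e: "e \<in> B" for e
  proof -
    have 1: "(\<lambda>n. cinner e (?z (F n))) \<longlonglongrightarrow> cinner e z" by (intro tendsto_intros cinner.tendsto z)
    have "(\<lambda>n. cinner e (?z (F n))) \<longlonglongrightarrow> c e"
    proof (cases "\<exists>m. e \<in> F m")
      case True
      then obtain m where m: "e \<in> F m" by blast
      have "cinner e (?z (F n)) = c e" if "m \<le> n" for n
        using mono[OF that] m F by (intro cinner_ortho_sum orthonormal_basis_finite_ortho[OF B]) auto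
      then have "\<forall>\<^sub>F n in sequentially. cinner e (?z (F n)) = c e" using eventually_sequentially by blast
      then show ?thesis by (rule tendsto_eventually)
    next
      case False
      have "(cmod (c e))\<^sup>2 < inverse (Suc n)" for n
        using D[of "insert e (F n)"] F[of n] e False sF[of n] by simp
      then have "c e = 0" by (metis norm_eq_zero not_less_iff_gr_or_eq order_less_trans reals_Archimedean zero_less_power2)
      moreover have "cinner e (?z (F n)) = 0" for n
        unfolding cinner.sum_right cinner_scaleC_right
      proof (intro sum.neutral ballI)
        fix f assume f: "f \<in> F n"
        then have "e \<noteq> f" "f \<in> B" using False F(2)[of n] by auto
        then show "c f * cinner e f = 0" using orthonormal_basis_cinner[OF B e] by simp
      qed
      ultimately show ?thesis by simp
    qed
    then show ?thesis using 1 LIMSEQ_unique by blast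
  qed
  moreover have "(norm z)\<^sup>2 \<le> C"
  proof (rule LIMSEQ_le_const2[OF tendsto_power[OF tendsto_norm[OF z]]])
    have "(norm (?z (F n)))\<^sup>2 = ?s (F n)" for n
      by (intro norm_ortho_sum orthonormal_basis_finite_ortho[OF B] F)
    then show "\<exists>N. \<forall>n\<ge>N. (norm (?z (F n)))\<^sup>2 \<le> C" using C F by auto
  qed
  ultimately show ?thesis by blast
qed

text \<open>A vector with the same coefficients as \<open>x\<close> and with norm bounded by the sums exists by
  \<open>riesz_fischer\<close>; by totality it is \<open>x\<close>.\<close>
lemma parseval_le:
  assumes B: "orthonormal_basis B"
    and C: "\<And>F. finite F \<Longrightarrow> F \<subseteq> B \<Longrightarrow> (\<Sum>e\<in>F. (cmod (cinner e x))\<^sup>2) \<le> C"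
  shows "(norm x)\<^sup>2 \<le> C"
proof -
  obtain z where z: "\<forall>e\<in>B. cinner e z = cinner e x" "(norm z)\<^sup>2 \<le> C"
    using riesz_fischer[OF B, of "\<lambda>e. cinner e x" C] C by auto
  have "\<forall>e\<in>B. cinner e (z - x) = 0" using z by (simp add: cinner_simps)
  then have "z - x = 0" using B unfolding orthonormal_basis_def by blast
  then have "z = x" by simp
  then show ?thesis using z by simp
qed

lemma parseval:
  assumes B: "orthonormal_basis B"
  shows "(\<Sum>\<^sub>\<infinity>e\<in>B. ennreal ((cmod (cinner e x))\<^sup>2)) = ennreal ((norm x)\<^sup>2)"
proof -
  let ?S = "\<Sum>\<^sub>\<infinity>e\<in>B. ennreal ((cmod (cinner e x))\<^sup>2)"
  have S: "?S = (SUP F\<in>{F. finite F \<and> F \<subseteq> B}. \<Sum>e\<in>F. ennreal ((cmod (cinner e x))\<^sup>2))"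
    by (simp add: nonneg_infsum_complete)
  have up: "?S \<le> ennreal ((norm x)\<^sup>2)"
    unfolding S using orthonormal_basis_finite_ortho[OF B]
    by (intro SUP_least) (auto simp: sum_ennreal intro!: ennreal_leI bessel_ineq)
  then have fin: "?S < top" by (meson ennreal_less_top order_le_less_trans)
  have "(norm x)\<^sup>2 \<le> enn2real ?S"
  proof (rule parseval_le[OF B])
    fix F assume F: "finite F" "F \<subseteq> B"
    have "ennreal (\<Sum>e\<in>F. (cmod (cinner e x))\<^sup>2) \<le> ?S"
      unfolding S by (subst sum_ennreal[symmetric]) (use F in \<open>auto intro!: SUP_upper\<close>)
    then show "(\<Sum>e\<in>F. (cmod (cinner e x))\<^sup>2) \<le> enn2real ?S"
      using enn2real_mono[OF _ fin, of "ennreal (\<Sum>e\<in>F. (cmod (cinner e x))\<^sup>2)"]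
      by (simp add: sum_nonneg)
  qed
  then have "ennreal ((norm x)\<^sup>2) \<le> ?S" using fin by (metis ennreal_enn2real ennreal_leI)
  with up show ?thesis by (rule antisym)
qed

section \<open>Adjoints\<close>

lemma clinear_op_scaleC: "clinear_op T \<Longrightarrow> T (c *\<^sub>C x) = c *\<^sub>C T x"
  by (simp add: clinear_op_def)

lemma clinear_op_sum: "clinear_op T \<Longrightarrow> T (\<Sum>i\<in>I. c i *\<^sub>C f i) = (\<Sum>i\<in>I. c i *\<^sub>C T (f i))"
  by (simp add: blinfun.sum_right clinear_op_scaleC)

text \<open>The functional vanishes on \<open>proj F x\<close>, and by Parseval the remaining part of \<open>x\<close> can be made
  arbitrarily small.\<close>
lemma orthonormal_basis_total:
  assumes B: "orthonormal_basis B" and f: "bounded_linear (f::'h::complex_hilbert_space \<Rightarrow> complex)"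
    and sc: "\<And>c x. f (c *\<^sub>C x) = c * f x" and 0: "\<And>e. e \<in> B \<Longrightarrow> f e = 0"
  shows "f x = 0"
proof -
  interpret bounded_linear f by fact
  obtain K where K: "\<And>x. cmod (f x) \<le> norm x * K" "K > 0" using pos_bounded by blast
  have "(norm x)\<^sup>2 \<le> (norm x)\<^sup>2 - (cmod (f x) / K)\<^sup>2"
  proof (rule parseval_le[OF B])
    fix F assume F: "finite F" "F \<subseteq> B"
    have "f (proj F x) = 0" unfolding proj_def sum sc using 0 F by (intro sum.neutral) auto
    then have "cmod (f x) \<le> norm (x - proj F x) * K" using K(1)[of "x - proj F x"] by (simp add: diff)
    then have "(cmod (f x) / K)\<^sup>2 \<le> (norm (x - proj F x))\<^sup>2" using K(2)
      by (intro power_mono) (auto simp: field_simps)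
    then show "(\<Sum>e\<in>F. (cmod (cinner e x))\<^sup>2) \<le> (norm x)\<^sup>2 - (cmod (f x) / K)\<^sup>2"
      using norm_diff_proj[OF orthonormal_basis_finite_ortho[OF B F], of x] by linarith
  qed
  then show ?thesis using K(2) by simp
qed

text \<open>The vector \<open>S y\<close> must have the coefficients \<open>\<langle>T e, y\<rangle>\<close>. Their finite square sums are bounded because
  such a sum is \<open>\<langle>T z, y\<rangle>\<close> for the partial vector \<open>z\<close> formed with the same coefficients.\<close>
lemma adjoint_exists:
  fixes T :: "'h::complex_hilbert_space \<Rightarrow>\<^sub>L 'h"
  assumes T: "clinear_op T"
  shows "\<exists>S. clinear_op S \<and> (\<forall>x y. cinner (T x) y = cinner x (S y))"
proof -
  obtain B :: "'h set" where B: "orthonormal_basis B" using orthonormal_basis_exists by blast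
  have "\<exists>z. (\<forall>x. cinner (T x) y = cinner x z) \<and> norm z \<le> norm T * norm y" for y
  proof -
    have "\<exists>z. (\<forall>e\<in>B. cinner e z = cinner (T e) y) \<and> (norm z)\<^sup>2 \<le> (norm T * norm y)\<^sup>2"
    proof (rule riesz_fischer[OF B])
      fix F assume F: "finite F" "F \<subseteq> B"
      define z where "z = (\<Sum>e\<in>F. cinner (T e) y *\<^sub>C e)"
      have nz: "(norm z)\<^sup>2 = (\<Sum>e\<in>F. (cmod (cinner (T e) y))\<^sup>2)"
        unfolding z_def by (rule norm_ortho_sum[OF orthonormal_basis_finite_ortho[OF B F]])
      have "cinner (T z) y = (\<Sum>e\<in>F. cnj (cinner (T e) y) * cinner (T e) y)"
        unfolding z_def clinear_op_sum[OF T] by (simp add: cinner.sum_left cinner_scaleC_left)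
      also have "\<dots> = of_real ((norm z)\<^sup>2)"
        unfolding nz by (simp only: cnj_mult_self of_real_sum)
      finally have "(norm z)\<^sup>2 = cmod (cinner (T z) y)" by (simp add: norm_power)
      also have "\<dots> \<le> norm (T z) * norm y" by (rule norm_cinner_le)
      also have "\<dots> \<le> norm T * norm z * norm y" by (intro mult_right_mono norm_blinfun) auto
      finally have "norm z \<le> norm T * norm y"
        by (cases "z = 0") (auto simp: power2_eq_square)
      then show "(\<Sum>e\<in>F. (cmod (cinner (T e) y))\<^sup>2) \<le> (norm T * norm y)\<^sup>2"
        unfolding nz[symmetric] by (intro power_mono) auto
    qed
    then obtain z where z: "\<forall>e\<in>B. cinner e z = cinner (T e) y" "(norm z)\<^sup>2 \<le> (norm T * norm y)\<^sup>2" by blast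
    have "cinner z x - cinner y (T x) = 0" for x
    proof (rule orthonormal_basis_total[OF B, where f = "\<lambda>x. cinner z x - cinner y (T x)"])
      show "bounded_linear (\<lambda>x. cinner z x - cinner y (T x))"
        by (intro bounded_linear_sub cinner.bounded_linear_right
            bounded_linear_compose[OF cinner.bounded_linear_right] blinfun.bounded_linear_right)
      show "cinner z e - cinner y (T e) = 0" if "e \<in> B" for e
        using z(1) that by (metis cinner_commute diff_self)
    qed (simp add: cinner_simps clinear_op_scaleC[OF T] algebra_simps)
    then have "cinner (T x) y = cinner x z" for x
      by (metis cinner_commute right_minus_eq)
    moreover have "norm z \<le> norm T * norm y" using z(2) by (rule power2_le_imp_le) simp
    ultimately show ?thesis by blast
  qed
  then obtain S where S: "\<And>x y. cinner (T x) y = cinner x (S y)" "\<And>y. norm (S y) \<le> norm T * norm y" by metis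
  have sc: "S (c *\<^sub>C x) = c *\<^sub>C S x" for c x
    by (rule cinner_ext) (simp add: cinner_simps flip: S(1))
  have "bounded_linear S"
  proof (rule bounded_linear_intro[where K = "norm T"])
    show "S (x + y) = S x + S y" for x y
      by (rule cinner_ext) (simp add: cinner_simps flip: S(1))
  qed (use S(2) in \<open>simp_all add: scaleR_scaleC sc mult.commute\<close>)
  then have "blinfun_apply (Blinfun S) = S" by (rule bounded_linear_Blinfun_apply)
  then show ?thesis using S(1) sc by (intro exI[of _ "Blinfun S"]) (simp add: clinear_op_def)
qed

lemma
  fixes T :: "'h::complex_hilbert_space \<Rightarrow>\<^sub>L 'h"
  assumes T: "clinear_op T"
  shows clinear_op_adjoint: "clinear_op (adjoint_op T)"
    and cinner_adjoint: "cinner (T x) y = cinner x (adjoint_op T y)"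
proof -
  let ?P = "\<lambda>S. clinear_op S \<and> (\<forall>x y. cinner (T x) y = cinner x (S y))"
  have "\<exists>!S. ?P S"
  proof (rule ex_ex1I[OF adjoint_exists[OF T]])
    fix S S' assume "?P S" "?P S'"
    then show "S = S'" by (intro blinfun_eqI cinner_ext) metis
  qed
  from theI'[OF this] have "?P (adjoint_op T)" unfolding adjoint_op_def .
  then show "clinear_op (adjoint_op T)" "cinner (T x) y = cinner x (adjoint_op T y)" by auto
qed

section \<open>Diagonalization on finite-dimensional subspaces\<close>

lemma bounded_linear_proj: "bounded_linear (proj E)"
  unfolding proj_def
proof (intro bounded_linear_sum)
  fix e assume "e \<in> E"
  show "bounded_linear (\<lambda>x. cinner e x *\<^sub>C e)"
  proof (rule bounded_linear_intro[where K = "norm e * norm e"])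
    show "norm (cinner e x *\<^sub>C e) \<le> norm x * (norm e * norm e)" for x
      using norm_cinner_le[of e x] mult_right_mono[of _ _ "norm e"]
      by (fastforce simp: norm_scaleC mult_ac)
  qed (simp_all add: cinner_simps scaleC_add_left scaleR_scaleC scaleC_scaleC)
qed

text \<open>The sphere is closed and lies in the Minkowski sum of the compact discs \<open>{c *\<^sub>C e | |c| \<le> 1}\<close>.\<close>
lemma compact_proj_sphere:
  fixes E :: "'h::complex_hilbert_space set"
  assumes E: "finite_ortho E"
  shows "compact {x. proj E x = x \<and> norm x = 1}"
proof -
  have "finite E" using E by (simp add: finite_ortho_def)
  then have K: "compact {\<Sum>e\<in>E. c e *\<^sub>C e | c. \<forall>e\<in>E. cmod (c e) \<le> 1}"
  proof induction
    case empty
    have "{\<Sum>e\<in>{}. c e *\<^sub>C (e::'h) | c. \<forall>e\<in>{}. cmod (c e) \<le> 1} = {0}" by auto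
    then show ?case by simp
  next
    case (insert f E)
    let ?K = "{\<Sum>e\<in>E. c e *\<^sub>C e | c. \<forall>e\<in>E. cmod (c e) \<le> 1}"
    let ?L = "(\<lambda>c. c *\<^sub>C f) ` cball 0 1"
    have "compact {x + y | x y. x \<in> ?L \<and> y \<in> ?K}"
      by (intro compact_sums insert.IH compact_continuous_image
          continuous_on_subset[OF continuous_on_scaleC_left]) auto
    moreover have "{x + y | x y. x \<in> ?L \<and> y \<in> ?K}
        = {\<Sum>e\<in>insert f E. c e *\<^sub>C e | c. \<forall>e\<in>insert f E. cmod (c e) \<le> 1}"
    proof safe
      fix a :: complex and c assume *: "a \<in> cball 0 1" "\<forall>e\<in>E. cmod (c e) \<le> 1"
      have "(\<Sum>e\<in>E. (c(f := a)) e *\<^sub>C e) = (\<Sum>e\<in>E. c e *\<^sub>C e)"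
        using insert.hyps by (intro sum.cong) auto
      then have "a *\<^sub>C f + (\<Sum>e\<in>E. c e *\<^sub>C e) = (\<Sum>e\<in>insert f E. (c(f := a)) e *\<^sub>C e)"
        using insert.hyps by simp
      then show "\<exists>d. a *\<^sub>C f + (\<Sum>e\<in>E. c e *\<^sub>C e) = (\<Sum>e\<in>insert f E. d e *\<^sub>C e) \<and> (\<forall>e\<in>insert f E. cmod (d e) \<le> 1)"
        using * by (intro exI[of _ "c(f := a)"]) auto
    next
      fix c assume *: "\<forall>e\<in>insert f E. cmod (c e) \<le> 1"
      have "(\<Sum>e\<in>insert f E. c e *\<^sub>C e) = c f *\<^sub>C f + (\<Sum>e\<in>E. c e *\<^sub>C e)"
        using insert.hyps by simp
      then show "\<exists>x y. (\<Sum>e\<in>insert f E. c e *\<^sub>C e) = x + y \<and> x \<in> ?L \<and> y \<in> ?K"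
        using * by (intro exI[of _ "c f *\<^sub>C f"] exI[of _ "\<Sum>e\<in>E. c e *\<^sub>C e"]) auto
    qed
    ultimately show ?case by simp
  qed
  have "continuous_on UNIV (proj E)"
    using bounded_linear_proj by (rule linear_continuous_on)
  then have "closed {x. proj E x = x \<and> norm x = 1}"
    by (intro closed_Collect_conj closed_Collect_eq continuous_intros) auto
  moreover have "{x. proj E x = x \<and> norm x = 1}
      \<subseteq> {\<Sum>e\<in>E. c e *\<^sub>C e | c. \<forall>e\<in>E. cmod (c e) \<le> 1}"
  proof safe
    fix x assume x: "proj E x = x" "norm x = 1"
    have "x = (\<Sum>e\<in>E. cinner e x *\<^sub>C e)" using x(1) by (simp add: proj_def)
    moreover have "cmod (cinner e x) \<le> 1" if "e \<in> E" for e
      using norm_cinner_le[of e x] norm_ortho[OF E that] x by simp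
    ultimately show "\<exists>c. x = (\<Sum>e\<in>E. c e *\<^sub>C e) \<and> (\<forall>e\<in>E. cmod (c e) \<le> 1)"
      by (intro exI[of _ "\<lambda>e. cinner e x"]) simp
  qed
  ultimately show ?thesis using compact_Int_closed[OF K, of "{x. proj E x = x \<and> norm x = 1}"]
    by (simp only: Int_absorb1)
qed

text \<open>The first-order condition at a maximum of the Rayleigh quotient on the part of the subspace orthogonal
  to the eigenvectors already found. Moving from \<open>v\<close> in the direction of the residual
  \<open>z = proj E (T v) - \<langle>v, T v\<rangle> v\<close> increases the quotient at the rate \<open>2 \<parallel>z\<parallel>\<^sup>2\<close>, hence \<open>z = 0\<close>.\<close>
lemma rayleigh_maximizer:
  fixes T :: "'h::complex_hilbert_space \<Rightarrow>\<^sub>L 'h"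
  assumes herm: "\<And>x y. cinner (T x) y = cinner x (T y)"
    and T: "clinear_op T"
    and max: "\<And>y. proj E y = y \<Longrightarrow> (\<forall>w\<in>V. cinner w y = 0) \<Longrightarrow> Re (cinner y (T y)) \<le> m * (norm y)\<^sup>2"
    and E: "finite_ortho E"
    and V: "\<And>w. w \<in> V \<Longrightarrow> proj E w = w" "\<And>w. w \<in> V \<Longrightarrow> \<exists>c. proj E (T w) = c *\<^sub>C w"
    and v: "proj E v = v" "norm v = 1" "\<And>w. w \<in> V \<Longrightarrow> cinner w v = 0" "m = Re (cinner v (T v))"
  shows "proj E (T v) = cinner v (T v) *\<^sub>C v"
proof (rule ccontr)
  assume neq: "proj E (T v) \<noteq> cinner v (T v) *\<^sub>C v"
  define z where "z = proj E (T v) - cinner v (T v) *\<^sub>C v"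
  have "z \<noteq> 0" using neq by (simp add: z_def)
  have vv: "cinner v v = 1" using v(2) by (simp add: cinner_self)
  have zE: "proj E z = z" by (simp add: z_def proj_diff proj_scaleC proj_idem[OF E] v(1))
  have vz: "cinner v z = 0"
    using proj_selfadjoint[of E v "T v"] by (simp add: z_def cinner_simps vv v(1))
  then have zv: "cinner z v = 0" using cinner_commute[of z v] by simp
  have wz: "cinner w z = 0" if w: "w \<in> V" for w
  proof -
    obtain c where c: "proj E (T w) = c *\<^sub>C w" using V(2)[OF w] by blast
    have "cinner w (proj E (T v)) = cinner (T w) v"
      using proj_selfadjoint[of E w "T v"] V(1)[OF that] by (simp add: herm)
    also have "\<dots> = cinner (proj E (T w)) v" by (simp add: proj_selfadjoint v(1))
    also have "\<dots> = 0" by (simp add: c cinner_simps v(3)[OF that])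
    finally show ?thesis by (simp add: z_def cinner_simps v(3)[OF that])
  qed
  have "cinner z (T v) = cinner z (proj E (T v))" using zE proj_selfadjoint[of E z "T v"] by simp
  also have "proj E (T v) = z + cinner v (T v) *\<^sub>C v" by (simp add: z_def)
  also have "cinner z \<dots> = cinner z z" by (simp add: cinner_simps zv)
  finally have zTv: "cinner z (T v) = of_real ((norm z)\<^sup>2)" by (simp add: cinner_self)
  have vTz: "cinner v (T z) = of_real ((norm z)\<^sup>2)"
    using zTv herm[of v z] cinner_commute[of "T v" z] by simp
  have ineq: "2 * t * (norm z)\<^sup>2 \<le> t\<^sup>2 * (m * (norm z)\<^sup>2 - Re (cinner z (T z)))" for t :: real
  proof -
    let ?y = "v + complex_of_real t *\<^sub>C z"
    have "cinner ?y ?y = of_real (1 + t\<^sup>2 * (norm z)\<^sup>2)"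
      by (simp add: cinner_simps vv vz zv cinner_self[of z] power2_eq_square)
    then have n: "(norm ?y)\<^sup>2 = 1 + t\<^sup>2 * (norm z)\<^sup>2" unfolding cinner_self using of_real_eq_iff by blast
    have "Re (cinner ?y (T ?y)) \<le> m * (norm ?y)\<^sup>2"
      using wz v(3) by (intro max) (auto simp: proj_add proj_scaleC v(1) zE cinner_simps)
    moreover have "Re (cinner ?y (T ?y)) = m + 2 * t * (norm z)\<^sup>2 + t\<^sup>2 * Re (cinner z (T z))"
      by (simp add: cinner_simps blinfun.add_right clinear_op_scaleC[OF T] zTv vTz v(4) power2_eq_square algebra_simps)
    ultimately show ?thesis unfolding n by (simp add: algebra_simps)
  qed
  define a where "a = (norm z)\<^sup>2"
  define C where "C = m * (norm z)\<^sup>2 - Re (cinner z (T z))"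
  have a: "a > 0" using \<open>z \<noteq> 0\<close> by (simp add: a_def)
  \<comment> \<open>The inequality has the shape \<open>2 t a \<le> t\<^sup>2 C\<close> with \<open>a > 0\<close>, which fails for small positive \<open>t\<close>.\<close>
  define t where "t = a / (\<bar>C\<bar> + 1)"
  have t: "t > 0" using a by (simp add: t_def)
  have "2 * t * a \<le> t\<^sup>2 * C" using ineq[of t] by (simp add: a_def C_def)
  then have "2 * a \<le> t * C" using t by (simp add: power2_eq_square mult.assoc mult.left_commute)
  also have "\<dots> \<le> t * (\<bar>C\<bar> + 1)" using t by (intro mult_left_mono) auto
  also have "\<dots> = a" by (simp add: t_def)
  finally show False using a by simp
qed

text \<open>The double sum \<open>\<Sum> |\<langle>e, v\<rangle>|\<^sup>2\<close> equals \<open>card V\<close>, because \<open>V\<close> lies in the span of \<open>E\<close>, and is at most \<open>card E\<close>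
  by Bessel's inequality.\<close>
lemma card_ortho_le:
  assumes E: "finite_ortho E" and V: "finite_ortho V" "\<And>v. v \<in> V \<Longrightarrow> proj E v = v"
  shows "card V \<le> card E"
proof -
  have "real (card V) = (\<Sum>v\<in>V. (norm (proj E v))\<^sup>2)" using V norm_ortho[OF V(1)] by simp
  also have "\<dots> = (\<Sum>e\<in>E. \<Sum>v\<in>V. (cmod (cinner v e))\<^sup>2)"
    unfolding norm_proj[OF E] by (subst sum.swap) (intro sum.cong refl arg_cong[of _ _ "\<lambda>t. t\<^sup>2"] cmod_cinner_commute)
  also have "\<dots> \<le> (\<Sum>e\<in>E. (norm e)\<^sup>2)" by (intro sum_mono bessel_ineq V)
  also have "\<dots> = real (card E)" using norm_ortho[OF E] by simp
  finally show ?thesis by simp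
qed

text \<open>The spectral theorem for the compression of \<open>T\<close> to the span of \<open>E\<close>. Among the orthonormal sets of
  eigenvectors of the compression take one of maximal cardinality. If it did not span the subspace, the
  Rayleigh quotient would attain its maximum on the unit sphere of the orthogonal complement, at a
  further eigenvector.\<close>
lemma hermitian_compression_diagonal:
  fixes T :: "'h::complex_hilbert_space \<Rightarrow>\<^sub>L 'h"
  assumes T: "clinear_op T" and herm: "\<And>x y. cinner (T x) y = cinner x (T y)"
    and E: "finite_ortho E"
  shows "\<exists>V. finite_ortho V \<and> (\<forall>x. proj V x = proj E x) \<and> (\<forall>v\<in>V. \<forall>w\<in>V. v \<noteq> w \<longrightarrow> cinner v (T w) = 0)"
proof -
  define P where "P V \<longleftrightarrow> finite_ortho V \<and> (\<forall>v\<in>V. proj E v = v) \<and> (\<forall>v\<in>V. proj E (T v) = cinner v (T v) *\<^sub>C v)" for V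
  have "P {}" by (simp add: P_def finite_ortho_def)
  moreover have "\<forall>V. P V \<longrightarrow> card V < Suc (card E)" using card_ortho_le[OF E] by (auto simp: P_def less_Suc_eq_le)
  ultimately obtain V where V: "P V" and maxV: "\<And>W. P W \<Longrightarrow> card W \<le> card V"
    using ex_has_greatest_nat[of P "{}" card "Suc (card E)"] by blast
  have o: "finite_ortho V" using V by (simp add: P_def)
  have span: "proj V x = x" if x: "proj E x = x" for x
  proof (rule ccontr)
    assume neq: "proj V x \<noteq> x"
    define y where "y = x - proj V x"
    have PE: "proj E (proj V x) = proj V x"
      unfolding proj_def[of V] proj_sum using V by (intro sum.cong) (auto simp: P_def)
    have y: "y \<noteq> 0" "proj E y = y" "\<forall>w\<in>V. cinner w y = 0"
      using neq by (auto simp: y_def proj_diff x PE cinner_simps cinner_proj[OF o])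
    define S where "S = {x. proj E x = x \<and> norm x = 1} \<inter> {y. \<forall>w\<in>V. cinner w y = 0}"
    have "closed {y. \<forall>w\<in>V. cinner w y = (0::complex)}"
      unfolding Collect_ball_eq
      by (intro closed_INT ballI closed_Collect_eq cinner.continuous_on continuous_intros)
    then have cS: "compact S" unfolding S_def by (intro compact_Int_closed compact_proj_sphere E)
    have nS: "complex_of_real (1 / norm u) *\<^sub>C u \<in> S" if "u \<noteq> 0" "proj E u = u" "\<forall>w\<in>V. cinner w u = 0" for u
      using that by (auto simp: S_def proj_scaleC norm_scaleC norm_divide cinner_simps)
    then have "S \<noteq> {}" using y by blast
    moreover have "continuous_on S (\<lambda>y. Re (cinner y (T y)))"
      by (intro continuous_intros cinner.continuous_on)
    ultimately obtain v where v: "v \<in> S" and vmax: "\<And>u. u \<in> S \<Longrightarrow> Re (cinner u (T u)) \<le> Re (cinner v (T v))"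
      using continuous_attains_sup[OF cS] by blast
    have eig: "proj E (T v) = cinner v (T v) *\<^sub>C v"
    proof (rule rayleigh_maximizer[OF herm T _ E])
      fix u assume u: "proj E u = u" "\<forall>w\<in>V. cinner w u = 0"
      show "Re (cinner u (T u)) \<le> Re (cinner v (T v)) * (norm u)\<^sup>2"
      proof (cases "u = 0")
        case False
        have "Re (cinner (complex_of_real a *\<^sub>C u) (T (complex_of_real a *\<^sub>C u))) = a\<^sup>2 * Re (cinner u (T u))" for a
          by (simp add: clinear_op_scaleC[OF T] cinner_simps power2_eq_square)
        then have "(1 / norm u)\<^sup>2 * Re (cinner u (T u)) \<le> Re (cinner v (T v))"
          using vmax[OF nS[OF False u]] by metis
        then show ?thesis using False by (simp add: power_divide divide_le_eq)
      qed simp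
    qed (use v V in \<open>auto simp: S_def P_def\<close>)
    have o': "finite_ortho (insert v V)"
      using v by (intro finite_ortho_insert o) (auto simp: S_def)
    have "P (insert v V)" using V o' eig v by (auto simp: P_def S_def)
    moreover have "v \<notin> V" using v norm_ortho[OF o, of v] cinner_self[of v] by (auto simp: S_def)
    ultimately show False using maxV[of "insert v V"] o by (simp add: finite_ortho_def)
  qed
  have "proj V x = proj E x" for x
  proof -
    have "cinner v (proj E x) = cinner v x" if "v \<in> V" for v
      using proj_selfadjoint[of E v x] V that by (simp add: P_def)
    then have "proj V (proj E x) = proj V x" by (simp add: proj_def[of V] cong: sum.cong)
    then show ?thesis using span[OF proj_idem[OF E]] by simp
  qed
  moreover have "cinner v (T w) = 0" if "v \<in> V" "w \<in> V" "v \<noteq> w" for v w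
  proof -
    have "cinner v (T w) = cinner v (proj E (T w))"
      using proj_selfadjoint[of E v "T w"] V that by (simp add: P_def)
    also have "\<dots> = cinner w (T w) * cinner v w" using V that by (simp add: P_def cinner_simps)
    also have "cinner v w = 0" using o that by (simp add: finite_ortho_def)
    finally show ?thesis by simp
  qed
  ultimately show ?thesis using o by blast
qed

text \<open>The off-diagonal entries of the compression of \<open>T\<^sup>* T\<close> are the inner products \<open>\<langle>T v, T w\<rangle>\<close>.\<close>
lemma singular_basis:
  fixes T :: "'h::complex_hilbert_space \<Rightarrow>\<^sub>L 'h"
  assumes T: "clinear_op T" and E: "finite_ortho E"
  shows "\<exists>V. finite_ortho V \<and> (\<forall>x. proj V x = proj E x) \<and> (\<forall>v\<in>V. \<forall>w\<in>V. v \<noteq> w \<longrightarrow> cinner (T v) (T w) = 0)"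
proof -
  let ?H = "adjoint_op T o\<^sub>L T"
  have H: "cinner x (?H y) = cinner (T x) (T y)" for x y by (simp add: cinner_adjoint[OF T])
  then have "cinner (?H x) y = cinner (T x) (T y)" for x y by (metis cinner_commute)
  moreover have "clinear_op ?H" using T clinear_op_adjoint[OF T] by (simp add: clinear_op_def)
  ultimately show ?thesis using hermitian_compression_diagonal[of ?H, OF _ _ E] H by simp
qed

section \<open>Functional calculus of a positive operator\<close>

definition positive_op :: "('h::complex_hilbert_space \<Rightarrow>\<^sub>L 'h) \<Rightarrow> bool" where
  "positive_op T \<longleftrightarrow> clinear_op T \<and> (\<forall>x y. cinner (T x) y = cinner x (T y)) \<and> (\<forall>x. 0 \<le> Re (cinner x (T x)))"

lemma op_poly_apply: "op_poly P T x = (\<Sum>i\<le>degree P. coeff P i *\<^sub>R (blinfun_apply T ^^ i) x)"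
proof -
  have "(((o\<^sub>L) T ^^ i) id_blinfun) x = (blinfun_apply T ^^ i) x" for i
    by (induction i) auto
  then show ?thesis by (simp add: op_poly_def blinfun.sum_left blinfun.scaleR_left)
qed

text \<open>The operator with eigenvalues \<open>a v\<close> on the orthonormal set \<open>V\<close>, and zero on its orthogonal complement.\<close>
definition diag :: "'h::complex_hilbert_space set \<Rightarrow> ('h \<Rightarrow> real) \<Rightarrow> 'h \<Rightarrow> 'h" where
  "diag V a x = (\<Sum>v\<in>V. (of_real (a v) * cinner v x) *\<^sub>C v)"

lemma diag_diff: "diag V a x - diag V b x = diag V (\<lambda>v. a v - b v) x"
  by (simp add: diag_def left_diff_distrib scaleC_diff_left sum_subtractf)

lemma diag_scaleC: "diag V a (c *\<^sub>C x) = c *\<^sub>C diag V a x"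
  by (simp add: diag_def clinear_scaleC_sum scaleC_scaleC cinner_simps mult_ac)

lemma cinner_diag: "cinner x (diag V a y) = (\<Sum>v\<in>V. of_real (a v) * (cinner x v * cinner v y))"
  by (simp add: diag_def cinner.sum_right cinner_simps mult_ac)

lemma diag_selfadjoint: "cinner (diag V a x) y = cinner x (diag V a y)"
  unfolding cinner_diag using cinner_commute[of x]
  by (simp add: diag_def cinner.sum_left cinner_simps mult_ac)

lemma Re_cinner_diag: "Re (cinner x (diag V a x)) = (\<Sum>v\<in>V. a v * (cmod (cinner v x))\<^sup>2)"
proof -
  have "cinner x v * cinner v x = of_real ((cmod (cinner v x))\<^sup>2)" for v
    by (metis cinner_commute cnj_mult_self)
  then show ?thesis by (simp only: cinner_diag Re_sum of_real_mult[symmetric] Re_complex_of_real)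
qed

lemma cinner_diag_diag:
  assumes "finite_ortho V"
  shows "cinner (diag V a x) (diag V b y) = cinner x (diag V (\<lambda>v. a v * b v) y)"
  unfolding diag_def[of V a] diag_def[of V b] cinner_ortho_sums[OF assms] cinner_diag
  using cinner_commute[of x] by (intro sum.cong refl) (simp add: mult_ac)

lemma norm_diag_le:
  assumes V: "finite_ortho V" and a: "\<And>v. v \<in> V \<Longrightarrow> \<bar>a v\<bar> \<le> e" and e: "0 \<le> e"
  shows "norm (diag V a x) \<le> e * norm x"
proof -
  have "(norm (diag V a x))\<^sup>2 = (\<Sum>v\<in>V. \<bar>a v\<bar>\<^sup>2 * (cmod (cinner v x))\<^sup>2)"
    by (simp only: diag_def norm_ortho_sum[OF V] norm_mult norm_of_real power_mult_distrib)
  also have "\<dots> \<le> (\<Sum>v\<in>V. e\<^sup>2 * (cmod (cinner v x))\<^sup>2)"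
    by (intro sum_mono mult_right_mono power_mono a) auto
  also have "\<dots> \<le> (e * norm x)\<^sup>2"
    unfolding sum_distrib_left[symmetric] power_mult_distrib by (intro mult_left_mono bessel_ineq V) auto
  finally show ?thesis by (rule power2_le_imp_le) (use e in simp)
qed

text \<open>The space contains all vectors \<open>T\<^sup>i x\<close> with \<open>i \<le> d\<close>. Hence on \<open>x\<close> a polynomial of degree at most \<open>d\<close>
  in \<open>T\<close> agrees with the same polynomial in the compression of \<open>T\<close>, which can be diagonalized. The
  eigenvalues are Rayleigh quotients of \<open>T\<close>, so they lie in \<open>[0, \<parallel>T\<parallel>]\<close>.\<close>
lemma op_poly_diagonal:
  fixes T :: "'h::complex_hilbert_space \<Rightarrow>\<^sub>L 'h"
  assumes T: "positive_op T" and S: "finite S"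
  obtains V l where "finite_ortho V" "\<And>x. x \<in> S \<Longrightarrow> proj V x = x"
    "\<And>v. v \<in> V \<Longrightarrow> l v \<in> {0..norm T}" "\<And>v. v \<in> V \<Longrightarrow> cinner v (T v) = of_real (l v)"
    "\<And>P x. degree P \<le> d \<Longrightarrow> x \<in> S \<Longrightarrow> op_poly P T x = diag V (\<lambda>v. poly P (l v)) x"
proof -
  have lin: "clinear_op T" and herm: "\<And>x y. cinner (T x) y = cinner x (T y)"
    and pos: "\<And>x. 0 \<le> Re (cinner x (T x))" using T by (auto simp: positive_op_def)
  let ?K = "(\<lambda>(i, x). (blinfun_apply T ^^ i) x) ` ({..d} \<times> S)"
  have "finite ?K" using S by simp
  from ortho_containing[OF this] obtain E where E: "finite_ortho E" "\<forall>x\<in>?K. proj E x = x" by blast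
  obtain V where V: "finite_ortho V" "\<And>x. proj V x = proj E x"
    "\<And>v w. v \<in> V \<Longrightarrow> w \<in> V \<Longrightarrow> v \<noteq> w \<Longrightarrow> cinner v (T w) = 0"
    using hermitian_compression_diagonal[OF lin herm E(1)] by blast
  define l where "l v = Re (cinner v (T v))" for v
  have l: "cinner v (T v) = of_real (l v)" for v
    using herm[of v v] cinner_commute[of v "T v"] by (simp add: l_def complex_eq_iff)
  have l_range: "l v \<in> {0..norm T}" if "v \<in> V" for v
  proof -
    have "l v \<le> cmod (cinner v (T v))" by (simp add: l_def complex_Re_le_cmod)
    also have "\<dots> \<le> norm v * norm (T v)" by (rule norm_cinner_le)
    also have "\<dots> \<le> norm T" using norm_ortho[OF V(1) that] norm_blinfun[of T v] by simp
    finally show ?thesis using pos[of v] by (simp add: l_def)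
  qed
  have PT: "proj V (T w) = of_real (l w) *\<^sub>C w" if "w \<in> V" for w
  proof -
    have "proj V (T w) = (\<Sum>v\<in>V. if v = w then of_real (l w) *\<^sub>C w else 0)"
      unfolding proj_def using V(3) that by (intro sum.cong) (auto simp: l)
    then show ?thesis using that V(1) by (simp add: finite_ortho_def)
  qed
  have K: "proj V ((blinfun_apply T ^^ i) x) = (blinfun_apply T ^^ i) x" if "i \<le> d" "x \<in> S" for i x
    using E(2) that V(2) by auto
  have pw: "(blinfun_apply T ^^ i) x = (\<Sum>v\<in>V. (of_real (l v ^ i) * cinner v x) *\<^sub>C v)"
    if "i \<le> d" "x \<in> S" for i x
    using that(1)
  proof (induction i)
    case 0
    then show ?case using K[of 0 x] that(2) by (simp add: proj_def)
  next
    case (Suc i)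
    have "(blinfun_apply T ^^ Suc i) x = proj V (T ((blinfun_apply T ^^ i) x))"
      using K[OF Suc.prems that(2)] by simp
    also have "\<dots> = (\<Sum>v\<in>V. (of_real (l v ^ i) * cinner v x) *\<^sub>C proj V (T v))"
      using Suc by (simp add: clinear_op_sum[OF lin] proj_sum)
    also have "\<dots> = (\<Sum>v\<in>V. (of_real (l v ^ Suc i) * cinner v x) *\<^sub>C v)"
      by (intro sum.cong refl) (simp add: PT scaleC_scaleC mult_ac)
    finally show ?case .
  qed
  show thesis
  proof
    show "proj V x = x" if "x \<in> S" for x using K[of 0 x] that by simp
    fix P :: "real poly" and x assume P: "degree P \<le> d" and x: "x \<in> S"
    have "op_poly P T x = (\<Sum>i\<le>degree P. \<Sum>v\<in>V. (of_real (coeff P i * l v ^ i) * cinner v x) *\<^sub>C v)"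
      unfolding op_poly_apply
    proof (intro sum.cong refl)
      fix i assume "i \<in> {..degree P}"
      then have "i \<le> d" using P by simp
      then show "coeff P i *\<^sub>R (blinfun_apply T ^^ i) x = (\<Sum>v\<in>V. (of_real (coeff P i * l v ^ i) * cinner v x) *\<^sub>C v)"
        by (simp add: pw[OF _ x] scaleR_scaleC clinear_scaleC_sum scaleC_scaleC mult_ac)
    qed
    also have "\<dots> = (\<Sum>v\<in>V. \<Sum>i\<le>degree P. (of_real (coeff P i * l v ^ i) * cinner v x) *\<^sub>C v)"
      by (rule sum.swap)
    also have "\<dots> = (\<Sum>v\<in>V. (of_real (poly P (l v)) * cinner v x) *\<^sub>C v)"
    proof (intro sum.cong refl)
      fix v :: 'h
      have sl: "(\<Sum>i\<in>I. c i *\<^sub>C v) = (\<Sum>i\<in>I. c i) *\<^sub>C v" for c :: "nat \<Rightarrow> complex" and I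
        by (induction I rule: infinite_finite_induct) (auto simp: scaleC_add_left)
      show "(\<Sum>i\<le>degree P. (of_real (coeff P i * l v ^ i) * cinner v x) *\<^sub>C v) = (of_real (poly P (l v)) * cinner v x) *\<^sub>C v"
        unfolding sl poly_altdef by (simp add: sum_distrib_right)
    qed
    finally show "op_poly P T x = diag V (\<lambda>v. poly P (l v)) x" unfolding diag_def .
  qed (use V(1) l l_range in auto)
qed

text \<open>The norm estimate of the functional calculus, applied to \<open>P - Q\<close>. Both polynomials are diagonalized by
  the same finite orthonormal set at the given vector.\<close>
lemma norm_op_poly_diff:
  assumes T: "positive_op T" and e: "\<And>t. t \<in> {0..norm T} \<Longrightarrow> \<bar>poly P t - poly Q t\<bar> \<le> e"
  shows "norm (op_poly P T - op_poly Q T) \<le> e"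
proof (rule norm_blinfun_bound)
  show e0: "0 \<le> e" using e[of 0] by simp
  fix x
  show "norm ((op_poly P T - op_poly Q T) x) \<le> e * norm x"
  proof (rule op_poly_diagonal[OF T, of "{x}" "max (degree P) (degree Q)"])
    fix V l
    assume V: "finite_ortho V" and l: "\<And>v. v \<in> V \<Longrightarrow> l v \<in> {0..norm T}"
      and p: "\<And>P' y. degree P' \<le> max (degree P) (degree Q) \<Longrightarrow> y \<in> {x} \<Longrightarrow>
        op_poly P' T y = diag V (\<lambda>v. poly P' (l v)) y"
    show "norm ((op_poly P T - op_poly Q T) x) \<le> e * norm x"
      unfolding blinfun.diff_left by (subst (1 2) p) (auto simp: diag_diff intro!: norm_diag_le V e e0 l[simplified])
  qed simp
qed

lemma poly_approximates_powr:
  assumes "r > 0"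
  shows "\<exists>P::nat \<Rightarrow> real poly. uniform_limit {0..b} (\<lambda>n. poly (P n)) (\<lambda>t. t powr r) sequentially"
proof -
  have "\<exists>P. \<forall>t\<in>{0..b}. \<bar>t powr r - poly P t\<bar> < inverse (Suc n)" for n
  proof -
    have "continuous_on {0..b} (\<lambda>t::real. t powr r)"
      using assms by (intro continuous_on_powr' continuous_intros) auto
    then obtain g where g: "real_polynomial_function g" "\<And>t. t \<in> {0..b} \<Longrightarrow> \<bar>t powr r - g t\<bar> < inverse (Suc n)"
      using Stone_Weierstrass_real_polynomial_function[of "{0..b}" "\<lambda>t. t powr r" "inverse (Suc n)"] by auto
    then obtain a m where "g = (\<lambda>x. \<Sum>i\<le>m. a i * x ^ i)" by (auto simp: real_polynomial_function_iff_sum)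
    then have "g = poly (\<Sum>i\<le>m. monom (a i) i)" by (simp add: fun_eq_iff poly_sum poly_monom)
    then have "\<bar>t powr r - poly (\<Sum>i\<le>m. monom (a i) i) t\<bar> < inverse (Suc n)" if "t \<in> {0..b}" for t
      using g(2)[OF that] by (simp only:)
    then show ?thesis by blast
  qed
  then obtain P where P: "\<And>n t. t \<in> {0..b} \<Longrightarrow> \<bar>t powr r - poly (P n) t\<bar> < inverse (Suc n)" by metis
  have "uniform_limit {0..b} (\<lambda>n. poly (P n)) (\<lambda>t. t powr r) sequentially"
  proof (rule uniform_limitI)
    fix e :: real assume "e > 0"
    then have "\<forall>\<^sub>F n in sequentially. inverse (Suc n) < e"
      using order_tendstoD(2)[OF LIMSEQ_inverse_real_of_nat] by blast
    then show "\<forall>\<^sub>F n in sequentially. \<forall>t\<in>{0..b}. dist (poly (P n) t) (t powr r) < e"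
    proof eventually_elim
      case (elim n)
      show ?case
      proof
        fix t assume "t \<in> {0..b}"
        then show "dist (poly (P n) t) (t powr r) < e"
          using P[of t n] elim unfolding dist_real_def by linarith
      qed
    qed
  qed
  then show ?thesis by blast
qed

text \<open>Polynomials that are uniformly close on \<open>[0, \<parallel>T\<parallel>]\<close> give close operators. Therefore every approximating
  sequence yields a Cauchy sequence of operators, and all of them have the same limit, which the
  definite description in \<open>op_powr\<close> picks.\<close>
lemma op_powr_limit:
  assumes T: "positive_op T" and r: "r > 0"
    and P: "uniform_limit {0..norm T} (\<lambda>n. poly (P n)) (\<lambda>t. t powr r) sequentially"
  shows "(\<lambda>n. op_poly (P n) T) \<longlonglongrightarrow> op_powr T r"
proof -
  let ?U = "\<lambda>P. uniform_limit {0..norm T} (\<lambda>n. poly (P n)) (\<lambda>t. t powr r) sequentially"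
  have close: "\<exists>N. \<forall>m\<ge>N. \<forall>n\<ge>N. norm (op_poly (P m) T - op_poly (Q n) T) < e"
    if P: "?U P" and Q: "?U Q" and e: "e > 0" for P Q e
  proof -
    have "\<forall>\<^sub>F n in sequentially. \<forall>t\<in>{0..norm T}. dist (poly (P n) t) (t powr r) < e/4"
      "\<forall>\<^sub>F n in sequentially. \<forall>t\<in>{0..norm T}. dist (poly (Q n) t) (t powr r) < e/4"
      using e by (intro uniform_limitD[OF P] uniform_limitD[OF Q]; simp)+
    then have "\<forall>\<^sub>F n in sequentially. \<forall>t\<in>{0..norm T}. dist (poly (P n) t) (t powr r) < e/4 \<and> dist (poly (Q n) t) (t powr r) < e/4"
      by eventually_elim auto
    then obtain N where N: "\<And>n t. n \<ge> N \<Longrightarrow> t \<in> {0..norm T} \<Longrightarrow> dist (poly (P n) t) (t powr r) < e/4"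
       "\<And>n t. n \<ge> N \<Longrightarrow> t \<in> {0..norm T} \<Longrightarrow> dist (poly (Q n) t) (t powr r) < e/4"
      unfolding eventually_sequentially by blast
    have "norm (op_poly (P m) T - op_poly (Q n) T) \<le> e/2" if "m \<ge> N" "n \<ge> N" for m n
    proof (rule norm_op_poly_diff[OF T])
      fix t assume "t \<in> {0..norm T}"
      then show "\<bar>poly (P m) t - poly (Q n) t\<bar> \<le> e/2"
        using N(1)[OF that(1), of t] N(2)[OF that(2), of t] unfolding dist_real_def by linarith
    qed
    then show ?thesis using e by (intro exI[of _ N]) fastforce
  qed
  obtain P0 where P0: "?U P0" using poly_approximates_powr[OF r] by blast
  have "Cauchy (\<lambda>n. op_poly (P0 n) T)"
    using close[OF P0 P0] by (simp add: Cauchy_def dist_norm)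
  then obtain S where S: "(\<lambda>n. op_poly (P0 n) T) \<longlonglongrightarrow> S" using Cauchy_convergent convergent_def by blast
  have all: "(\<lambda>n. op_poly (Q n) T) \<longlonglongrightarrow> S" if "?U Q" for Q
  proof -
    have "(\<lambda>n. op_poly (Q n) T - op_poly (P0 n) T) \<longlonglongrightarrow> 0"
      using close[OF that P0] by (fastforce simp: LIMSEQ_def)
    from tendsto_add[OF this S] show ?thesis by simp
  qed
  have "op_powr T r = S"
    unfolding op_powr_def
  proof (rule the_equality)
    show "\<forall>P. ?U P \<longrightarrow> (\<lambda>n. op_poly (P n) T) \<longlonglongrightarrow> S" using all by blast
    fix S' assume "\<forall>P. ?U P \<longrightarrow> (\<lambda>n. op_poly (P n) T) \<longlonglongrightarrow> S'"
    then have "(\<lambda>n. op_poly (P0 n) T) \<longlonglongrightarrow> S'" using P0 by blast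
    then show "S' = S" using S LIMSEQ_unique by blast
  qed
  then show ?thesis using all[OF P] by simp
qed

text \<open>Finite-dimensional approximations of the functional calculus, valid for all vectors in \<open>S\<close> and all
  exponents in \<open>R\<close> at once. Every property of powers of \<open>T\<close> that involves finitely many vectors and
  exponents and survives limits can be checked on \<open>diag\<close>.\<close>
definition diagonalizes ::
  "('h::complex_hilbert_space \<Rightarrow>\<^sub>L 'h) \<Rightarrow> 'h set \<Rightarrow> real set \<Rightarrow> (nat \<Rightarrow> 'h set) \<Rightarrow> (nat \<Rightarrow> 'h \<Rightarrow> real) \<Rightarrow> bool" where
  "diagonalizes T S R V l \<longleftrightarrow> (\<forall>n. finite_ortho (V n)) \<and>
     (\<forall>n. \<forall>v\<in>V n. 0 \<le> l n v \<and> cinner v (T v) = of_real (l n v)) \<and>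
     (\<forall>x\<in>S. \<forall>r\<in>R. (\<lambda>n. diag (V n) (\<lambda>v. l n v powr r) x) \<longlonglongrightarrow> op_powr T r x)"

lemma diagonalizesD:
  assumes "diagonalizes T S R V l"
  shows "finite_ortho (V n)" "v \<in> V n \<Longrightarrow> 0 \<le> l n v" "v \<in> V n \<Longrightarrow> cinner v (T v) = of_real (l n v)"
    and "x \<in> S \<Longrightarrow> r \<in> R \<Longrightarrow> (\<lambda>n. diag (V n) (\<lambda>v. l n v powr r) x) \<longlonglongrightarrow> op_powr T r x"
  using assms unfolding diagonalizes_def by blast+

text \<open>Take the diagonalizations that belong to polynomials approximating the functions \<open>t \<mapsto> t\<^sup>r\<close>. The
  polynomial and the power differ little on the eigenvalues, so \<open>diag\<close> may be formed with the power.\<close>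
lemma op_powr_diagonal:
  assumes T: "positive_op T" and S: "finite S" and R: "finite R" "\<And>r. r \<in> R \<Longrightarrow> r > 0"
  obtains V l where "diagonalizes T S R V l"
proof -
  have "\<forall>r\<in>R. \<exists>P::nat \<Rightarrow> real poly. uniform_limit {0..norm T} (\<lambda>n. poly (P n)) (\<lambda>t. t powr r) sequentially"
    using poly_approximates_powr R(2) by blast
  then obtain P :: "real \<Rightarrow> nat \<Rightarrow> real poly" where
    P: "\<And>r. r \<in> R \<Longrightarrow> uniform_limit {0..norm T} (\<lambda>n. poly (P r n)) (\<lambda>t. t powr r) sequentially" by metis
  define d where "d n = Max (insert 0 ((\<lambda>r. degree (P r n)) ` R))" for n
  have d: "degree (P r n) \<le> d n" if "r \<in> R" for r n
    unfolding d_def using R(1) that by (intro Max_ge) auto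
  define Q where "Q n V l \<longleftrightarrow> finite_ortho V \<and> (\<forall>v\<in>V. l v \<in> {0..norm T} \<and> cinner v (T v) = of_real (l v)) \<and>
    (\<forall>P x. degree P \<le> d n \<longrightarrow> x \<in> S \<longrightarrow> op_poly P T x = diag V (\<lambda>v. poly P (l v)) x)" for n V l
  have "\<exists>V l. Q n V l" for n
    unfolding Q_def by (rule op_poly_diagonal[OF T S, of "d n"]) blast
  then obtain V l where Q: "\<And>n. Q n (V n) (l n)" by metis
  have V: "finite_ortho (V n)"
    and l: "v \<in> V n \<Longrightarrow> l n v \<in> {0..norm T}" "v \<in> V n \<Longrightarrow> cinner v (T v) = of_real (l n v)"
    and p: "degree P \<le> d n \<Longrightarrow> x \<in> S \<Longrightarrow> op_poly P T x = diag (V n) (\<lambda>v. poly P (l n v)) x" for n x v P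
    using Q[of n] unfolding Q_def by blast+
  have lim: "(\<lambda>n. diag (V n) (\<lambda>v. l n v powr r) x) \<longlonglongrightarrow> op_powr T r x" if x: "x \<in> S" and r: "r \<in> R" for x r
  proof -
    let ?D = "\<lambda>n. diag (V n) (\<lambda>v. l n v powr r) x"
    have "(\<lambda>n. ?D n - op_poly (P r n) T x) \<longlonglongrightarrow> 0"
    proof (rule LIMSEQ_I)
      fix e :: real assume e: "e > 0"
      define e' where "e' = e / (norm x + 1)"
      have e': "e' > 0" "e' * norm x < e" using e by (auto simp: e'_def field_simps add_pos_nonneg)
      obtain N where N: "\<And>n t. n \<ge> N \<Longrightarrow> t \<in> {0..norm T} \<Longrightarrow> dist (poly (P r n) t) (t powr r) < e'"
        using uniform_limitD[OF P[OF r] e'(1)] unfolding eventually_sequentially by blast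
      have "norm (?D n - op_poly (P r n) T x) < e" if "n \<ge> N" for n
      proof -
        have "norm (?D n - op_poly (P r n) T x) \<le> e' * norm x"
          unfolding p[OF d[OF r] x] diag_diff
        proof (rule norm_diag_le[OF V])
          fix v assume "v \<in> V n"
          then show "\<bar>l n v powr r - poly (P r n) (l n v)\<bar> \<le> e'"
            using N[OF that l(1)] unfolding dist_real_def by (simp add: abs_minus_commute less_imp_le)
        qed (use e' in simp)
        then show ?thesis using e'(2) by simp
      qed
      then show "\<exists>N. \<forall>n\<ge>N. norm (?D n - op_poly (P r n) T x - 0) < e" by auto
    qed
    moreover have "(\<lambda>n. op_poly (P r n) T x) \<longlonglongrightarrow> op_powr T r x"
      by (intro blinfun.tendsto op_powr_limit T P r R(2)) auto
    ultimately show ?thesis using tendsto_add by fastforce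
  qed
  show thesis by (rule that[of V l]) (use V l lim in \<open>auto simp: diagonalizes_def\<close>)
qed

lemma op_powr_one: "positive_op T \<Longrightarrow> op_powr T 1 = T"
proof -
  assume T: "positive_op T"
  have "(\<lambda>n. op_poly [:0, 1:] T) \<longlonglongrightarrow> op_powr T 1"
    by (rule op_powr_limit[OF T]) (auto intro!: uniform_limitI simp: dist_real_def)
  moreover have "op_poly [:0, 1:] T = T"
    by (rule blinfun_eqI) (simp add: op_poly_apply)
  ultimately show ?thesis by (simp add: LIMSEQ_const_iff)
qed

lemma positive_op_powr:
  assumes T: "positive_op T" and r: "r > 0"
  shows "positive_op (op_powr T r)"
  unfolding positive_op_def
proof (intro conjI allI)
  show "clinear_op (op_powr T r)"
    unfolding clinear_op_def
  proof (intro allI)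
    fix c x
    obtain V l where D: "diagonalizes T {x, c *\<^sub>C x} {r} V l"
      by (rule op_powr_diagonal[OF T, of "{x, c *\<^sub>C x}" "{r}"]) (use r in auto)
    have "(\<lambda>n. c *\<^sub>C diag (V n) (\<lambda>v. l n v powr r) x) \<longlonglongrightarrow> c *\<^sub>C op_powr T r x"
      by (intro tendsto_intros diagonalizesD(4)[OF D]) auto
    moreover have "(\<lambda>n. c *\<^sub>C diag (V n) (\<lambda>v. l n v powr r) x) \<longlonglongrightarrow> op_powr T r (c *\<^sub>C x)"
      using diagonalizesD(4)[OF D, of "c *\<^sub>C x" r] by (simp add: diag_scaleC)
    ultimately show "op_powr T r (c *\<^sub>C x) = c *\<^sub>C op_powr T r x" by (rule LIMSEQ_unique[symmetric])
  qed
next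
  fix x y
  obtain V l where D: "diagonalizes T {x, y} {r} V l"
    by (rule op_powr_diagonal[OF T, of "{x, y}" "{r}"]) (use r in auto)
  have "(\<lambda>n. cinner x (diag (V n) (\<lambda>v. l n v powr r) y)) \<longlonglongrightarrow> cinner x (op_powr T r y)"
    by (intro cinner.tendsto tendsto_const diagonalizesD(4)[OF D]) auto
  moreover have "(\<lambda>n. cinner x (diag (V n) (\<lambda>v. l n v powr r) y)) \<longlonglongrightarrow> cinner (op_powr T r x) y"
    unfolding diag_selfadjoint[symmetric] by (intro cinner.tendsto tendsto_const diagonalizesD(4)[OF D]) auto
  ultimately show "cinner (op_powr T r x) y = cinner x (op_powr T r y)" by (rule LIMSEQ_unique[symmetric])
next
  fix x
  obtain V l where D: "diagonalizes T {x} {r} V l"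
    by (rule op_powr_diagonal[OF T, of "{x}" "{r}"]) (use r in auto)
  have "(\<lambda>n. Re (cinner x (diag (V n) (\<lambda>v. l n v powr r) x))) \<longlonglongrightarrow> Re (cinner x (op_powr T r x))"
    by (intro tendsto_Re cinner.tendsto tendsto_const diagonalizesD(4)[OF D]) auto
  then show "0 \<le> Re (cinner x (op_powr T r x))"
    by (rule LIMSEQ_le_const) (simp add: Re_cinner_diag sum_nonneg)
qed

text \<open>The operator \<open>T\<^sup>r\<close> is self-adjoint and its square is \<open>T\<^bsup>2r\<^esup>\<close>, here in terms of matrix coefficients.\<close>
lemma cinner_op_powr:
  assumes T: "positive_op T" and r: "r > 0"
  shows "cinner (op_powr T r x) (op_powr T r y) = cinner x (op_powr T (2 * r) y)"
proof -
  obtain V l where D: "diagonalizes T {x, y} {r, 2 * r} V l"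
    by (rule op_powr_diagonal[OF T, of "{x, y}" "{r, 2 * r}"]) (use r in auto)
  let ?D = "\<lambda>s z n. diag (V n) (\<lambda>v. l n v powr s) z"
  have eq: "cinner (?D r x n) (?D r y n) = cinner x (?D (2 * r) y n)" for n
    by (simp only: cinner_diag_diag[OF diagonalizesD(1)[OF D]] powr_add[symmetric] mult_2)
  have "(\<lambda>n. cinner (?D r x n) (?D r y n)) \<longlonglongrightarrow> cinner (op_powr T r x) (op_powr T r y)"
    by (intro cinner.tendsto diagonalizesD(4)[OF D]) auto
  moreover have "(\<lambda>n. cinner x (?D (2 * r) y n)) \<longlonglongrightarrow> cinner x (op_powr T (2 * r) y)"
    by (intro cinner.tendsto tendsto_const diagonalizesD(4)[OF D]) auto
  ultimately show ?thesis unfolding eq by (rule LIMSEQ_unique)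
qed

lemma norm_op_powr:
  assumes T: "positive_op T" and r: "r > 0"
  shows "(norm (op_powr T r x))\<^sup>2 = Re (cinner x (op_powr T (2 * r) x))"
  using cinner_op_powr[OF assms, of x x] by (simp flip: Re_cinner_self)

text \<open>The weights may add up to less than one, because the function vanishes at zero: the tangent line at
  \<open>a\<close> has the nonpositive intercept \<open>(1 - p) a\<^sup>p\<close>.\<close>
lemma powr_jensen:
  fixes l w :: "'i \<Rightarrow> real"
  assumes p: "1 \<le> p" and l: "\<And>i. i \<in> I \<Longrightarrow> 0 \<le> l i" and w: "\<And>i. i \<in> I \<Longrightarrow> 0 \<le> w i" "sum w I \<le> 1"
  shows "(\<Sum>i\<in>I. l i * w i) powr p \<le> (\<Sum>i\<in>I. l i powr p * w i)"
proof -
  define a where "a = (\<Sum>i\<in>I. l i * w i)"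
  have a0: "a \<ge> 0" unfolding a_def by (intro sum_nonneg) (simp add: l w)
  show ?thesis
  proof (cases "a = 0")
    case True
    then show ?thesis unfolding a_def[symmetric] by (simp add: sum_nonneg w)
  next
    case False
    then have a: "a > 0" using a0 by simp
    (* the tangent line of t powr p at a lies below the graph *)
    have tangent: "a powr p + p * a powr (p - 1) * (t - a) \<le> t powr p" if "t \<ge> 0" for t
    proof (cases "t = 0")
      case True
      have "a powr p = a powr (p - 1) * a" using a by (simp add: powr_diff)
      then show ?thesis using True p a by (simp add: mult_right_mono)
    next
      case False
      then have t: "t > 0" using that by simp
      have "p * a powr (p - 1) * (t - a) \<le> t powr p - a powr p"
        by (rule convex_on_imp_above_tangent[OF powr_convex[OF p], of a t])
          (use t a in \<open>auto intro!: derivative_eq_intros simp: interior_open\<close>)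
      then show ?thesis by simp
    qed
    have "a powr p = a powr p + p * a powr (p - 1) * (a - a)" by simp
    also have "\<dots> \<le> a powr p * sum w I + p * a powr (p - 1) * (a - a * sum w I)"
    proof -
      have e: "a powr p = a * a powr (p - 1)" using a by (simp add: powr_diff)
      have "a powr p * sum w I + p * a powr (p - 1) * (a - a * sum w I) - a powr p
        = (p - 1) * a powr p * (1 - sum w I)" unfolding e by (simp add: algebra_simps)
      moreover have "0 \<le> (p - 1) * a powr p * (1 - sum w I)" using p w(2) by simp
      ultimately show ?thesis by simp
    qed
    also have "\<dots> = (\<Sum>i\<in>I. (a powr p + p * a powr (p - 1) * (l i - a)) * w i)"
    proof -
      define c where "c = p * a powr (p - 1)"
      have "(\<Sum>i\<in>I. (a powr p + c * (l i - a)) * w i) = (\<Sum>i\<in>I. (a powr p - c * a) * w i + c * (l i * w i))"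
        by (intro sum.cong) (simp_all add: algebra_simps)
      also have "\<dots> = (a powr p - c * a) * sum w I + c * a"
        by (simp only: sum.distrib a_def sum_distrib_left[symmetric])
      also have "\<dots> = a powr p * sum w I + c * (a - a * sum w I)" by (simp add: algebra_simps)
      finally show ?thesis unfolding c_def by simp
    qed
    also have "\<dots> \<le> (\<Sum>i\<in>I. l i powr p * w i)"
      by (intro sum_mono mult_right_mono tangent l w)
    finally show ?thesis by (simp add: a_def)
  qed
qed

text \<open>Jensen's inequality for the spectral measure of \<open>x\<close>, whose mass is \<open>\<parallel>x\<parallel>\<^sup>2 \<le> 1\<close>.\<close>
lemma positive_op_jensen:
  assumes T: "positive_op T" and p: "1 \<le> p" and x: "norm x \<le> 1"
  shows "Re (cinner x (T x)) powr p \<le> Re (cinner x (op_powr T p x))"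
proof -
  obtain V l where D: "diagonalizes T {x} {1, p} V l"
    by (rule op_powr_diagonal[OF T, of "{x}" "{1, p}"]) (use p in auto)
  let ?D = "\<lambda>s n. Re (cinner x (diag (V n) (\<lambda>v. l n v powr s) x))"
  have "?D 1 n powr p \<le> ?D p n" for n
  proof -
    have l: "0 \<le> l n v" if "v \<in> V n" for v by (rule diagonalizesD(2)[OF D that])
    have "(\<Sum>v\<in>V n. (cmod (cinner v x))\<^sup>2) \<le> 1"
      using bessel_ineq[OF diagonalizesD(1)[OF D], of x n] x by (smt (verit) norm_ge_zero power_le_one)
    from powr_jensen[OF p l _ this] have
      "(\<Sum>v\<in>V n. l n v * (cmod (cinner v x))\<^sup>2) powr p \<le> (\<Sum>v\<in>V n. l n v powr p * (cmod (cinner v x))\<^sup>2)" by simp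
    then show ?thesis unfolding Re_cinner_diag using l by (simp cong: sum.cong)
  qed
  moreover have lim: "?D s \<longlonglongrightarrow> Re (cinner x (op_powr T s x))" if "s \<in> {1, p}" for s
    by (intro tendsto_Re cinner.tendsto tendsto_const diagonalizesD(4)[OF D] that) auto
  moreover have "(\<lambda>n. ?D 1 n powr p) \<longlonglongrightarrow> Re (cinner x (T x)) powr p"
  proof (rule tendsto_powr')
    show "?D 1 \<longlonglongrightarrow> Re (cinner x (T x))" using lim[of 1] by (simp add: op_powr_one[OF T])
    have "0 \<le> ?D 1 n" for n unfolding Re_cinner_diag by (intro sum_nonneg) auto
    then show "Re (cinner x (T x)) \<noteq> 0 \<or> 0 < p \<and> (\<forall>\<^sub>F n in sequentially. 0 \<le> ?D 1 n)"
      using p by simp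
  qed simp
  ultimately show ?thesis by (intro LIMSEQ_le[OF _ lim[of p]]) auto
qed

lemma
  fixes T :: "'h::complex_hilbert_space \<Rightarrow>\<^sub>L 'h"
  assumes T: "clinear_op T"
  shows positive_op_abs: "positive_op (op_abs T)"
    and norm_op_abs: "norm (op_abs T x) = norm (T x)"
proof -
  let ?H = "adjoint_op T o\<^sub>L T"
  have H: "cinner x (?H y) = cinner (T x) (T y)" for x y by (simp add: cinner_adjoint[OF T])
  moreover have "cinner (?H x) y = cinner (T x) (T y)" for x y by (metis H cinner_commute)
  moreover have "clinear_op ?H" using T clinear_op_adjoint[OF T] by (simp add: clinear_op_def)
  ultimately have pos: "positive_op ?H" by (simp add: positive_op_def cinner_self)
  then show "positive_op (op_abs T)" unfolding op_abs_def by (rule positive_op_powr) simp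
  have "(norm (op_abs T x))\<^sup>2 = (norm (T x))\<^sup>2"
    using norm_op_powr[OF pos, of "1/2" x] H[of x x] by (simp add: op_abs_def op_powr_one[OF pos] cinner_self)
  then show "norm (op_abs T x) = norm (T x)" by (rule power2_eq_imp_eq) auto
qed

section \<open>Schatten norms through Bessel families\<close>

text \<open>Equivalently, the \<open>e i\<close> are the images of an orthonormal family of some space under a contraction. Unlike
  orthonormal families, these families stay in their class under partial isometries (\<open>bessel_polar\<close>),
  and they may be padded with zero vectors.\<close>
definition bessel :: "'i set \<Rightarrow> ('i \<Rightarrow> 'h::complex_hilbert_space) \<Rightarrow> bool" where
  "bessel I e \<longleftrightarrow> finite I \<and> (\<forall>x. (\<Sum>i\<in>I. (cmod (cinner (e i) x))\<^sup>2) \<le> (norm x)\<^sup>2)"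

lemma besselD: "bessel I e \<Longrightarrow> (\<Sum>i\<in>I. (cmod (cinner (e i) x))\<^sup>2) \<le> (norm x)\<^sup>2"
  by (simp add: bessel_def)

lemma bessel_finite: "bessel I e \<Longrightarrow> finite I"
  by (simp add: bessel_def)

lemma bessel_norm:
  assumes "bessel I e" "i \<in> I"
  shows "norm (e i) \<le> 1"
proof (rule ccontr)
  assume "\<not> norm (e i) \<le> 1"
  then have n: "norm (e i) > 1" by simp
  have "(cmod (cinner (e i) (e i)))\<^sup>2 \<le> (norm (e i))\<^sup>2"
  proof -
    have "(cmod (cinner (e i) (e i)))\<^sup>2 \<le> (\<Sum>j\<in>I. (cmod (cinner (e j) (e i)))\<^sup>2)"
      by (rule member_le_sum[OF assms(2) _ bessel_finite[OF assms(1)]]) simp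
    then show ?thesis using besselD[OF assms(1), of "e i"] by linarith
  qed
  then have "((norm (e i))\<^sup>2)\<^sup>2 \<le> (norm (e i))\<^sup>2" by (simp add: cinner_self norm_power)
  moreover have "1 * (norm (e i))\<^sup>2 < (norm (e i))\<^sup>2 * (norm (e i))\<^sup>2"
    using n by (intro mult_strict_right_mono) (auto simp: one_less_power)
  ultimately show False by (simp add: power2_eq_square[of "(norm (e i))\<^sup>2"])
qed

lemma bessel_finite_ortho: "finite_ortho V \<Longrightarrow> bessel V (\<lambda>v. v)"
  by (simp add: bessel_def bessel_ineq) (simp add: finite_ortho_def)

lemma bessel_reindex: "inj_on h J \<Longrightarrow> bessel (h ` J) e \<Longrightarrow> bessel J (\<lambda>j. e (h j))"
  using finite_image_iff[of h J] by (simp add: bessel_def sum.reindex)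

lemma bessel_singleton: "norm e \<le> 1 \<Longrightarrow> bessel {i} (\<lambda>_. e)"
proof -
  assume e: "norm e \<le> 1"
  have "(cmod (cinner e x))\<^sup>2 \<le> (norm x)\<^sup>2" for x
    using norm_cinner_le[of e x] mult_right_mono[OF e norm_ge_zero[of x]] by (intro power_mono) auto
  then show ?thesis by (simp add: bessel_def)
qed

lemma bessel_orthonormal_family:
  assumes fin: "finite W" and b: "\<And>v w. v \<in> W \<Longrightarrow> w \<in> W \<Longrightarrow> cinner (b v) (b w) = (if v = w then 1 else 0)"
  shows "bessel W b"
proof -
  have inj: "inj_on b W" by (rule inj_onI) (metis b zero_neq_one)
  have o: "finite_ortho (b ` W)" unfolding finite_ortho_def using fin b inj by (auto simp: inj_on_eq_iff)
  show ?thesis by (rule bessel_reindex[OF inj bessel_finite_ortho[OF o]])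
qed

text \<open>The dual form of the Bessel condition: the adjoint of a contraction is a contraction.\<close>
lemma bessel_synthesis:
  assumes u: "bessel I u"
  shows "(norm (\<Sum>i\<in>I. c i *\<^sub>C u i))\<^sup>2 \<le> (\<Sum>i\<in>I. (cmod (c i))\<^sup>2)"
proof -
  define z where "z = (\<Sum>i\<in>I. c i *\<^sub>C u i)"
  have "(norm z)\<^sup>2 = cmod (cinner z z)" by (simp add: cinner_self norm_power)
  also have "cinner z z = (\<Sum>i\<in>I. c i * cinner z (u i))"
    by (subst (2) z_def) (simp add: cinner.sum_right cinner_scaleC_right)
  also have "cmod \<dots> \<le> (\<Sum>i\<in>I. cmod (c i) * cmod (cinner (u i) z))"
    by (intro sum_norm_le) (simp add: norm_mult cmod_cinner_commute)
  also have "\<dots> \<le> L2_set (\<lambda>i. cmod (c i)) I * L2_set (\<lambda>i. cmod (cinner (u i) z)) I"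
    using L2_set_mult_ineq[of "\<lambda>i. cmod (c i)" "\<lambda>i. cmod (cinner (u i) z)" I] by simp
  also have "L2_set (\<lambda>i. cmod (cinner (u i) z)) I \<le> norm z"
    unfolding L2_set_def using besselD[OF u, of z] by (simp add: real_le_lsqrt)
  finally have "(norm z)\<^sup>2 \<le> L2_set (\<lambda>i. cmod (c i)) I * norm z" by (simp add: mult_left_mono L2_set_nonneg)
  then have "norm z \<le> L2_set (\<lambda>i. cmod (c i)) I"
    by (cases "z = 0") (auto simp: power2_eq_square L2_set_nonneg)
  then have "(norm z)\<^sup>2 \<le> (L2_set (\<lambda>i. cmod (c i)) I)\<^sup>2" by (intro power_mono) auto
  then show ?thesis by (simp add: z_def L2_set_def sum_nonneg)
qed

text \<open>The singular values are \<open>\<parallel>T v\<parallel>\<close>. Where \<open>T v = 0\<close> the left singular vector \<open>u v\<close> is zero, so \<open>u\<close> is a Bessel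
  family and in general not orthonormal.\<close>
lemma singular_decomposition:
  fixes T :: "'h::complex_hilbert_space \<Rightarrow>\<^sub>L 'h"
  assumes T: "clinear_op T" and E: "finite_ortho E"
  obtains V u where "finite_ortho V" "\<And>x. proj V x = proj E x" "bessel V u"
    "\<And>v. v \<in> V \<Longrightarrow> T v = of_real (norm (T v)) *\<^sub>C u v" "\<And>v. v \<in> V \<Longrightarrow> cinner (u v) (T v) = of_real (norm (T v))"
    "\<And>v w. v \<in> V \<Longrightarrow> w \<in> V \<Longrightarrow> v \<noteq> w \<Longrightarrow> cinner (u v) (T w) = 0"
proof -
  obtain V where V: "finite_ortho V" "\<And>x. proj V x = proj E x"
    and o: "\<And>v w. v \<in> V \<Longrightarrow> w \<in> V \<Longrightarrow> v \<noteq> w \<Longrightarrow> cinner (T v) (T w) = 0"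
    using singular_basis[OF T E] by blast
  have finV: "finite V" using V(1) by (simp add: finite_ortho_def)
  define W where "W = {v \<in> V. T v \<noteq> 0}"
  define u where "u v = complex_of_real (1 / norm (T v)) *\<^sub>C T v" for v
  have uu: "cinner (u v) (u w) = (if v = w then 1 else 0)" if "v \<in> W" "w \<in> W" for v w
  proof (cases "v = w")
    case True
    have "norm (u v) = 1" using that by (simp add: u_def norm_scaleC norm_divide W_def)
    then show ?thesis using True by (simp add: cinner_self)
  next
    case False
    then show ?thesis using o[of v w] that by (simp add: u_def cinner_simps W_def)
  qed
  have bW: "bessel W u" by (rule bessel_orthonormal_family[OF _ uu]) (use finV in \<open>auto simp: W_def\<close>)
  have bV: "bessel V u"
    unfolding bessel_def
  proof (intro conjI finV allI)
    fix x
    have "(\<Sum>i\<in>V. (cmod (cinner (u i) x))\<^sup>2) = (\<Sum>i\<in>W. (cmod (cinner (u i) x))\<^sup>2)"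
      using finV by (intro sum.mono_neutral_right) (auto simp: W_def u_def)
    then show "(\<Sum>i\<in>V. (cmod (cinner (u i) x))\<^sup>2) \<le> (norm x)\<^sup>2" using besselD[OF bW] by simp
  qed
  have Tu: "T v = of_real (norm (T v)) *\<^sub>C u v" for v by (cases "T v = 0") (simp_all add: u_def scaleC_scaleC)
  have uT: "cinner (u v) (T v) = of_real (norm (T v))" for v
    by (cases "T v = 0") (simp_all add: u_def cinner_simps cinner_self power2_eq_square)
  have off: "cinner (u v) (T w) = 0" if "v \<in> V" "w \<in> V" "v \<noteq> w" for v w
    using o[OF that] by (simp add: u_def cinner_simps)
  show thesis by (rule that[OF V bV Tu uT off])
qed

text \<open>The \<open>p\<close>-th power of the Schatten norm, expressed by matrix coefficients; see \<open>trace_op_abs_powr\<close>. An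
  index type has to be fixed for the supremum, but \<open>schatten_sum_upper\<close> admits every finite family.\<close>
definition schatten_sum :: "real \<Rightarrow> ('h::complex_hilbert_space \<Rightarrow>\<^sub>L 'h) \<Rightarrow> ennreal" where
  "schatten_sum p T = (SUP (I, e, f)\<in>{(I::nat set, e, f). bessel I e \<and> bessel I f}.
     ennreal (\<Sum>i\<in>I. cmod (cinner (f i) (T (e i))) powr p))"

lemma schatten_sum_upper:
  fixes T :: "'h::complex_hilbert_space \<Rightarrow>\<^sub>L 'h"
  assumes "bessel I e" "bessel I f"
  shows "ennreal (\<Sum>i\<in>I. cmod (cinner (f i) (T (e i))) powr p) \<le> schatten_sum p T"
proof -
  have "finite I" using assms by (simp add: bessel_def)
  then obtain h where h: "bij_betw h {0..<card I} I" using ex_bij_betw_nat_finite by blast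
  have inj: "inj_on h {0..<card I}" and im: "h ` {0..<card I} = I" using h by (auto simp: bij_betw_def)
  have "(\<Sum>i\<in>I. cmod (cinner (f i) (T (e i))) powr p) = (\<Sum>j\<in>{0..<card I}. cmod (cinner (f (h j)) (T (e (h j)))) powr p)"
    using sum.reindex_bij_betw[OF h, of "\<lambda>i. cmod (cinner (f i) (T (e i))) powr p"] by simp
  moreover have "bessel {0..<card I} (\<lambda>j. e (h j))" "bessel {0..<card I} (\<lambda>j. f (h j))"
    using assms by (auto intro!: bessel_reindex[OF inj] simp: im)
  ultimately show ?thesis
    unfolding schatten_sum_def
    by (intro SUP_upper2[of "({0..<card I}, \<lambda>j. e (h j), \<lambda>j. f (h j))"]) auto
qed

lemma schatten_sum_least:
  fixes T :: "'h::complex_hilbert_space \<Rightarrow>\<^sub>L 'h"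
  assumes "\<And>(I::nat set) e f. bessel I e \<Longrightarrow> bessel I f \<Longrightarrow> ennreal (\<Sum>i\<in>I. cmod (cinner (f i) (T (e i))) powr p) \<le> c"
  shows "schatten_sum p T \<le> c"
  unfolding schatten_sum_def using assms by (intro SUP_least) auto

text \<open>A polar decomposition \<open>T = U K\<close> on the span of the \<open>e i\<close>, with \<open>f' = U\<^sup>* f\<close>. The partial isometry \<open>U\<close> maps the
  left singular vectors \<open>u v\<close> of \<open>K\<close> to the vectors \<open>c v\<close>, and the assumption on the norms makes it a contraction.\<close>
lemma bessel_polar:
  fixes T K :: "'h::complex_hilbert_space \<Rightarrow>\<^sub>L 'h"
  assumes T: "clinear_op T" and K: "clinear_op K" and eq: "\<And>x. norm (T x) = norm (K x)"
    and f: "bessel I f"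
  shows "\<exists>f'. bessel I f' \<and> (\<forall>i\<in>I. cinner (f' i) (K (e i)) = cinner (f i) (T (e i)))"
proof -
  have fin: "finite I" using f by (simp add: bessel_def)
  obtain E where E: "finite_ortho E" "\<And>i. i \<in> I \<Longrightarrow> proj E (e i) = e i"
    using ortho_containing[of "e ` I"] fin by blast
  obtain V u where V: "finite_ortho V" "\<And>x. proj V x = proj E x" and u: "bessel V u"
    and Ku: "\<And>v. v \<in> V \<Longrightarrow> K v = of_real (norm (K v)) *\<^sub>C u v"
    and uK: "\<And>v. v \<in> V \<Longrightarrow> cinner (u v) (K v) = of_real (norm (K v))"
    and off: "\<And>v w. v \<in> V \<Longrightarrow> w \<in> V \<Longrightarrow> v \<noteq> w \<Longrightarrow> cinner (u v) (K w) = 0"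
    by (rule singular_decomposition[OF K E(1)]) blast
  have finV: "finite V" using V(1) by (simp add: finite_ortho_def)
  define c where "c v = complex_of_real (1 / norm (K v)) *\<^sub>C T v" for v
  have c: "complex_of_real (norm (K v)) *\<^sub>C c v = T v" for v
    using eq[of v] by (cases "K v = 0") (simp_all add: c_def scaleC_scaleC)
  define f' where "f' i = (\<Sum>v\<in>V. cinner (c v) (f i) *\<^sub>C u v)" for i
  have f'x: "cinner (f' i) x = cinner (f i) (\<Sum>v\<in>V. cinner (u v) x *\<^sub>C c v)" for i x
    unfolding f'_def using cinner_commute[of "f i"]
    by (simp add: cinner.sum_left cinner.sum_right cinner_simps mult.commute)
  have "bessel I f'"
    unfolding bessel_def
  proof (intro conjI fin allI)
    fix x
    define z where "z = (\<Sum>v\<in>V. (cinner (u v) x * of_real (1 / norm (K v))) *\<^sub>C v)"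
    have Tz: "T z = (\<Sum>v\<in>V. cinner (u v) x *\<^sub>C c v)"
      by (simp add: z_def clinear_op_sum[OF T] c_def scaleC_scaleC)
    have "K z = (\<Sum>v\<in>V. (if K v = 0 then 0 else cinner (u v) x) *\<^sub>C u v)"
      unfolding z_def clinear_op_sum[OF K]
    proof (rule sum.cong[OF refl])
      fix v assume "v \<in> V"
      from arg_cong[OF Ku[OF this], of "\<lambda>y. (cinner (u v) x * of_real (1 / norm (K v))) *\<^sub>C y"]
      show "(cinner (u v) x * of_real (1 / norm (K v))) *\<^sub>C K v = (if K v = 0 then 0 else cinner (u v) x) *\<^sub>C u v"
        by (simp add: scaleC_scaleC)
    qed
    then have Kz: "(norm (K z))\<^sup>2 \<le> (\<Sum>v\<in>V. (cmod (if K v = 0 then 0 else cinner (u v) x))\<^sup>2)"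
      using bessel_synthesis[OF u] by metis
    have "(\<Sum>i\<in>I. (cmod (cinner (f' i) x))\<^sup>2) \<le> (norm (T z))\<^sup>2"
      unfolding f'x Tz by (rule besselD[OF f])
    also have "\<dots> = (norm (K z))\<^sup>2" by (simp add: eq)
    also note Kz
    also have "(\<Sum>v\<in>V. (cmod (if K v = 0 then 0 else cinner (u v) x))\<^sup>2) \<le> (\<Sum>v\<in>V. (cmod (cinner (u v) x))\<^sup>2)"
      by (rule sum_mono) simp
    also have "\<dots> \<le> (norm x)\<^sup>2" by (rule besselD[OF u])
    finally show "(\<Sum>i\<in>I. (cmod (cinner (f' i) x))\<^sup>2) \<le> (norm x)\<^sup>2" .
  qed
  moreover have "cinner (f' i) (K (e i)) = cinner (f i) (T (e i))" if i: "i \<in> I" for i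
  proof -
    have ei: "e i = (\<Sum>v\<in>V. cinner v (e i) *\<^sub>C v)" using E(2)[OF i] V(2)[of "e i"] by (simp add: proj_def)
    have Ke: "K (e i) = (\<Sum>v\<in>V. cinner v (e i) *\<^sub>C K v)" and Te: "T (e i) = (\<Sum>v\<in>V. cinner v (e i) *\<^sub>C T v)"
      by (subst ei, simp add: clinear_op_sum[OF K] clinear_op_sum[OF T])+
    have "cinner (u v) (K (e i)) *\<^sub>C c v = cinner v (e i) *\<^sub>C T v" if v: "v \<in> V" for v
    proof -
      have "cinner (u v) (K (e i)) = (\<Sum>w\<in>V. if w = v then cinner v (e i) * of_real (norm (K v)) else 0)"
        unfolding Ke cinner.sum_right cinner_scaleC_right
        using off[OF v] uK[OF v] by (intro sum.cong refl) auto
      also have "\<dots> = cinner v (e i) * of_real (norm (K v))" using v finV by simp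
      finally show ?thesis by (simp add: c flip: scaleC_scaleC)
    qed
    then show ?thesis unfolding f'x Te by (simp cong: sum.cong)
  qed
  ultimately show ?thesis by blast
qed

lemma schatten_sum_eq_norm:
  fixes T K :: "'h::complex_hilbert_space \<Rightarrow>\<^sub>L 'h"
  assumes "clinear_op T" "clinear_op K" "\<And>x. norm (T x) = norm (K x)"
  shows "schatten_sum p T = schatten_sum p K"
proof -
  have le: "schatten_sum p T \<le> schatten_sum p K"
    if *: "clinear_op T" "clinear_op K" "\<And>x. norm (T x) = norm (K x)" for T K :: "'h \<Rightarrow>\<^sub>L 'h"
  proof (rule schatten_sum_least)
    fix I :: "nat set" and e f :: "nat \<Rightarrow> 'h" assume ef: "bessel I e" "bessel I f"
    obtain f' where f': "bessel I f'" "\<forall>i\<in>I. cinner (f' i) (K (e i)) = cinner (f i) (T (e i))"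
      using bessel_polar[OF * ef(2)] by blast
    have "(\<Sum>i\<in>I. cmod (cinner (f i) (T (e i))) powr p) = (\<Sum>i\<in>I. cmod (cinner (f' i) (K (e i))) powr p)"
      using f'(2) by (intro sum.cong) auto
    then show "ennreal (\<Sum>i\<in>I. cmod (cinner (f i) (T (e i))) powr p) \<le> schatten_sum p K"
      using schatten_sum_upper[OF ef(1) f'(1)] by simp
  qed
  show ?thesis using le[of T K] le[of K T] assms by (intro antisym) auto
qed

lemma positive_op_Cauchy_Schwarz:
  fixes K :: "'h::complex_hilbert_space \<Rightarrow>\<^sub>L 'h"
  assumes K: "positive_op K"
  shows "(cmod (cinner x (K y)))\<^sup>2 \<le> Re (cinner x (K x)) * Re (cinner y (K y))"
proof -
  let ?M = "op_powr K (1/2)"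
  have n: "(norm (?M x))\<^sup>2 = Re (cinner x (K x))" for x
    using norm_op_powr[OF K, of "1/2" x] by (simp add: op_powr_one[OF K])
  have "cinner x (K y) = cinner (?M x) (?M y)"
    using cinner_op_powr[OF K, of "1/2" x y] by (simp add: op_powr_one[OF K])
  then have "(cmod (cinner x (K y)))\<^sup>2 \<le> (norm (?M x) * norm (?M y))\<^sup>2"
    by (intro power_mono) (simp_all add: norm_cinner_le)
  then show ?thesis by (simp add: power_mult_distrib n)
qed

lemma infsum_sum_ennreal:
  "finite I \<Longrightarrow> (\<Sum>i\<in>I. \<Sum>\<^sub>\<infinity>e\<in>B. (g i e :: ennreal)) = (\<Sum>\<^sub>\<infinity>e\<in>B. \<Sum>i\<in>I. g i e)"
  by (induction I rule: finite_induct) (simp_all add: infsum_add nonneg_summable_on_complete)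

text \<open>Write the quadratic form of \<open>K\<^sup>p\<close> as \<open>\<parallel>M x\<parallel>\<^sup>2\<close> with \<open>M = K\<^bsup>p/2\<^esup>\<close>, expand in the basis that defines the trace,
  and exchange the sums: the vectors \<open>e i\<close> then occur in a Bessel sum for \<open>M b\<close>.\<close>
lemma bessel_sum_le_trace:
  fixes K :: "'h::complex_hilbert_space \<Rightarrow>\<^sub>L 'h"
  assumes K: "positive_op K" and p: "p > 0" and e: "bessel I e"
  shows "ennreal (\<Sum>i\<in>I. Re (cinner (e i) (op_powr K p (e i)))) \<le> pos_trace (op_powr K p)"
proof -
  define B where "B = (SOME B::'h set. orthonormal_basis B)"
  have B: "orthonormal_basis B" unfolding B_def by (rule someI_ex[OF orthonormal_basis_exists])
  let ?M = "op_powr K (p/2)"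
  have n: "(norm (?M x))\<^sup>2 = Re (cinner x (op_powr K p x))" for x
    using norm_op_powr[OF K, of "p/2" x] p by simp
  have herm: "cinner x (?M y) = cinner (?M x) y" for x y
    using positive_op_powr[OF K, of "p/2"] p by (simp add: positive_op_def)
  have "ennreal (\<Sum>i\<in>I. Re (cinner (e i) (op_powr K p (e i)))) = (\<Sum>i\<in>I. ennreal ((norm (?M (e i)))\<^sup>2))"
    by (simp add: n[symmetric] sum_ennreal)
  also have "\<dots> = (\<Sum>i\<in>I. \<Sum>\<^sub>\<infinity>b\<in>B. ennreal ((cmod (cinner b (?M (e i))))\<^sup>2))"
    by (simp add: parseval[OF B])
  also have "\<dots> = (\<Sum>\<^sub>\<infinity>b\<in>B. \<Sum>i\<in>I. ennreal ((cmod (cinner b (?M (e i))))\<^sup>2))"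
    by (rule infsum_sum_ennreal[OF bessel_finite[OF e]])
  also have "\<dots> \<le> (\<Sum>\<^sub>\<infinity>b\<in>B. ennreal (Re (cinner b (op_powr K p b))))"
  proof (rule infsum_mono)
    fix b
    have "(\<Sum>i\<in>I. (cmod (cinner b (?M (e i))))\<^sup>2) = (\<Sum>i\<in>I. (cmod (cinner (e i) (?M b)))\<^sup>2)"
    proof (intro sum.cong refl arg_cong[of _ _ "\<lambda>t. t\<^sup>2"])
      fix i
      show "cmod (cinner b (?M (e i))) = cmod (cinner (e i) (?M b))"
        by (subst herm) (rule cmod_cinner_commute)
    qed
    also have "\<dots> \<le> Re (cinner b (op_powr K p b))" using besselD[OF e] by (simp add: n[symmetric])
    finally show "(\<Sum>i\<in>I. ennreal ((cmod (cinner b (?M (e i))))\<^sup>2)) \<le> ennreal (Re (cinner b (op_powr K p b)))"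
      by (simp add: sum_ennreal ennreal_leI)
  qed (auto intro!: nonneg_summable_on_complete)
  also have "\<dots> = pos_trace (op_powr K p)" by (simp add: pos_trace_def B_def)
  finally show ?thesis .
qed

text \<open>For positive \<open>K\<close> the Cauchy-Schwarz inequality separates \<open>f i\<close> from \<open>e i\<close>. The two quadratic forms that
  remain are compared with those of \<open>K\<^sup>p\<close> by Jensen's inequality, and summed by \<open>bessel_sum_le_trace\<close>.\<close>
lemma schatten_sum_le_trace:
  fixes K :: "'h::complex_hilbert_space \<Rightarrow>\<^sub>L 'h"
  assumes K: "positive_op K" and p: "p \<ge> 1"
  shows "schatten_sum p K \<le> pos_trace (op_powr K p)"
proof (rule schatten_sum_least)
  fix I :: "nat set" and e f :: "nat \<Rightarrow> 'h" assume e: "bessel I e" and f: "bessel I f"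
  let ?L = "op_powr K p"
  have pos: "0 \<le> Re (cinner x (K x))" for x using K by (simp add: positive_op_def)
  have single: "cmod (cinner (f i) (K (e i))) powr p
      \<le> (Re (cinner (f i) (?L (f i))) + Re (cinner (e i) (?L (e i)))) / 2" if i: "i \<in> I" for i
  proof -
    let ?a = "Re (cinner (f i) (K (f i)))" and ?b = "Re (cinner (e i) (K (e i)))"
    have "cmod (cinner (f i) (K (e i))) = sqrt ((cmod (cinner (f i) (K (e i))))\<^sup>2)" by simp
    also have "\<dots> \<le> sqrt (?a * ?b)" by (intro real_sqrt_le_mono positive_op_Cauchy_Schwarz K)
    also have "\<dots> \<le> (?a + ?b) / 2" by (rule arith_geo_mean_sqrt[OF pos pos])
    finally have "cmod (cinner (f i) (K (e i))) powr p \<le> ((?a + ?b) / 2) powr p"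
      using p by (intro powr_mono2) auto
    also have "\<dots> = (\<Sum>j\<in>{True, False}. (if j then ?a else ?b) * (1/2)) powr p" by (simp add: field_simps)
    also have "\<dots> \<le> (\<Sum>j\<in>{True, False}. (if j then ?a else ?b) powr p * (1/2))"
      using pos by (intro powr_jensen p) auto
    also have "\<dots> = (?a powr p + ?b powr p) / 2" by simp
    also have "\<dots> \<le> (Re (cinner (f i) (?L (f i))) + Re (cinner (e i) (?L (e i)))) / 2"
      using positive_op_jensen[OF K p bessel_norm[OF f i]] positive_op_jensen[OF K p bessel_norm[OF e i]] by simp
    finally show ?thesis .
  qed
  let ?F = "\<Sum>i\<in>I. Re (cinner (f i) (?L (f i)))" and ?E = "\<Sum>i\<in>I. Re (cinner (e i) (?L (e i)))"
  have "(\<Sum>i\<in>I. cmod (cinner (f i) (K (e i))) powr p) \<le> (?F + ?E) / 2"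
    using sum_mono[OF single] by (simp add: sum.distrib flip: sum_divide_distrib)
  also have "\<dots> \<le> max ?F ?E" by simp
  finally have "ennreal (\<Sum>i\<in>I. cmod (cinner (f i) (K (e i))) powr p) \<le> ennreal (max ?F ?E)" by (rule ennreal_leI)
  also have "\<dots> \<le> pos_trace ?L"
    using bessel_sum_le_trace[OF K _ e, of p] bessel_sum_le_trace[OF K _ f, of p] p by (simp add: max_def)
  finally show "ennreal (\<Sum>i\<in>I. cmod (cinner (f i) (K (e i))) powr p) \<le> pos_trace ?L" .
qed

lemma le_enn2real: "ennreal x \<le> c \<Longrightarrow> c < top \<Longrightarrow> x \<le> enn2real c"
  by (cases c) (auto simp: ennreal_le_iff)

text \<open>A finite part of the trace is approximated with eigenvectors \<open>v\<close> of a compression of \<open>K\<close>. They form an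
  orthonormal set, and \<open>(l v)\<^sup>p = \<langle>v, K v\<rangle>\<^sup>p\<close>, so their eigenvalue sum is one of the sums in \<open>schatten_sum\<close>.\<close>
lemma trace_le_schatten_sum:
  fixes K :: "'h::complex_hilbert_space \<Rightarrow>\<^sub>L 'h"
  assumes K: "positive_op K" and p: "p > 0"
  shows "pos_trace (op_powr K p) \<le> schatten_sum p K"
proof (cases "schatten_sum p K = \<infinity>")
  case False
  then have fin: "schatten_sum p K < top" by (simp add: less_top)
  define B where "B = (SOME B::'h set. orthonormal_basis B)"
  have B: "orthonormal_basis B" unfolding B_def by (rule someI_ex[OF orthonormal_basis_exists])
  let ?L = "op_powr K p"
  have pos: "0 \<le> Re (cinner x (?L x))" for x using positive_op_powr[OF K p] by (simp add: positive_op_def)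
  have "pos_trace ?L = (SUP F\<in>{F. finite F \<and> F \<subseteq> B}. \<Sum>e\<in>F. ennreal (Re (cinner e (?L e))))"
    by (simp add: pos_trace_def nonneg_infsum_complete flip: B_def)
  also have "\<dots> \<le> schatten_sum p K"
  proof (rule SUP_least)
    fix F assume F: "F \<in> {F. finite F \<and> F \<subseteq> B}"
    then have oF: "finite_ortho F" using orthonormal_basis_finite_ortho[OF B] by blast
    obtain V l where D: "diagonalizes K F {p} V l"
      by (rule op_powr_diagonal[OF K, of F "{p}"]) (use p F in auto)
    note V = diagonalizesD(1)[OF D]
    let ?D = "\<lambda>x n. diag (V n) (\<lambda>v. l n v powr p) x"
    have "(\<Sum>x\<in>F. Re (cinner x (?D x n))) \<le> enn2real (schatten_sum p K)" for n
    proof -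
      have "(\<Sum>x\<in>F. Re (cinner x (?D x n))) = (\<Sum>x\<in>F. \<Sum>v\<in>V n. l n v powr p * (cmod (cinner x v))\<^sup>2)"
        unfolding Re_cinner_diag by (intro sum.cong refl) (simp add: cmod_cinner_commute)
      also have "\<dots> = (\<Sum>v\<in>V n. l n v powr p * (\<Sum>x\<in>F. (cmod (cinner x v))\<^sup>2))"
        by (subst sum.swap) (simp add: sum_distrib_left)
      also have "\<dots> \<le> (\<Sum>v\<in>V n. l n v powr p * 1)"
      proof (intro sum_mono mult_left_mono)
        fix v assume "v \<in> V n"
        then show "(\<Sum>x\<in>F. (cmod (cinner x v))\<^sup>2) \<le> 1"
          using bessel_ineq[OF oF, of v] norm_ortho[OF V, of v n] by simp
      qed simp
      also have "\<dots> = (\<Sum>v\<in>V n. cmod (cinner v (K v)) powr p)"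
        using diagonalizesD(2,3)[OF D] by (intro sum.cong) simp_all
      finally have "ennreal (\<Sum>x\<in>F. Re (cinner x (?D x n))) \<le> schatten_sum p K"
        using schatten_sum_upper[OF bessel_finite_ortho[OF V[of n]] bessel_finite_ortho[OF V[of n]], of K p]
        by (meson ennreal_leI order_trans)
      then show ?thesis using fin by (rule le_enn2real)
    qed
    then have "(\<Sum>x\<in>F. Re (cinner x (?L x))) \<le> enn2real (schatten_sum p K)"
      by (intro LIMSEQ_le_const2[of "\<lambda>n. \<Sum>x\<in>F. Re (cinner x (?D x n))"] tendsto_sum tendsto_Re
          cinner.tendsto tendsto_const diagonalizesD(4)[OF D]) auto
    then show "(\<Sum>e\<in>F. ennreal (Re (cinner e (?L e)))) \<le> schatten_sum p K"
      using pos fin by (simp add: sum_ennreal) (metis ennreal_enn2real ennreal_leI)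
  qed
  finally show ?thesis .
qed simp

text \<open>Replacing \<open>T\<close> by \<open>|T|\<close> does not change \<open>schatten_sum\<close>, because \<open>\<parallel>T x\<parallel> = \<parallel>|T| x\<parallel>\<close>. For a positive operator the
  two inequalities have been shown above.\<close>
lemma trace_op_abs_powr:
  fixes T :: "'h::complex_hilbert_space \<Rightarrow>\<^sub>L 'h"
  assumes T: "clinear_op T" and p: "1 \<le> p"
  shows "pos_trace (op_powr (op_abs T) p) = schatten_sum p T"
proof -
  have K: "positive_op (op_abs T)" by (rule positive_op_abs[OF T])
  have "pos_trace (op_powr (op_abs T) p) = schatten_sum p (op_abs T)"
    using schatten_sum_le_trace[OF K p] trace_le_schatten_sum[OF K, of p] p by (intro antisym) auto
  also have "\<dots> = schatten_sum p T"
    using K norm_op_abs[OF T] by (intro schatten_sum_eq_norm T) (auto simp: positive_op_def)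
  finally show ?thesis .
qed

section \<open>The Schatten class as a normed space\<close>

lemma powr_le_cancel: "x powr p \<le> y powr p \<Longrightarrow> 0 < p \<Longrightarrow> 0 \<le> y \<Longrightarrow> x \<le> (y::real)"
  using powr_less_mono2[of p y x] by force

lemma mem_schatten_class:
  "1 \<le> p \<Longrightarrow> T \<in> schatten_class p \<longleftrightarrow> clinear_op T \<and> schatten_sum p T < \<infinity>"
  by (auto simp: schatten_class_def trace_op_abs_powr)

lemma schatten_class_clinear: "T \<in> schatten_class p \<Longrightarrow> clinear_op T"
  by (simp add: schatten_class_def)

lemma schatten_norm_nonneg [simp]: "0 \<le> schatten_norm p T"
  by (simp add: schatten_norm_def)

lemma schatten_norm_powr:
  "1 \<le> p \<Longrightarrow> clinear_op T \<Longrightarrow> schatten_norm p T powr p = enn2real (schatten_sum p T)"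
  by (simp add: schatten_norm_def trace_op_abs_powr powr_powr)

lemma bessel_sum_le_schatten_norm:
  assumes p: "1 \<le> p" and T: "T \<in> schatten_class p" and "bessel I e" "bessel I f"
  shows "(\<Sum>i\<in>I. cmod (cinner (f i) (T (e i))) powr p) \<le> schatten_norm p T powr p"
proof -
  have fin: "schatten_sum p T < top" and lin: "clinear_op T" using T p by (auto simp: mem_schatten_class)
  have "enn2real (ennreal (\<Sum>i\<in>I. cmod (cinner (f i) (T (e i))) powr p)) \<le> enn2real (schatten_sum p T)"
    using schatten_sum_upper[OF assms(3,4), of T p] fin by (rule enn2real_mono)
  then show ?thesis by (simp add: schatten_norm_powr[OF p lin] sum_nonneg)
qed

text \<open>Together with \<open>bessel_sum_le_schatten_norm\<close> this characterizes the Schatten norm by Bessel families. The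
  properties of the norm are derived from these two rules.\<close>
lemma schatten_norm_leI:
  fixes T :: "'h::complex_hilbert_space \<Rightarrow>\<^sub>L 'h"
  assumes p: "1 \<le> p" and T: "clinear_op T" and c: "0 \<le> c"
    and le: "\<And>(I::nat set) e f. bessel I e \<Longrightarrow> bessel I f \<Longrightarrow>
      (\<Sum>i\<in>I. cmod (cinner (f i) (T (e i))) powr p) \<le> c powr p"
  shows "T \<in> schatten_class p" "schatten_norm p T \<le> c"
proof -
  have S: "schatten_sum p T \<le> ennreal (c powr p)"
    using le by (intro schatten_sum_least ennreal_leI)
  then show "T \<in> schatten_class p" using T p by (auto simp: mem_schatten_class intro: order_le_less_trans)
  have "schatten_norm p T powr p \<le> c powr p"
    unfolding schatten_norm_powr[OF p T] using S by (intro enn2real_leI) auto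
  then show "schatten_norm p T \<le> c" using p c by (auto intro: powr_le_cancel[of _ p])
qed

lemma scaleC_op_apply [simp]: "scaleC_op c T x = c *\<^sub>C T x"
  by transfer simp

lemma clinear_op_scaleC_op: "clinear_op T \<Longrightarrow> clinear_op (scaleC_op c T)"
  by (simp add: clinear_op_def scaleC_scaleC mult.commute)

lemma scaleR_scaleC_op: "r *\<^sub>R T = scaleC_op (of_real r) T"
  by (rule blinfun_eqI) (simp add: blinfun.scaleR_left scaleR_scaleC)

lemma clinear_op_add: "clinear_op S \<Longrightarrow> clinear_op T \<Longrightarrow> clinear_op (S + T)"
  by (simp add: clinear_op_def blinfun.add_left scaleC_add_right)

lemma schatten_zero:
  assumes p: "1 \<le> p"
  shows "(0 :: 'a::complex_hilbert_space \<Rightarrow>\<^sub>L 'a) \<in> schatten_class p"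
    and "schatten_norm p (0 :: 'a::complex_hilbert_space \<Rightarrow>\<^sub>L 'a) = 0"
proof -
  have lin: "clinear_op (0 :: 'a \<Rightarrow>\<^sub>L 'a)"
    by (simp add: clinear_op_def)
  note * = schatten_norm_leI[OF p lin, of 0]
  show "(0 :: 'a \<Rightarrow>\<^sub>L 'a) \<in> schatten_class p" by (rule *(1)) (simp_all add: sum_nonneg)
  have "schatten_norm p (0 :: 'a \<Rightarrow>\<^sub>L 'a) \<le> 0" by (rule *(2)) (simp_all add: sum_nonneg)
  then show "schatten_norm p (0 :: 'a \<Rightarrow>\<^sub>L 'a) = 0" using schatten_norm_nonneg[of p "0 :: 'a \<Rightarrow>\<^sub>L 'a"] by linarith
qed

lemma schatten_scaleC:
  assumes p: "1 \<le> p" and T: "T \<in> schatten_class p"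
  shows "scaleC_op c T \<in> schatten_class p" "schatten_norm p (scaleC_op c T) = cmod c * schatten_norm p T"
proof -
  have main: "scaleC_op c T \<in> schatten_class p \<and> schatten_norm p (scaleC_op c T) \<le> cmod c * schatten_norm p T"
    if T: "T \<in> schatten_class p" for c and T :: "'a \<Rightarrow>\<^sub>L 'a"
  proof -
    have "(\<Sum>i\<in>I. cmod (cinner (f i) (scaleC_op c T (e i))) powr p) \<le> (cmod c * schatten_norm p T) powr p"
      if "bessel I e" "bessel I f" for I :: "nat set" and e f
    proof -
      have "(\<Sum>i\<in>I. cmod (cinner (f i) (scaleC_op c T (e i))) powr p)
          = cmod c powr p * (\<Sum>i\<in>I. cmod (cinner (f i) (T (e i))) powr p)"
        by (simp add: cinner_simps norm_mult powr_mult sum_distrib_left)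
      also have "\<dots> \<le> cmod c powr p * schatten_norm p T powr p"
        by (intro mult_left_mono bessel_sum_le_schatten_norm p T that) simp
      finally show ?thesis by (simp add: powr_mult)
    qed
    then show ?thesis
      using schatten_norm_leI[OF p clinear_op_scaleC_op[OF schatten_class_clinear[OF T]], of "cmod c * schatten_norm p T" c]
      by simp
  qed
  show cT: "scaleC_op c T \<in> schatten_class p" using main[OF T] by blast
  show "schatten_norm p (scaleC_op c T) = cmod c * schatten_norm p T"
  proof (cases "c = 0")
    case True
    have "scaleC_op 0 T = 0" by (rule blinfun_eqI) simp
    then show ?thesis using True schatten_zero[OF p] by simp
  next
    case False
    have "scaleC_op (1 / c) (scaleC_op c T) = T" using False by (intro blinfun_eqI) (simp add: scaleC_scaleC)
    then have "schatten_norm p T \<le> cmod (1 / c) * schatten_norm p (scaleC_op c T)"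
      using main[OF cT, of "1 / c"] by simp
    then have "cmod c * schatten_norm p T \<le> schatten_norm p (scaleC_op c T)"
      using False by (simp add: norm_divide field_simps)
    then show ?thesis using main[OF T, of c] by simp
  qed
qed

text \<open>The number \<open>(x + y) / (a + b)\<close> is a convex combination of \<open>x / a\<close> and \<open>y / b\<close>.\<close>
lemma add_powr_le:
  fixes a b x y p :: real
  assumes p: "1 \<le> p" and "0 < a" "0 < b" "0 \<le> x" "0 \<le> y"
  shows "(x + y) powr p \<le> (a + b) powr p * (a / (a + b) * (x / a) powr p + b / (a + b) * (y / b) powr p)"
proof -
  have "x + y = (a + b) * (\<Sum>j\<in>{True, False}. (if j then x / a else y / b) * (if j then a / (a + b) else b / (a + b)))"
  proof -
    have nz: "a \<noteq> 0" "b \<noteq> 0" "a + b \<noteq> 0" using assms by auto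
    have "(\<Sum>j\<in>{True, False}. (if j then x / a else y / b) * (if j then a / (a + b) else b / (a + b))) = (x + y) / (a + b)"
      by (simp add: nz add_divide_distrib)
    then show ?thesis using nz by simp
  qed
  then have "(x + y) powr p = (a + b) powr p * (\<Sum>j\<in>{True, False}. (if j then x / a else y / b) * (if j then a / (a + b) else b / (a + b))) powr p"
    by (simp only: powr_mult)
  also have "\<dots> \<le> (a + b) powr p * (\<Sum>j\<in>{True, False}. (if j then x / a else y / b) powr p * (if j then a / (a + b) else b / (a + b)))"
    using assms by (intro mult_left_mono powr_jensen p) (auto simp flip: add_divide_distrib)
  finally show ?thesis by (simp add: mult.commute)
qed

text \<open>Minkowski's inequality by convexity. The slack \<open>d\<close> keeps the two norms positive, so that one can divide by
  them.\<close>
lemma schatten_add: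
  assumes p: "1 \<le> p" and S: "S \<in> schatten_class p" and T: "T \<in> schatten_class p"
  shows "S + T \<in> schatten_class p" "schatten_norm p (S + T) \<le> schatten_norm p S + schatten_norm p T"
proof -
  have main: "S + T \<in> schatten_class p \<and> schatten_norm p (S + T) \<le> (schatten_norm p S + d) + (schatten_norm p T + d)"
    if d: "d > 0" for d
  proof -
    define a where "a = schatten_norm p S + d"
    define b where "b = schatten_norm p T + d"
    have ab: "a > 0" "b > 0" using d by (simp_all add: a_def b_def add_nonneg_pos)
    have "(\<Sum>i\<in>I. cmod (cinner (f i) ((S + T) (e i))) powr p) \<le> (a + b) powr p"
      if "bessel I e" "bessel I f" for I :: "nat set" and e f
    proof -
      let ?s = "\<lambda>i. cmod (cinner (f i) (S (e i)))" and ?t = "\<lambda>i. cmod (cinner (f i) (T (e i)))"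
      have "(\<Sum>i\<in>I. ?s i powr p) \<le> a powr p"
        using bessel_sum_le_schatten_norm[OF p S that] d p powr_mono2[of p "schatten_norm p S" a]
        by (simp add: a_def)
      then have s: "(\<Sum>i\<in>I. (?s i / a) powr p) \<le> 1"
        using ab by (simp add: powr_divide flip: sum_divide_distrib)
      have "(\<Sum>i\<in>I. ?t i powr p) \<le> b powr p"
        using bessel_sum_le_schatten_norm[OF p T that] d p powr_mono2[of p "schatten_norm p T" b]
        by (simp add: b_def)
      then have t: "(\<Sum>i\<in>I. (?t i / b) powr p) \<le> 1"
        using ab by (simp add: powr_divide flip: sum_divide_distrib)
      have "(\<Sum>i\<in>I. cmod (cinner (f i) ((S + T) (e i))) powr p) \<le> (\<Sum>i\<in>I. (?s i + ?t i) powr p)"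
        using p by (intro sum_mono powr_mono2) (auto simp: blinfun.add_left cinner_simps norm_triangle_ineq)
      also have "\<dots> \<le> (\<Sum>i\<in>I. (a + b) powr p * (a / (a + b) * (?s i / a) powr p + b / (a + b) * (?t i / b) powr p))"
        by (intro sum_mono add_powr_le p ab) auto
      also have "\<dots> = (a + b) powr p * (a / (a + b) * (\<Sum>i\<in>I. (?s i / a) powr p) + b / (a + b) * (\<Sum>i\<in>I. (?t i / b) powr p))"
        by (simp only: sum_distrib_left[symmetric] sum.distrib)
      also have "\<dots> \<le> (a + b) powr p * (a / (a + b) * 1 + b / (a + b) * 1)"
        using ab s t by (intro mult_left_mono add_mono) auto
      also have "\<dots> = (a + b) powr p" using ab by (simp flip: add_divide_distrib)
      finally show ?thesis .
    qed
    then show ?thesis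
      using schatten_norm_leI[OF p clinear_op_add[OF schatten_class_clinear[OF S] schatten_class_clinear[OF T]], of "a + b"] ab
      by (simp add: a_def b_def)
  qed
  show "S + T \<in> schatten_class p" using main[of 1] by simp
  show "schatten_norm p (S + T) \<le> schatten_norm p S + schatten_norm p T"
  proof (rule field_le_epsilon)
    fix e :: real assume "e > 0"
    then show "schatten_norm p (S + T) \<le> schatten_norm p S + schatten_norm p T + e" using main[of "e/2"] by simp
  qed
qed

lemma norm_le_schatten_norm:
  assumes p: "1 \<le> p" and T: "T \<in> schatten_class p"
  shows "norm T \<le> schatten_norm p T"
proof (rule norm_blinfun_bound)
  fix x
  show "norm (T x) \<le> schatten_norm p T * norm x"
  proof (cases "T x = 0")
    case False
    then have x: "x \<noteq> 0" by auto
    define e where "e = complex_of_real (1 / norm x) *\<^sub>C x"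
    define f where "f = complex_of_real (1 / norm (T x)) *\<^sub>C T x"
    have "norm e = 1" "norm f = 1" using x False by (simp_all add: e_def f_def norm_scaleC norm_divide)
    then have "(\<Sum>i\<in>{0::nat}. cmod (cinner f (T e)) powr p) \<le> schatten_norm p T powr p"
      by (intro bessel_sum_le_schatten_norm p T bessel_singleton) auto
    then have "cmod (cinner f (T e)) \<le> schatten_norm p T" using p by (auto intro: powr_le_cancel[of _ p])
    moreover have "cinner f (T e) = of_real (norm (T x) / norm x)"
      using False x by (simp add: e_def f_def clinear_op_scaleC[OF schatten_class_clinear[OF T]] cinner_simps cinner_self power2_eq_square)
    ultimately show ?thesis using x by (simp add: norm_divide divide_le_eq)
  qed simp
qed simp

text \<open>The limit exists in operator norm. It is also a limit in the Schatten norm, since every sum in the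
  supremum depends continuously on the operator.\<close>
lemma schatten_complete:
  fixes T :: "nat \<Rightarrow> ('h::complex_hilbert_space \<Rightarrow>\<^sub>L 'h)"
  assumes p: "1 \<le> p" and T: "\<And>n. T n \<in> schatten_class p"
    and cauchy: "\<And>e. e > 0 \<Longrightarrow> \<exists>N. \<forall>m\<ge>N. \<forall>n\<ge>N. schatten_norm p (T m - T n) < e"
  shows "\<exists>L\<in>schatten_class p. (\<lambda>n. schatten_norm p (T n - L)) \<longlonglongrightarrow> 0"
proof -
  have diff: "S - S' \<in> schatten_class p" if "S \<in> schatten_class p" "S' \<in> schatten_class p" for S S' :: "'h \<Rightarrow>\<^sub>L 'h"
  proof -
    have "S - S' = S + scaleC_op (- 1) S'" by (rule blinfun_eqI) (simp add: blinfun.diff_left blinfun.add_left scaleC_minus_left)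
    then show ?thesis using schatten_add(1)[OF p] schatten_scaleC(1)[OF p] that by metis
  qed
  have "Cauchy T"
    unfolding Cauchy_def dist_norm
    using cauchy norm_le_schatten_norm[OF p diff[OF T T]] by (meson order_le_less_trans)
  then obtain L where L: "T \<longlonglongrightarrow> L" using Cauchy_convergent convergent_def by blast
  have Lx: "(\<lambda>n. T n x) \<longlonglongrightarrow> L x" for x by (intro blinfun.tendsto L tendsto_const)
  have lin: "clinear_op L"
    unfolding clinear_op_def
  proof (intro allI)
    fix c x
    have "(\<lambda>n. c *\<^sub>C T n x) \<longlonglongrightarrow> L (c *\<^sub>C x)"
      using Lx[of "c *\<^sub>C x"] by (simp add: clinear_op_scaleC[OF schatten_class_clinear[OF T]])
    moreover have "(\<lambda>n. c *\<^sub>C T n x) \<longlonglongrightarrow> c *\<^sub>C L x" by (intro tendsto_intros Lx)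
    ultimately show "L (c *\<^sub>C x) = c *\<^sub>C L x" by (rule LIMSEQ_unique)
  qed
  have close: "\<exists>N. \<forall>n\<ge>N. T n - L \<in> schatten_class p \<and> schatten_norm p (T n - L) \<le> e" if e: "e > 0" for e
  proof -
    obtain N where N: "\<And>m n. m \<ge> N \<Longrightarrow> n \<ge> N \<Longrightarrow> schatten_norm p (T m - T n) < e" using cauchy[OF e] by blast
    have "T n - L \<in> schatten_class p \<and> schatten_norm p (T n - L) \<le> e" if n: "n \<ge> N" for n
    proof -
      have lin': "clinear_op (T n - L)"
        using lin schatten_class_clinear[OF T, of n] by (simp add: clinear_op_def blinfun.diff_left)
          (metis add_diff_cancel scaleC_add_right diff_add_cancel)
      have "(\<Sum>i\<in>I. cmod (cinner (f i) ((T n - L) (e' i))) powr p) \<le> e powr p"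
        if "bessel I e'" "bessel I f" for I :: "nat set" and e' f
      proof (rule LIMSEQ_le_const2)
        show "(\<lambda>m. \<Sum>i\<in>I. cmod (cinner (f i) ((T n - T m) (e' i))) powr p)
            \<longlonglongrightarrow> (\<Sum>i\<in>I. cmod (cinner (f i) ((T n - L) (e' i))) powr p)"
          using p unfolding blinfun.diff_left
          by (intro tendsto_sum tendsto_powr' tendsto_norm cinner.tendsto tendsto_diff tendsto_const Lx) auto
        have "(\<Sum>i\<in>I. cmod (cinner (f i) ((T n - T m) (e' i))) powr p) \<le> e powr p" if m: "m \<ge> N" for m
          using bessel_sum_le_schatten_norm[OF p diff[OF T T] \<open>bessel I e'\<close> \<open>bessel I f\<close>, of n m] N[OF n m] p
            powr_mono2[of p "schatten_norm p (T n - T m)" e] by simp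
        then show "\<exists>M. \<forall>m\<ge>M. (\<Sum>i\<in>I. cmod (cinner (f i) ((T n - T m) (e' i))) powr p) \<le> e powr p" by blast
      qed
      then show ?thesis using schatten_norm_leI[OF p lin', of e] e by simp
    qed
    then show ?thesis by blast
  qed
  obtain N where "T N - L \<in> schatten_class p" using close[of 1] by auto
  from diff[OF T[of N] this] have "L \<in> schatten_class p" by simp
  moreover have "(\<lambda>n. schatten_norm p (T n - L)) \<longlonglongrightarrow> 0"
  proof (rule LIMSEQ_I)
    fix e :: real assume e: "e > 0"
    then obtain N where "\<forall>n\<ge>N. schatten_norm p (T n - L) \<le> e/2" using close[of "e/2"] by auto
    then show "\<exists>N. \<forall>n\<ge>N. norm (schatten_norm p (T n - L) - 0) < e" using e by (intro exI[of _ N]) fastforce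
  qed
  ultimately show ?thesis by blast
qed

section \<open>Complex interpolation\<close>

text \<open>The factor \<open>exp (e (z\<^sup>2 - 1))\<close> has modulus at most one on the strip and decays as \<open>Im z\<close> grows. The maximum
  modulus principle on a long rectangle bounds the damped function, and then \<open>e\<close> tends to zero.\<close>
lemma three_lines_unit:
  fixes F :: "complex \<Rightarrow> complex"
  assumes holo: "F holomorphic_on UNIV"
    and B: "\<And>z. 0 \<le> Re z \<Longrightarrow> Re z \<le> 1 \<Longrightarrow> cmod (F z) \<le> B"
    and edge: "\<And>z. Re z = 0 \<Longrightarrow> cmod (F z) \<le> 1" "\<And>z. Re z = 1 \<Longrightarrow> cmod (F z) \<le> 1"
    and t: "0 \<le> t" "t \<le> 1"
  shows "cmod (F (of_real t)) \<le> 1"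
proof -
  have B0: "B \<ge> 0" using B[of 0] norm_ge_zero order_trans by (metis order_refl zero_complex.sel(1) zero_le_one)
  have damped: "cmod (F (of_real t)) * exp (e * (t\<^sup>2 - 1)) \<le> 1" if e: "e > 0" for e :: real
  proof -
    define G where "G z = F z * exp (of_real e * (z\<^sup>2 - 1))" for z
    have nG: "cmod (G z) = cmod (F z) * exp (e * ((Re z)\<^sup>2 - (Im z)\<^sup>2 - 1))" for z
      by (simp add: G_def norm_mult power2_eq_square)
    \<comment> \<open>At the height \<open>R\<close> the damping outweighs the bound \<open>B\<close>.\<close>
    define R where "R = max 1 (ln (B + 1) / e)"
    have R: "R \<ge> 1" by (simp add: R_def)
    have "ln (B + 1) \<le> e * R" using e by (simp add: R_def field_simps max_def)
    also have "\<dots> \<le> e * R\<^sup>2" using e R by (simp add: power2_eq_square)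
    finally have big: "B + 1 \<le> exp (e * R\<^sup>2)" using B0 by (metis add_nonneg_pos exp_le_cancel_iff exp_ln zero_less_one)
    let ?S = "cbox (Complex 0 (- R)) (Complex 1 R)"
    have "cmod (G (of_real t)) \<le> 1"
    proof (rule maximum_modulus_frontier[of G ?S])
      have hG: "G holomorphic_on UNIV" unfolding G_def using holo by (intro holomorphic_intros)
      then show "G holomorphic_on interior ?S" by (rule holomorphic_on_subset) simp
      show "continuous_on (closure ?S) G"
        by (rule holomorphic_on_imp_continuous_on[OF holomorphic_on_subset[OF hG]]) simp
      show "of_real t \<in> ?S" using t R by (simp add: in_cbox_complex_iff)
      fix z assume "z \<in> frontier ?S"
      then have z: "0 \<le> Re z" "Re z \<le> 1" "- R \<le> Im z" "Im z \<le> R" and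
        bd: "Re z = 0 \<or> Re z = 1 \<or> Im z = - R \<or> Im z = R"
        by (auto simp: frontier_cbox in_cbox_complex_iff in_box_complex_iff)
      have x1: "(Re z)\<^sup>2 \<le> 1" using z by (simp add: power_le_one)
      then have y0: "(Re z)\<^sup>2 - (Im z)\<^sup>2 - 1 \<le> 0" using zero_le_power2[of "Im z"] by linarith
      show "cmod (G z) \<le> 1"
      proof (cases "Re z = 0 \<or> Re z = 1")
        case True
        have "exp (e * ((Re z)\<^sup>2 - (Im z)\<^sup>2 - 1)) \<le> 1" using e y0 by (simp add: mult_nonneg_nonpos)
        then show ?thesis unfolding nG using edge[of z] True by (intro mult_le_one) auto
      next
        case False
        then have im: "(Im z)\<^sup>2 = R\<^sup>2" using bd by auto
        have "e * ((Re z)\<^sup>2 - (Im z)\<^sup>2 - 1) \<le> - (e * R\<^sup>2)"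
          using mult_left_mono[OF x1, of e] e by (simp add: im algebra_simps)
        then have "cmod (G z) \<le> B * exp (- (e * R\<^sup>2))" unfolding nG using B[OF z(1,2)] B0 by (intro mult_mono) auto
        also have "\<dots> \<le> 1" using big by (simp add: exp_minus field_simps)
        finally show ?thesis .
      qed
    qed simp
    then show ?thesis by (simp add: nG)
  qed
  have "((\<lambda>e. cmod (F (of_real t)) * exp (e * (t\<^sup>2 - 1))) \<longlongrightarrow> cmod (F (of_real t)) * exp (0 * (t\<^sup>2 - 1))) (at_right 0)"
    by (intro tendsto_intros)
  then have "cmod (F (of_real t)) * exp (0 * (t\<^sup>2 - 1)) \<le> 1"
    by (rule tendsto_upperbound) (auto intro!: eventually_at_right_less[THEN eventually_mono] damped)
  then show ?thesis by simp
qed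

text \<open>Divide by \<open>M\<^sub>0\<^bsup>1-z\<^esup> M\<^sub>1\<^bsup>z\<^esup>\<close>.\<close>
lemma three_lines:
  fixes F :: "complex \<Rightarrow> complex"
  assumes holo: "F holomorphic_on UNIV"
    and B: "\<And>z. 0 \<le> Re z \<Longrightarrow> Re z \<le> 1 \<Longrightarrow> cmod (F z) \<le> B"
    and pos: "0 < M0" "0 < M1"
    and edge: "\<And>z. Re z = 0 \<Longrightarrow> cmod (F z) \<le> M0" "\<And>z. Re z = 1 \<Longrightarrow> cmod (F z) \<le> M1"
    and t: "0 \<le> t" "t \<le> 1"
  shows "cmod (F (of_real t)) \<le> M0 powr (1 - t) * M1 powr t"
proof -
  define H where "H z = F z * exp (- ((1 - z) * of_real (ln M0) + z * of_real (ln M1)))" for z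
  have nH: "cmod (H z) = cmod (F z) * exp (- ((1 - Re z) * ln M0 + Re z * ln M1))" for z
    by (simp add: H_def norm_mult)
  have B0: "B \<ge> 0" using B[of 0] norm_ge_zero order_trans by (metis order_refl zero_complex.sel(1) zero_le_one)
  have "cmod (H (of_real t)) \<le> 1"
  proof (rule three_lines_unit[OF _ _ _ _ t])
    show "H holomorphic_on UNIV" unfolding H_def using holo by (intro holomorphic_intros)
    show "cmod (H z) \<le> B * exp (\<bar>ln M0\<bar> + \<bar>ln M1\<bar>)" if z: "0 \<le> Re z" "Re z \<le> 1" for z
    proof -
      have "- ((1 - Re z) * ln M0) \<le> \<bar>ln M0\<bar>" "- (Re z * ln M1) \<le> \<bar>ln M1\<bar>"
        using mult_right_mono[of "1 - Re z" 1 "\<bar>ln M0\<bar>"] mult_right_mono[of "Re z" 1 "\<bar>ln M1\<bar>"] z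
          abs_ge_minus_self[of "(1 - Re z) * ln M0"] abs_ge_minus_self[of "Re z * ln M1"] by (auto simp: abs_mult)
      then show ?thesis unfolding nH using B[OF z] B0 by (intro mult_mono) auto
    qed
    show "cmod (H z) \<le> 1" if "Re z = 0" for z
      unfolding nH using edge(1)[OF that] pos that by (simp add: exp_minus field_simps)
    show "cmod (H z) \<le> 1" if "Re z = 1" for z
      unfolding nH using edge(2)[OF that] pos that by (simp add: exp_minus field_simps)
  qed
  then have le: "cmod (F (of_real t)) * exp (- ((1 - t) * ln M0 + t * ln M1)) \<le> 1" unfolding nH by simp
  have "x \<le> exp c" if "x * exp (- c) \<le> 1" for x c :: real
    using that by (simp add: exp_minus divide_inverse[symmetric])
  from this[OF le] show ?thesis using pos by (simp add: powr_def exp_add)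
qed

text \<open>The power \<open>r\<^sup>z\<close> with a nonnegative base, as a holomorphic function of the exponent. The value \<open>0\<close> at \<open>r = 0\<close>
  agrees with \<open>powr\<close>.\<close>
definition cpow :: "real \<Rightarrow> complex \<Rightarrow> complex" where
  "cpow r z = (if r = 0 then 0 else exp (z * of_real (ln r)))"

lemma norm_cpow: "0 \<le> r \<Longrightarrow> cmod (cpow r z) = r powr Re z"
  by (simp add: cpow_def powr_def)

lemma cpow_of_real: "0 \<le> r \<Longrightarrow> cpow r (of_real s) = of_real (r powr s)"
  by (simp add: cpow_def powr_def exp_of_real flip: of_real_mult)

lemma holomorphic_cpow: "f holomorphic_on S \<Longrightarrow> (\<lambda>z. cpow r (f z)) holomorphic_on S"
  by (cases "r = 0") (auto simp: cpow_def intro!: holomorphic_intros)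

lemma continuous_on_powr_const_base:
  "continuous_on S f \<Longrightarrow> continuous_on S (\<lambda>x. (r::real) powr f x)"
  by (cases "r = 0") (auto intro!: continuous_intros)

text \<open>The Riesz-Thorin theorem for a finite matrix, from \<open>\<ell>\<^sup>p(w)\<close> to \<open>\<ell>\<^sup>q(\<ell>\<^sup>p)\<close>. The hypothesis \<open>E1\<close> is the bound from
  \<open>\<ell>\<^sup>1(w)\<close> to \<open>\<ell>\<^sup>\<infinity>(\<ell>\<^sup>1)\<close>, and \<open>E2\<close> the bound from \<open>\<ell>\<^sup>2(w)\<close> to \<open>\<ell>\<^sup>2(\<ell>\<^sup>2)\<close>. Let \<open>g = M a\<close>, let \<open>G k\<close> be the inner norm
  of \<open>g k\<close>, and let \<open>\<Gamma> = \<Sum> (G k)\<^sup>q\<close> and \<open>W = \<Sum> w |a|\<^sup>p\<close>. The input is deformed to \<open>\<alpha> z\<close>, and \<open>g\<close> is paired with the deformation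
  \<open>\<beta> z\<close> of its dual vector. The exponents are affine in \<open>z\<close> and chosen such that at \<open>z = t = 2 / q\<close> the pairing
  \<open>F z\<close> equals \<open>\<Gamma>\<close>, while \<open>E1\<close> bounds it by \<open>\<Gamma> W\<close> on \<open>Re z = 0\<close> and \<open>E2\<close> by \<open>(\<Gamma> W)\<^bsup>1/2\<^esup>\<close> on \<open>Re z = 1\<close>. As
  \<open>1 - t / 2 = 1 / p\<close>, the three lines theorem gives \<open>\<Gamma> \<le> (\<Gamma> W)\<^bsup>1/p\<^esup>\<close>.\<close>
lemma mixed_norm_interpolation:
  fixes M :: "'k \<Rightarrow> 'i \<Rightarrow> 'x \<Rightarrow> complex" and w :: "'x \<Rightarrow> real" and a :: "'x \<Rightarrow> complex"
  assumes p: "1 < p" "p < 2" and q: "q = p / (p - 1)"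
    and fin: "finite K" "\<And>k. k \<in> K \<Longrightarrow> finite (I k)" "finite X"
    and w: "\<And>x. x \<in> X \<Longrightarrow> 0 \<le> w x"
    and E1: "\<And>k x. k \<in> K \<Longrightarrow> x \<in> X \<Longrightarrow> (\<Sum>i\<in>I k. cmod (M k i x)) \<le> w x"
    and E2: "\<And>a. (\<Sum>k\<in>K. \<Sum>i\<in>I k. (cmod (\<Sum>x\<in>X. M k i x * a x))\<^sup>2) \<le> (\<Sum>x\<in>X. w x * (cmod (a x))\<^sup>2)"
  shows "(\<Sum>k\<in>K. (\<Sum>i\<in>I k. cmod (\<Sum>x\<in>X. M k i x * a x) powr p) powr (q / p))
    \<le> (\<Sum>x\<in>X. w x * cmod (a x) powr p) powr (q / p)"
proof -
  have p0: "p > 0" using p by simp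
  have q2: "q > 2" using p unfolding q by (simp add: field_simps)
  have pq: "p / q = p - 1" using p unfolding q by simp
  have qp: "1 / q = 1 - 1 / p" using p unfolding q by (simp add: field_simps)
  define t where "t = 2 / q"
  have t: "0 \<le> t" "t \<le> 1" using q2 by (simp_all add: t_def)
  define g where "g k i = (\<Sum>x\<in>X. M k i x * a x)" for k i
  define G where "G k = (\<Sum>i\<in>I k. cmod (g k i) powr p) powr (1 / p)" for k
  have G0: "G k \<ge> 0" for k by (simp add: G_def)
  have Gp: "G k powr p = (\<Sum>i\<in>I k. cmod (g k i) powr p)" for k
    using p0 by (simp add: G_def powr_powr sum_nonneg)
  have Gq: "G k powr q = (\<Sum>i\<in>I k. cmod (g k i) powr p) powr (q / p)" for k
    by (simp add: G_def powr_powr)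
  define \<Gamma> where "\<Gamma> = (\<Sum>k\<in>K. G k powr q)"
  define W where "W = (\<Sum>x\<in>X. w x * cmod (a x) powr p)"
  have \<Gamma>0: "\<Gamma> \<ge> 0" by (simp add: \<Gamma>_def sum_nonneg)
  have W0: "W \<ge> 0" unfolding W_def using w by (intro sum_nonneg) auto
  have "\<Gamma> \<le> W powr (q / p)"
  proof (cases "\<Gamma> = 0")
    case False
    then have \<Gamma>: "\<Gamma> > 0" using \<Gamma>0 by simp
    have W: "W > 0"
    proof (rule ccontr)
      assume "\<not> W > 0"
      then have "W = 0" using W0 by simp
      then have "\<forall>x\<in>X. w x * cmod (a x) powr p = 0"
        unfolding W_def using w fin by (subst (asm) sum_nonneg_eq_0_iff) auto
      then have "(\<Sum>x\<in>X. w x * (cmod (a x))\<^sup>2) = 0" by (intro sum.neutral) auto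
      then have le: "(\<Sum>k\<in>K. \<Sum>i\<in>I k. (cmod (g k i))\<^sup>2) \<le> 0" using E2[of a] by (simp add: g_def)
      have "g k i = 0" if "k \<in> K" "i \<in> I k" for k i
      proof -
        have "(cmod (g k i))\<^sup>2 \<le> (\<Sum>i\<in>I k. (cmod (g k i))\<^sup>2)"
          using that fin by (intro member_le_sum) auto
        also have "\<dots> \<le> (\<Sum>k\<in>K. \<Sum>i\<in>I k. (cmod (g k i))\<^sup>2)"
          using that fin by (intro member_le_sum[of k K]) (auto intro: sum_nonneg)
        also note le
        finally show ?thesis by simp
      qed
      then have "\<Gamma> = 0" unfolding \<Gamma>_def G_def by (intro sum.neutral) simp
      then show False using \<Gamma> by simp
    qed
    define \<alpha> where "\<alpha> x z = sgn (a x) * cpow (cmod (a x)) (of_real p * (1 - z / 2))" for x z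
    define \<beta> where "\<beta> k i z = cnj (sgn (g k i)) * cpow (cmod (g k i)) (z * of_real (p / 2))
      * cpow (G k) (of_real q - z * of_real ((q + p) / 2))" for k i z
    define F where "F z = (\<Sum>k\<in>K. \<Sum>i\<in>I k. \<beta> k i z * (\<Sum>x\<in>X. M k i x * \<alpha> x z))" for z
    have n\<alpha>: "cmod (\<alpha> x z) = cmod (a x) powr (p * (1 - Re z / 2))" for x z
      by (simp add: \<alpha>_def norm_mult norm_sgn norm_cpow)
    have n\<beta>: "cmod (\<beta> k i z) = cmod (g k i) powr (Re z * (p / 2)) * G k powr (q - Re z * ((q + p) / 2))" for k i z
      using G0[of k] by (simp add: \<beta>_def norm_mult norm_sgn norm_cpow)
    have hF: "F holomorphic_on UNIV"
      unfolding F_def \<alpha>_def \<beta>_def by (intro holomorphic_intros holomorphic_cpow) auto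
    have Ft: "F (of_real t) = of_real \<Gamma>"
    proof -
      have "\<alpha> x (of_real t) = a x" for x
      proof -
        have "p * (1 - t / 2) = 1" using p0 qp by (simp add: t_def field_simps)
        then have e: "of_real p * (1 - complex_of_real t / 2) = of_real 1"
          by (metis of_real_1 of_real_diff of_real_divide of_real_mult of_real_numeral)
        show ?thesis unfolding \<alpha>_def e by (subst cpow_of_real) (simp_all add: sgn_eq)
      qed
      then have 1: "(\<Sum>x\<in>X. M k i x * \<alpha> x (of_real t)) = g k i" for k i by (simp add: g_def)
      have "\<beta> k i (of_real t) * g k i = of_real (cmod (g k i) powr p * G k powr (q - p))" for k i
      proof -
        have "t * (p / 2) = p - 1" using pq by (simp add: t_def)
        then have e1: "complex_of_real t * of_real (p / 2) = of_real (p - 1)"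
          by (simp only: of_real_mult[symmetric])
        have "t * ((q + p) / 2) = p" using pq q2 by (simp add: t_def field_simps)
        then have e2: "of_real q - complex_of_real t * of_real ((q + p) / 2) = of_real (q - p)"
          by (simp only: of_real_mult[symmetric] of_real_diff)
        have "cnj (sgn (g k i)) * g k i = of_real (cmod (g k i))"
          by (cases "g k i = 0") (simp_all add: sgn_eq cnj_mult_self power2_eq_square)
        then have "\<beta> k i (of_real t) * g k i = of_real (cmod (g k i) * cmod (g k i) powr (p - 1) * G k powr (q - p))"
        proof -
          assume *: "cnj (sgn (g k i)) * g k i = of_real (cmod (g k i))"
          have "\<beta> k i (of_real t) * g k i = (cnj (sgn (g k i)) * g k i) *
              (of_real (cmod (g k i) powr (p - 1)) * of_real (G k powr (q - p)))"
            unfolding \<beta>_def e1 e2 cpow_of_real[OF norm_ge_zero] cpow_of_real[OF G0]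
            by (simp only: mult.assoc mult.commute[of "g k i"])
          then show ?thesis unfolding * by simp
        qed
        also have "cmod (g k i) * cmod (g k i) powr (p - 1) = cmod (g k i) powr p"
          by (cases "g k i = 0") (simp_all add: powr_diff)
        finally show ?thesis .
      qed
      then have "F (of_real t) = of_real (\<Sum>k\<in>K. (\<Sum>i\<in>I k. cmod (g k i) powr p) * G k powr (q - p))"
        unfolding F_def 1 by (simp add: sum_distrib_right)
      also have "(\<Sum>k\<in>K. (\<Sum>i\<in>I k. cmod (g k i) powr p) * G k powr (q - p)) = \<Gamma>"
        unfolding \<Gamma>_def Gp[symmetric] by (simp flip: powr_add)
      finally show ?thesis .
    qed
    have F_le: "cmod (F z) \<le> (\<Sum>k\<in>K. \<Sum>i\<in>I k. cmod (\<beta> k i z) * (\<Sum>x\<in>X. cmod (M k i x) * cmod (\<alpha> x z)))" for z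
      unfolding F_def
    proof (intro sum_norm_le)
      fix k i
      have "cmod (\<Sum>x\<in>X. M k i x * \<alpha> x z) \<le> (\<Sum>x\<in>X. cmod (M k i x) * cmod (\<alpha> x z))"
        by (rule sum_norm_le) (simp add: norm_mult)
      then show "cmod (\<beta> k i z * (\<Sum>x\<in>X. M k i x * \<alpha> x z))
          \<le> cmod (\<beta> k i z) * (\<Sum>x\<in>X. cmod (M k i x) * cmod (\<alpha> x z))"
        unfolding norm_mult by (intro mult_left_mono) auto
    qed
    \<comment> \<open>The function \<open>F\<close> is bounded on the strip because \<open>|F z| \<le> H (Re z)\<close> with a continuous \<open>H\<close>.\<close>
    define H where "H s = (\<Sum>k\<in>K. \<Sum>i\<in>I k. (cmod (g k i) powr (s * (p / 2)) * G k powr (q - s * ((q + p) / 2)))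
      * (\<Sum>x\<in>X. cmod (M k i x) * cmod (a x) powr (p * (1 - s / 2))))" for s
    have "continuous_on {0..1} H"
      unfolding H_def
      by (intro continuous_on_sum continuous_on_mult continuous_on_powr_const_base continuous_on_diff
          continuous_on_divide continuous_on_const continuous_on_id) auto
    then have "bounded (H ` {0..1})" by (intro compact_imp_bounded compact_continuous_image) auto
    then obtain B where "\<forall>y\<in>H ` {0..1}. norm y \<le> B" unfolding bounded_iff by blast
    then have B: "\<bar>H s\<bar> \<le> B" if "s \<in> {0..1}" for s using that by auto
    have "cmod (F (of_real t)) \<le> (\<Gamma> * W) powr (1 - t) * (sqrt (\<Gamma> * W)) powr t"
    proof (rule three_lines[OF hF _ _ _ _ _ t])
      fix z :: complex assume z: "0 \<le> Re z" "Re z \<le> 1"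
      have "cmod (F z) \<le> H (Re z)" using F_le[of z] by (simp add: n\<alpha> n\<beta> H_def)
      also have "\<dots> \<le> B" using B[of "Re z"] z by simp
      finally show "cmod (F z) \<le> B" .
    next
      fix z :: complex assume z: "Re z = 0"
      have "cmod (F z) \<le> (\<Sum>k\<in>K. \<Sum>i\<in>I k. G k powr q * (\<Sum>x\<in>X. cmod (M k i x) * cmod (a x) powr p))"
      proof (rule order_trans[OF F_le], intro sum_mono mult_mono)
        fix k i
        show "cmod (\<beta> k i z) \<le> G k powr q" unfolding n\<beta> by (simp add: z)
      qed (auto simp: n\<alpha> z intro!: sum_nonneg)
      also have "\<dots> = (\<Sum>k\<in>K. G k powr q * (\<Sum>x\<in>X. (\<Sum>i\<in>I k. cmod (M k i x)) * cmod (a x) powr p))"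
        unfolding sum_distrib_left[symmetric] sum_distrib_right by (subst sum.swap) simp
      also have "\<dots> \<le> (\<Sum>k\<in>K. G k powr q * W)"
        unfolding W_def by (intro sum_mono mult_left_mono mult_right_mono E1) auto
      also have "\<dots> = \<Gamma> * W" by (simp add: \<Gamma>_def sum_distrib_right)
      finally show "cmod (F z) \<le> \<Gamma> * W" .
    next
      fix z :: complex assume z: "Re z = 1"
      let ?S = "Sigma K I" and ?h = "\<lambda>(k, i). \<Sum>x\<in>X. M k i x * \<alpha> x z" and ?b = "\<lambda>(k, i). \<beta> k i z"
      have fK: "\<forall>k\<in>K. finite (I k)" using fin by blast
      have "F z = (\<Sum>ki\<in>?S. ?b ki * ?h ki)"
        unfolding F_def by (subst sum.Sigma[OF fin(1) fK]) (simp add: case_prod_unfold)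
      then have "cmod (F z) \<le> (\<Sum>ki\<in>?S. cmod (?b ki) * cmod (?h ki))"
        by (simp add: sum_norm_le norm_mult)
      also have "\<dots> \<le> L2_set (\<lambda>ki. cmod (?b ki)) ?S * L2_set (\<lambda>ki. cmod (?h ki)) ?S"
        using L2_set_mult_ineq[of "\<lambda>ki. cmod (?b ki)" "\<lambda>ki. cmod (?h ki)" ?S] by simp
      also have "\<dots> \<le> sqrt \<Gamma> * sqrt W"
      proof (intro mult_mono)
        have "(\<Sum>ki\<in>?S. (cmod (?b ki))\<^sup>2) = (\<Sum>k\<in>K. \<Sum>i\<in>I k. (cmod (\<beta> k i z))\<^sup>2)"
          by (subst sum.Sigma[OF fin(1) fK]) (simp add: case_prod_unfold)
        also have "\<dots> = (\<Sum>k\<in>K. \<Sum>i\<in>I k. cmod (g k i) powr p * G k powr (q - p))"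
        proof (intro sum.cong refl)
          fix k i
          have sq: "(r powr s)\<^sup>2 = r powr (2 * s)" for r s :: real by (simp add: power2_eq_square flip: powr_add)
          have e: "2 * (q - 1 * ((q + p) / 2)) = q - p" "2 * (1 * (p / 2)) = p" by (simp_all add: field_simps)
          show "(cmod (\<beta> k i z))\<^sup>2 = cmod (g k i) powr p * G k powr (q - p)"
            unfolding n\<beta> z power_mult_distrib sq e ..
        qed
        also have "\<dots> = \<Gamma>"
          unfolding \<Gamma>_def sum_distrib_right[symmetric] Gp[symmetric] by (simp flip: powr_add)
        finally show "L2_set (\<lambda>ki. cmod (?b ki)) ?S \<le> sqrt \<Gamma>" by (simp add: L2_set_def)
        have "(\<Sum>ki\<in>?S. (cmod (?h ki))\<^sup>2) = (\<Sum>k\<in>K. \<Sum>i\<in>I k. (cmod (\<Sum>x\<in>X. M k i x * \<alpha> x z))\<^sup>2)"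
          by (subst sum.Sigma[OF fin(1) fK]) (simp add: case_prod_unfold)
        also have "\<dots> \<le> (\<Sum>x\<in>X. w x * (cmod (\<alpha> x z))\<^sup>2)" by (rule E2)
        also have "\<dots> = W"
        proof -
          have "(cmod (\<alpha> x z))\<^sup>2 = cmod (a x) powr p" for x
            unfolding n\<alpha> z power2_eq_square powr_add[symmetric] by (simp add: field_simps)
          then show ?thesis by (simp add: W_def)
        qed
        finally show "L2_set (\<lambda>ki. cmod (?h ki)) ?S \<le> sqrt W" unfolding L2_set_def by (rule real_sqrt_le_mono)
      qed (auto simp: \<Gamma>0 L2_set_nonneg)
      finally show "cmod (F z) \<le> sqrt (\<Gamma> * W)" by (simp add: real_sqrt_mult)
    qed (use \<Gamma> W in auto)
    also have "\<dots> = (\<Gamma> * W) powr (1 / p)"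
    proof -
      have "1 - t + t / 2 = 1 / p" using qp by (simp add: t_def)
      moreover have "sqrt (\<Gamma> * W) powr t = (\<Gamma> * W) powr (t / 2)"
        using \<Gamma> W by (simp add: powr_powr flip: powr_half_sqrt)
      ultimately show ?thesis by (simp flip: powr_add)
    qed
    finally have "\<Gamma> \<le> \<Gamma> powr (1 / p) * W powr (1 / p)" unfolding Ft using \<Gamma> by (simp add: powr_mult)
    moreover have "\<Gamma> = \<Gamma> powr (1 / q) * \<Gamma> powr (1 / p)" using \<Gamma> qp by (simp flip: powr_add)
    ultimately have "\<Gamma> powr (1 / q) * \<Gamma> powr (1 / p) \<le> W powr (1 / p) * \<Gamma> powr (1 / p)" by (simp add: mult.commute)
    then have "\<Gamma> powr (1 / q) \<le> W powr (1 / p)" using \<Gamma> by (simp add: mult_le_cancel_right)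
    then have "(\<Gamma> powr (1 / q)) powr q \<le> (W powr (1 / p)) powr q" using q2 by (intro powr_mono2) auto
    then show ?thesis using \<Gamma> q2 by (simp add: powr_powr)
  qed simp
  then show ?thesis by (simp add: \<Gamma>_def W_def Gq g_def)
qed

section \<open>Bochner integrals in a complete normed subspace\<close>

text \<open>A subspace with a complete norm of its own. The example is a Schatten class, which in the norm of the
  ambient space of bounded operators is in general not complete.\<close>
locale complete_normed_subspace =
  fixes V :: "'v::real_vector set" and N :: "'v \<Rightarrow> real"
  assumes zero_mem: "0 \<in> V" and add_mem: "x \<in> V \<Longrightarrow> y \<in> V \<Longrightarrow> x + y \<in> V"
    and scale_mem: "x \<in> V \<Longrightarrow> r *\<^sub>R x \<in> V"
    and N_nonneg: "0 \<le> N x" and N_add: "x \<in> V \<Longrightarrow> y \<in> V \<Longrightarrow> N (x + y) \<le> N x + N y"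
    and N_scale: "x \<in> V \<Longrightarrow> N (r *\<^sub>R x) = \<bar>r\<bar> * N x"
    and N_eq_0: "x \<in> V \<Longrightarrow> N x = 0 \<Longrightarrow> x = 0"
    and N_complete: "(\<And>n::nat. T n \<in> V) \<Longrightarrow> (\<And>e. e > 0 \<Longrightarrow> \<exists>K. \<forall>m\<ge>K. \<forall>n\<ge>K. N (T m - T n) < e) \<Longrightarrow>
      \<exists>L\<in>V. (\<lambda>n. N (T n - L)) \<longlonglongrightarrow> 0"
begin

lemma N_zero: "N 0 = 0" using N_scale[OF zero_mem, of 0] by simp

lemma minus_mem: "x \<in> V \<Longrightarrow> - x \<in> V" using scale_mem[of x "-1"] by simp

lemma diff_mem: "x \<in> V \<Longrightarrow> y \<in> V \<Longrightarrow> x - y \<in> V" using add_mem[of x "- y"] minus_mem by simp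

lemma N_commute: "x \<in> V \<Longrightarrow> y \<in> V \<Longrightarrow> N (x - y) = N (y - x)"
  using N_scale[OF diff_mem, of y x "-1"] by simp

lemma N_triangle: "x \<in> V \<Longrightarrow> y \<in> V \<Longrightarrow> z \<in> V \<Longrightarrow> N (x - z) \<le> N (x - y) + N (y - z)"
  using N_add[OF diff_mem[of x y] diff_mem[of y z]] by simp

lemma N_diff_le: "x \<in> V \<Longrightarrow> y \<in> V \<Longrightarrow> N (x - y) \<le> N x + N y"
  using N_add[of x "- y"] minus_mem[of y] N_scale[of y "-1"] by simp

lemma N_reverse: "x \<in> V \<Longrightarrow> y \<in> V \<Longrightarrow> \<bar>N x - N y\<bar> \<le> N (x - y)"
  using N_add[OF diff_mem[of x y], of y] N_add[OF diff_mem[of y x], of x] N_commute[of x y] by simp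

lemma sum_mem: "(\<And>i. i \<in> I \<Longrightarrow> f i \<in> V) \<Longrightarrow> (\<Sum>i\<in>I. f i) \<in> V"
  by (induction I rule: infinite_finite_induct) (auto intro: zero_mem add_mem)

lemma N_sum: "(\<And>i. i \<in> I \<Longrightarrow> f i \<in> V) \<Longrightarrow> N (\<Sum>i\<in>I. f i) \<le> (\<Sum>i\<in>I. N (f i))"
proof (induction I rule: infinite_finite_induct)
  case (insert i I)
  then have "N (f i + (\<Sum>i\<in>I. f i)) \<le> N (f i) + N (\<Sum>i\<in>I. f i)" by (intro N_add sum_mem) auto
  then show ?case using insert by fastforce
qed (simp_all add: N_zero)

end

locale bochner_subspace = complete_normed_subspace V N + finite_measure M
  for V :: "'v::real_vector set" and N :: "'v \<Rightarrow> real" and M :: "'a measure"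
begin

abbreviation sbi where "sbi \<equiv> Bochner_Integration.simple_bochner_integral M"

abbreviation L1_dist where "L1_dist f g \<equiv> \<integral>\<^sup>+x. ennreal (N (f x - g x)) \<partial>M"

definition simple_in :: "('a \<Rightarrow> 'v) \<Rightarrow> bool" where
  "simple_in s \<longleftrightarrow> simple_function M s \<and> s \<in> space M \<rightarrow> V"

lemma simple_integrable: "simple_function M s \<Longrightarrow> Bochner_Integration.simple_bochner_integrable M s"
  using emeasure_finite by (intro Bochner_Integration.simple_bochner_integrable.intros) auto

lemma simple_N_measurable: "simple_function M s \<Longrightarrow> (\<lambda>x. N (s x)) \<in> borel_measurable M"
  by (rule borel_measurable_simple_function[OF simple_function_compose1])

lemma simple_in_diff: "simple_in s \<Longrightarrow> simple_in t \<Longrightarrow> simple_in (\<lambda>x. s x - t x)"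
  using simple_function_compose2[of M s t "(-)"] unfolding simple_in_def Pi_def by (auto intro: diff_mem)

lemma sbi_mem: "simple_in s \<Longrightarrow> sbi s \<in> V"
  unfolding Bochner_Integration.simple_bochner_integral_def simple_in_def
  by (intro sum_mem scale_mem) auto

lemma N_sbi:
  assumes "simple_in s"
  shows "ennreal (N (sbi s)) \<le> (\<integral>\<^sup>+x. ennreal (N (s x)) \<partial>M)"
proof -
  have s: "simple_function M s" "s \<in> space M \<rightarrow> V" using assms by (auto simp: simple_in_def)
  have "N (sbi s) \<le> (\<Sum>y\<in>s ` space M. N (measure M {x \<in> space M. s x = y} *\<^sub>R y))"
    unfolding Bochner_Integration.simple_bochner_integral_def using s by (intro N_sum scale_mem) auto
  also have "\<dots> = (\<Sum>y\<in>s ` space M. measure M {x \<in> space M. s x = y} *\<^sub>R N y)"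
    using s by (intro sum.cong refl) (auto simp: N_scale Pi_iff)
  also have "\<dots> = sbi (\<lambda>x. N (s x))"
    using s(1) by (intro Bochner_Integration.simple_bochner_integral_partition[symmetric]
        simple_integrable[OF simple_function_compose1[OF s(1)]]) auto
  finally have "ennreal (N (sbi s)) \<le> ennreal (sbi (\<lambda>x. N (s x)))" by (rule ennreal_leI)
  also have "\<dots> = (\<integral>\<^sup>+x. ennreal (N (s x)) \<partial>M)"
    by (rule Bochner_Integration.simple_bochner_integral_eq_nn_integral[OF simple_integrable[OF simple_function_compose1[OF s(1)]] N_nonneg])
  finally show ?thesis .
qed

text \<open>The function \<open>N \<circ> f\<close> need not be measurable. Up to a null set it is the limit of the measurable functions
  \<open>N \<circ> t j\<close> with simple \<open>t j\<close>, and the lower limit of the latter is measurable everywhere.\<close>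
lemma measurable_version:
  assumes f: "strongly_measurable_in M V N f" and s: "simple_in s"
  obtains h where "h \<in> borel_measurable M" "AE x in M. h x = ennreal (N (f x - s x))"
proof -
  obtain t where t: "\<And>i. simple_function M (t i)" "\<And>i. t i \<in> space M \<rightarrow> V"
    "AE x in M. (\<lambda>i. N (f x - t i x)) \<longlonglongrightarrow> 0" and fV: "f \<in> space M \<rightarrow> V"
    using f unfolding strongly_measurable_in_def by auto
  define h where "h x = liminf (\<lambda>j. ennreal (N (t j x - s x)))" for x
  show thesis
  proof
    have "(\<lambda>x. ennreal (N (t j x - s x))) \<in> borel_measurable M" for j
    proof -
      have "simple_function M s" using s by (simp add: simple_in_def)
      then have "simple_function M (\<lambda>x. t j x - s x)" by (rule simple_function_compose2[OF t(1)])
      then show ?thesis by (rule measurable_compose[OF simple_N_measurable measurable_ennreal])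
    qed
    then show "h \<in> borel_measurable M" unfolding h_def by measurable
    show "AE x in M. h x = ennreal (N (f x - s x))"
      using t(3) AE_space
    proof eventually_elim
      case (elim x)
      have mem: "f x \<in> V" "\<And>j. t j x \<in> V" "s x \<in> V" using elim(2) fV t(2) s by (auto simp: simple_in_def)
      have "(\<lambda>j. N (t j x - s x)) \<longlonglongrightarrow> N (f x - s x)"
      proof (rule LIM_zero_cancel, rule Lim_null_comparison[OF always_eventually elim(1)], rule allI)
        fix j
        show "norm (N (t j x - s x) - N (f x - s x)) \<le> N (f x - t j x)"
          using N_reverse[OF diff_mem[OF mem(2,3)] diff_mem[OF mem(1,3)], of j] N_commute[OF mem(1) mem(2), of j]
          by simp
      qed
      then have "(\<lambda>j. ennreal (N (t j x - s x))) \<longlonglongrightarrow> ennreal (N (f x - s x))" by (rule tendsto_ennrealI)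
      then show ?case unfolding h_def by (intro lim_imp_Liminf) auto
    qed
  qed
qed

lemma nn_integral_N_triangle:
  assumes f: "strongly_measurable_in M V N f" and s: "simple_in s" and t: "simple_in t"
  shows "(\<integral>\<^sup>+x. ennreal (N (s x - t x)) \<partial>M) \<le> L1_dist f s + L1_dist f t"
proof -
  obtain h where h: "h \<in> borel_measurable M" "AE x in M. h x = ennreal (N (f x - s x))"
    using measurable_version[OF f s] by blast
  obtain k where k: "k \<in> borel_measurable M" "AE x in M. k x = ennreal (N (f x - t x))"
    using measurable_version[OF f t] by blast
  have "(\<integral>\<^sup>+x. ennreal (N (s x - t x)) \<partial>M) \<le> (\<integral>\<^sup>+x. h x + k x \<partial>M)"
  proof (rule nn_integral_mono_AE)
    show "AE x in M. ennreal (N (s x - t x)) \<le> h x + k x"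
      using h(2) k(2) AE_space
    proof eventually_elim
      case (elim x)
      have mem: "f x \<in> V" "t x \<in> V" "s x \<in> V"
        using elim(3) f s t by (auto simp: simple_in_def strongly_measurable_in_def)
      have "N (s x - t x) \<le> N (f x - s x) + N (f x - t x)"
        using N_triangle[OF mem(3,1,2)] N_commute[OF mem(1,3)] by simp
      then have "ennreal (N (s x - t x)) \<le> ennreal (N (f x - s x) + N (f x - t x))" by (rule ennreal_leI)
      then show ?case unfolding elim(1,2) by (simp add: N_nonneg)
    qed
  qed
  also have "\<dots> = (\<integral>\<^sup>+x. h x \<partial>M) + (\<integral>\<^sup>+x. k x \<partial>M)" by (rule nn_integral_add[OF h(1) k(1)])
  also have "\<dots> = L1_dist f s + L1_dist f t"
    using nn_integral_cong_AE[OF h(2)] nn_integral_cong_AE[OF k(2)] by simp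
  finally show ?thesis .
qed

lemma nn_integral_N_finite:
  assumes f: "strongly_measurable_in M V N f" and p: "1 \<le> p"
    and fin: "(\<integral>\<^sup>+x. ennreal (N (f x) powr p) \<partial>M) < \<infinity>"
  shows "(\<integral>\<^sup>+x. ennreal (N (f x)) \<partial>M) < \<infinity>"
proof -
  have "simple_in (\<lambda>x. 0)" by (auto simp: simple_in_def zero_mem)
  from measurable_version[OF f this] obtain h where
    h: "h \<in> borel_measurable M" "AE x in M. h x = ennreal (N (f x - 0))" by blast
  define g where "g x = enn2real (h x)" for x
  have [measurable]: "g \<in> borel_measurable M" unfolding g_def using h(1) by measurable
  have gN: "AE x in M. ennreal (N (f x)) = ennreal (g x) \<and> ennreal (N (f x) powr p) = ennreal (g x powr p)"
    using h(2) by eventually_elim (simp add: g_def N_nonneg)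
  have "(\<integral>\<^sup>+x. ennreal (N (f x)) \<partial>M) = (\<integral>\<^sup>+x. ennreal (g x) \<partial>M)"
    by (rule nn_integral_cong_AE) (use gN in eventually_elim, simp)
  also have "\<dots> \<le> (\<integral>\<^sup>+x. 1 + ennreal (g x powr p) \<partial>M)"
  proof (rule nn_integral_mono)
    fix x
    have "g x \<le> 1 + g x powr p"
    proof (cases "g x \<le> 1")
      case False
      then have "g x powr 1 \<le> g x powr p" using p by (intro powr_mono) auto
      then show ?thesis using False by simp
    qed (simp add: add_increasing2)
    from ennreal_leI[OF this] show "ennreal (g x) \<le> 1 + ennreal (g x powr p)" by simp
  qed
  also have "\<dots> = emeasure M (space M) + (\<integral>\<^sup>+x. ennreal (g x powr p) \<partial>M)"
    by (simp add: nn_integral_add)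
  also have "(\<integral>\<^sup>+x. ennreal (g x powr p) \<partial>M) = (\<integral>\<^sup>+x. ennreal (N (f x) powr p) \<partial>M)"
    by (rule nn_integral_cong_AE) (use gN in eventually_elim, simp)
  also have "emeasure M (space M) + \<dots> < \<infinity>"
    using fin emeasure_finite[of "space M"] by (simp add: less_top[symmetric])
  finally show ?thesis .
qed

text \<open>Almost everywhere convergence of simple functions becomes convergence of integrals by truncation: where
  \<open>N (t i x)\<close> exceeds \<open>2 g x\<close> the approximation is replaced by zero, for a measurable version \<open>g\<close> of
  \<open>N \<circ> f\<close>. The truncated functions converge as before and are dominated.\<close>
lemma simple_approximation:
  assumes f: "strongly_measurable_in M V N f" and p: "1 \<le> p"
    and fin: "(\<integral>\<^sup>+x. ennreal (N (f x) powr p) \<partial>M) < \<infinity>"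
  obtains s where "\<And>i. simple_in (s i)"
    "(\<lambda>i. L1_dist f (s i)) \<longlonglongrightarrow> 0"
    "(\<lambda>i. \<integral>\<^sup>+x. ennreal (N (s i x) powr p) \<partial>M) \<longlonglongrightarrow> (\<integral>\<^sup>+x. ennreal (N (f x) powr p) \<partial>M)"
proof -
  obtain t where t: "\<And>i. simple_function M (t i)" "\<And>i. t i \<in> space M \<rightarrow> V"
    "AE x in M. (\<lambda>i. N (f x - t i x)) \<longlonglongrightarrow> 0" and fV: "f \<in> space M \<rightarrow> V"
    using f unfolding strongly_measurable_in_def by auto
  have "simple_in (\<lambda>x. 0)" by (auto simp: simple_in_def zero_mem)
  from measurable_version[OF f this] obtain h where
    h: "h \<in> borel_measurable M" "AE x in M. h x = ennreal (N (f x - 0))" by blast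
  define g where "g x = enn2real (h x)" for x
  have g[measurable]: "g \<in> borel_measurable M" unfolding g_def using h(1) by measurable
  have gN: "AE x in M. g x = N (f x)" using h(2) by eventually_elim (simp add: g_def N_nonneg)
  \<comment> \<open>The factor 2 leaves room for convergence where \<open>g x > 0\<close>; where \<open>g x = 0\<close> the value of \<open>f\<close> is zero.\<close>
  define s where "s i x = (if N (t i x) \<le> 2 * g x then t i x else 0)" for i x
  have s: "simple_in (s i)" for i
  proof -
    have [measurable]: "(\<lambda>x. N (t i x)) \<in> borel_measurable M" by (rule simple_N_measurable[OF t(1)])
    have "simple_function M (s i)" unfolding s_def by (rule simple_function_If[OF t(1)]) (simp, measurable)
    then show ?thesis using t(2) by (auto simp: simple_in_def s_def zero_mem Pi_iff)
  qed
  have lim: "AE x in M. (\<lambda>i. N (f x - s i x)) \<longlonglongrightarrow> 0 \<and> g x = N (f x) \<and> f x \<in> V \<and> (\<forall>i. s i x \<in> V \<and> N (s i x) \<le> 2 * g x)"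
    using t(3) gN AE_space
  proof eventually_elim
    case (elim x)
    have mem: "f x \<in> V" "\<And>j. t j x \<in> V" "\<And>j. s j x \<in> V" using elim(3) fV t(2) s by (auto simp: simple_in_def Pi_iff)
    have g0: "g x \<ge> 0" by (simp add: elim(2) N_nonneg)
    have bd: "N (s i x) \<le> 2 * g x" for i using g0 by (simp add: s_def N_zero)
    have "(\<lambda>i. N (f x - s i x)) \<longlonglongrightarrow> 0"
    proof (cases "g x = 0")
      case True
      have "N (f x - s i x) = 0" for i
        using N_diff_le[OF mem(1) mem(3)[of i]] bd[of i] True elim(2) N_nonneg[of "f x - s i x"] by simp
      then show ?thesis by simp
    next
      case False
      have "(\<lambda>j. N (t j x)) \<longlonglongrightarrow> N (f x)"
      proof (rule LIM_zero_cancel, rule Lim_null_comparison[OF always_eventually elim(1)], rule allI)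
        fix j
        show "norm (N (t j x) - N (f x)) \<le> N (f x - t j x)"
          using N_reverse[OF mem(2) mem(1), of j] N_commute[OF mem(1) mem(2), of j] by simp
      qed
      moreover have "N (f x) < 2 * g x" using False g0 elim(2) by simp
      ultimately have "\<forall>\<^sub>F j in sequentially. N (t j x) < 2 * g x" by (rule order_tendstoD(2))
      then have "\<forall>\<^sub>F j in sequentially. N (f x - t j x) = N (f x - s j x)"
        by eventually_elim (simp add: s_def)
      then show ?thesis using elim(1) by (rule Lim_transform_eventually[rotated])
    qed
    then show ?case using elim(2) mem bd by auto
  qed
  have "\<exists>h. h \<in> borel_measurable M \<and> (AE x in M. h x = ennreal (N (f x - s i x)))" for i
    using measurable_version[OF f s] by blast
  then obtain u where u: "\<And>i. u i \<in> borel_measurable M" "\<And>i. AE x in M. u i x = ennreal (N (f x - s i x))" by metis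
  have finp: "(\<integral>\<^sup>+x. ennreal (g x powr p) \<partial>M) < \<infinity>"
  proof -
    have "AE x in M. ennreal (g x powr p) = ennreal (N (f x) powr p)" using gN by eventually_elim simp
    then show ?thesis using nn_integral_cong_AE fin by metis
  qed
  have fin3: "(\<integral>\<^sup>+x. 3 * ennreal (g x) \<partial>M) < \<infinity>"
  proof -
    have "AE x in M. ennreal (g x) = ennreal (N (f x))" using gN by eventually_elim simp
    then have "(\<integral>\<^sup>+x. ennreal (g x) \<partial>M) < \<infinity>"
      using nn_integral_cong_AE nn_integral_N_finite[OF f p fin] by metis
    then show ?thesis by (simp add: nn_integral_cmult ennreal_mult_less_top)
  qed
  show thesis
  proof (rule that[OF s])
    have "(\<lambda>i. \<integral>\<^sup>+x. u i x \<partial>M) \<longlonglongrightarrow> (\<integral>\<^sup>+x. 0 \<partial>M)"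
    proof (rule nn_integral_dominated_convergence[OF u(1) _ _ _ fin3])
      show "AE x in M. u j x \<le> 3 * ennreal (g x)" for j
        using u(2)[of j] lim
      proof eventually_elim
        case (elim x)
        then have "N (f x - s j x) \<le> 3 * g x"
          using N_diff_le[of "f x" "s j x"] by (smt (verit))
        then have "ennreal (N (f x - s j x)) \<le> ennreal 3 * ennreal (g x)"
          by (subst ennreal_mult'[symmetric]) (simp_all add: ennreal_leI)
        then show ?case using elim by simp
      qed
      have "AE x in M. \<forall>i. u i x = ennreal (N (f x - s i x))" using u(2) by (simp add: AE_all_countable)
      then show "AE x in M. (\<lambda>i. u i x) \<longlonglongrightarrow> 0"
        using lim
      proof eventually_elim
        case (elim x)
        then show ?case using tendsto_ennrealI[of "\<lambda>i. N (f x - s i x)" 0] by simp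
      qed
    qed simp_all
    then show "(\<lambda>i. L1_dist f (s i)) \<longlonglongrightarrow> 0"
      using nn_integral_cong_AE[OF u(2)] by simp
    have "(\<lambda>i. \<integral>\<^sup>+x. ennreal (N (s i x) powr p) \<partial>M) \<longlonglongrightarrow> (\<integral>\<^sup>+x. ennreal (g x powr p) \<partial>M)"
    proof (rule nn_integral_dominated_convergence[where w = "\<lambda>x. ennreal (2 powr p) * ennreal (g x powr p)"])
      show "(\<lambda>x. ennreal (N (s j x) powr p)) \<in> borel_measurable M" for j
        using s[of j] simple_N_measurable[of "s j"] by (simp add: simple_in_def)
      show "AE x in M. ennreal (N (s j x) powr p) \<le> ennreal (2 powr p) * ennreal (g x powr p)" for j
        using lim
      proof eventually_elim
        case (elim x)
        then have "N (s j x) powr p \<le> (2 * g x) powr p" using p N_nonneg by (intro powr_mono2) auto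
        then show ?case by (simp add: powr_mult ennreal_leI flip: ennreal_mult)
      qed
      show "(\<integral>\<^sup>+x. ennreal (2 powr p) * ennreal (g x powr p) \<partial>M) < \<infinity>"
        using finp by (simp add: nn_integral_cmult ennreal_mult_less_top)
      show "AE x in M. (\<lambda>i. ennreal (N (s i x) powr p)) \<longlonglongrightarrow> ennreal (g x powr p)"
        using lim
      proof eventually_elim
        case (elim x)
        have "(\<lambda>j. N (s j x)) \<longlonglongrightarrow> N (f x)"
        proof (rule LIM_zero_cancel, rule Lim_null_comparison[OF always_eventually], rule allI)
          fix j
          show "norm (N (s j x) - N (f x)) \<le> N (f x - s j x)"
            using N_reverse[of "s j x" "f x"] N_commute[of "f x" "s j x"] elim by simp
          show "(\<lambda>j. N (f x - s j x)) \<longlonglongrightarrow> 0" using elim by simp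
        qed
        then have "(\<lambda>j. N (s j x) powr p) \<longlonglongrightarrow> g x powr p"
          using elim p N_nonneg by (intro tendsto_powr') auto
        then show ?case by (rule tendsto_ennrealI)
      qed
    qed measurable
    moreover have "(\<integral>\<^sup>+x. ennreal (g x powr p) \<partial>M) = (\<integral>\<^sup>+x. ennreal (N (f x) powr p) \<partial>M)"
    proof (rule nn_integral_cong_AE)
      show "AE x in M. ennreal (g x powr p) = ennreal (N (f x) powr p)" using gN by eventually_elim simp
    qed
    ultimately show "(\<lambda>i. \<integral>\<^sup>+x. ennreal (N (s i x) powr p) \<partial>M) \<longlonglongrightarrow> (\<integral>\<^sup>+x. ennreal (N (f x) powr p) \<partial>M)" by simp
  qed
qed

lemma N_sbi_diff:
  assumes f: "strongly_measurable_in M V N f" and s: "simple_in s" and t: "simple_in t"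
  shows "ennreal (N (sbi s - sbi t)) \<le> L1_dist f s + L1_dist f t"
proof -
  have "sbi s - sbi t = sbi (\<lambda>x. s x - t x)"
    using s t by (intro Bochner_Integration.simple_bochner_integral_diff[symmetric] simple_integrable) (auto simp: simple_in_def)
  then show ?thesis
    using N_sbi[OF simple_in_diff[OF s t]] nn_integral_N_triangle[OF f s t] by (auto intro: order_trans)
qed

lemma bochner_integral_exists:
  assumes f: "strongly_measurable_in M V N f" and fin: "(\<integral>\<^sup>+x. ennreal (N (f x)) \<partial>M) < \<infinity>"
  shows "\<exists>I. has_bochner_integral_in M V N f I"
proof -
  have fin1: "(\<integral>\<^sup>+x. ennreal (N (f x) powr 1) \<partial>M) < \<infinity>" using fin N_nonneg by simp
  obtain s where s: "\<And>i. simple_in (s i)" and lim: "(\<lambda>i. L1_dist f (s i)) \<longlonglongrightarrow> 0"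
    by (rule simple_approximation[OF f order_refl fin1]) blast
  have "\<exists>I\<in>V. (\<lambda>i. N (sbi (s i) - I)) \<longlonglongrightarrow> 0"
  proof (rule N_complete)
    show "sbi (s n) \<in> V" for n by (rule sbi_mem[OF s])
    fix e :: real assume e: "e > 0"
    have "\<forall>\<^sub>F i in sequentially. L1_dist f (s i) < ennreal (e / 2)"
      using e by (intro order_tendstoD(2)[OF lim]) simp
    then obtain K where K: "\<And>i. i \<ge> K \<Longrightarrow> L1_dist f (s i) < ennreal (e / 2)"
      unfolding eventually_sequentially by blast
    have "N (sbi (s m) - sbi (s n)) < e" if "m \<ge> K" "n \<ge> K" for m n
    proof -
      have "ennreal (N (sbi (s m) - sbi (s n))) < ennreal (e / 2) + ennreal (e / 2)"
        using N_sbi_diff[OF f s s, of m n] K[OF that(1)] K[OF that(2)]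
        by (meson add_strict_mono order_le_less_trans)
      then show ?thesis using e by (simp add: ennreal_less_iff N_nonneg flip: ennreal_plus)
    qed
    then show "\<exists>K. \<forall>m\<ge>K. \<forall>n\<ge>K. N (sbi (s m) - sbi (s n)) < e" by blast
  qed
  then obtain I where "I \<in> V" "(\<lambda>i. N (sbi (s i) - I)) \<longlonglongrightarrow> 0" by blast
  then have "has_bochner_integral_in M V N f I"
    unfolding has_bochner_integral_in_def using f s lim simple_integrable
    by (auto simp: simple_in_def intro!: exI[of _ s])
  then show ?thesis by blast
qed

lemma has_bochner_integral_inD:
  assumes "has_bochner_integral_in M V N f I"
  obtains s where "\<And>i. simple_in (s i)" "(\<lambda>i. L1_dist f (s i)) \<longlonglongrightarrow> 0"
    "(\<lambda>i. N (sbi (s i) - I)) \<longlonglongrightarrow> 0" "I \<in> V" "strongly_measurable_in M V N f"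
proof -
  obtain s where s: "\<And>i. Bochner_Integration.simple_bochner_integrable M (s i) \<and> s i \<in> space M \<rightarrow> V"
    "(\<lambda>i. L1_dist f (s i)) \<longlonglongrightarrow> 0" "(\<lambda>i. N (sbi (s i) - I)) \<longlonglongrightarrow> 0"
    using assms unfolding has_bochner_integral_in_def by blast
  have "simple_in (s i)" for i
    using s(1)[of i] by (auto simp: simple_in_def Bochner_Integration.simple_bochner_integrable.simps)
  then show thesis using that s assms unfolding has_bochner_integral_in_def by blast
qed

lemma has_bochner_integral_in_unique:
  assumes I: "has_bochner_integral_in M V N f I" and J: "has_bochner_integral_in M V N f J"
  shows "I = J"
proof -
  obtain s where s: "\<And>i. simple_in (s i)" "(\<lambda>i. L1_dist f (s i)) \<longlonglongrightarrow> 0"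
    "(\<lambda>i. N (sbi (s i) - I)) \<longlonglongrightarrow> 0" "I \<in> V" "strongly_measurable_in M V N f"
    by (rule has_bochner_integral_inD[OF I]) blast
  obtain t where t: "\<And>i. simple_in (t i)" "(\<lambda>i. L1_dist f (t i)) \<longlonglongrightarrow> 0"
    "(\<lambda>i. N (sbi (t i) - J)) \<longlonglongrightarrow> 0" "J \<in> V" "strongly_measurable_in M V N f"
    by (rule has_bochner_integral_inD[OF J]) blast
  have "(\<lambda>i. ennreal (N (sbi (s i) - sbi (t i)))) \<longlonglongrightarrow> 0"
  proof (rule tendsto_sandwich[OF _ _ tendsto_const])
    show "(\<lambda>i. L1_dist f (s i) + L1_dist f (t i)) \<longlonglongrightarrow> 0"
      using tendsto_add[OF s(2) t(2)] by simp
  qed (use N_sbi_diff[OF s(5) s(1) t(1)] in \<open>auto intro!: always_eventually\<close>)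
  then have "(\<lambda>i. N (sbi (s i) - sbi (t i))) \<longlonglongrightarrow> 0"
    using N_nonneg by (simp add: ennreal_tendsto_0_iff)
  then have lim: "(\<lambda>i. N (sbi (s i) - I) + N (sbi (s i) - sbi (t i)) + N (sbi (t i) - J)) \<longlonglongrightarrow> 0 + 0 + 0"
    by (intro tendsto_add s(3) t(3))
  have "N (I - J) \<le> N (sbi (s i) - I) + N (sbi (s i) - sbi (t i)) + N (sbi (t i) - J)" for i
    using N_triangle[OF s(4) sbi_mem[OF s(1)] t(4), of i] N_triangle[OF sbi_mem[OF s(1)] sbi_mem[OF t(1)] t(4), of i i]
      N_commute[OF s(4) sbi_mem[OF s(1)], of i] by simp
  then have "N (I - J) \<le> 0" using LIMSEQ_le_const[OF lim, of "N (I - J)"] by auto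
  then have "N (I - J) = 0" using N_nonneg[of "I - J"] by simp
  then have "I - J = 0" by (rule N_eq_0[OF diff_mem[OF s(4) t(4)]])
  then show ?thesis by simp
qed

text \<open>Existence and uniqueness make the definite description \<open>bochner_integral_in\<close> meaningful.\<close>
lemma has_bochner_integral_in_integral:
  assumes "strongly_measurable_in M V N f" "(\<integral>\<^sup>+x. ennreal (N (f x)) \<partial>M) < \<infinity>"
  shows "has_bochner_integral_in M V N f (bochner_integral_in M V N f)"
  unfolding bochner_integral_in_def
  by (rule theI'[OF ex_ex1I[OF bochner_integral_exists[OF assms] has_bochner_integral_in_unique]])

text \<open>A bounded functional commutes with the integral. Since \<open>\<phi> \<circ> f\<close> need not be measurable, this is expressed
  as a comparison with any integrable scalar function \<open>u\<close> near \<open>\<phi> \<circ> f\<close>.\<close>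
lemma functional_integral_estimate:
  fixes \<phi> :: "'v \<Rightarrow> complex"
  assumes I: "has_bochner_integral_in M V N f I"
    and \<phi>: "linear \<phi>" "\<And>x. x \<in> V \<Longrightarrow> cmod (\<phi> x) \<le> C * N x" and C: "0 \<le> C"
    and u: "integrable M u" and h: "h \<in> borel_measurable M" "AE x in M. ennreal (cmod (\<phi> (f x) - u x)) \<le> h x"
  shows "ennreal (cmod (\<phi> I - integral\<^sup>L M u)) \<le> (\<integral>\<^sup>+x. h x \<partial>M)"
proof -
  interpret \<phi>: linear \<phi> by (rule \<phi>(1))
  obtain s where s: "\<And>i. simple_in (s i)" "(\<lambda>i. L1_dist f (s i)) \<longlonglongrightarrow> 0"
    "(\<lambda>i. N (sbi (s i) - I)) \<longlonglongrightarrow> 0" "I \<in> V" "strongly_measurable_in M V N f"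
    by (rule has_bochner_integral_inD[OF I]) blast
  let ?d = "\<lambda>i. L1_dist f (s i)"
  have le: "ennreal (cmod (\<phi> I - integral\<^sup>L M u)) \<le> ennreal (C * N (sbi (s i) - I)) + (ennreal C * ?d i + (\<integral>\<^sup>+x. h x \<partial>M))" for i
  proof -
    obtain k where k: "k \<in> borel_measurable M" "AE x in M. k x = ennreal (N (f x - s i x))"
      using measurable_version[OF s(5) s(1)] by blast
    have si: "simple_function M (s i)" using s(1) by (simp add: simple_in_def)
    have sb: "Bochner_Integration.simple_bochner_integrable M (\<lambda>x. \<phi> (s i x))"
      by (rule simple_integrable[OF simple_function_compose1[OF si]])
    have int: "integrable M (\<lambda>x. \<phi> (s i x))"
      using has_bochner_integral_simple_bochner_integrable[OF sb] by (rule integrable.intros)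
    have "\<phi> (sbi (s i)) = sbi (\<lambda>x. \<phi> (s i x))"
      by (rule Bochner_Integration.simple_bochner_integral_linear[OF \<phi>(1) simple_integrable[OF si], symmetric])
    also have "\<dots> = integral\<^sup>L M (\<lambda>x. \<phi> (s i x))"
      by (rule simple_bochner_integrable_eq_integral[OF sb])
    finally have "\<phi> (sbi (s i)) - integral\<^sup>L M u = integral\<^sup>L M (\<lambda>x. \<phi> (s i x) - u x)"
      using int u by simp
    then have "ennreal (cmod (\<phi> (sbi (s i)) - integral\<^sup>L M u)) \<le> (\<integral>\<^sup>+x. ennreal (cmod (\<phi> (s i x) - u x)) \<partial>M)"
      using integral_norm_bound_ennreal[of M "\<lambda>x. \<phi> (s i x) - u x"] int u by simp
    also have "\<dots> \<le> (\<integral>\<^sup>+x. ennreal C * k x + h x \<partial>M)"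
    proof (rule nn_integral_mono_AE)
      show "AE x in M. ennreal (cmod (\<phi> (s i x) - u x)) \<le> ennreal C * k x + h x"
        using k(2) h(2) AE_space
      proof eventually_elim
        case (elim x)
        have mem: "f x \<in> V" "s i x \<in> V"
          using elim(3) s(1)[of i] s(5) by (auto simp: simple_in_def strongly_measurable_in_def)
        have "cmod (\<phi> (s i x) - \<phi> (f x)) \<le> C * N (f x - s i x)"
          using \<phi>(2)[OF diff_mem[OF mem(2,1)]] by (simp add: \<phi>.diff N_commute[OF mem])
        then have "cmod (\<phi> (s i x) - u x) \<le> C * N (f x - s i x) + cmod (\<phi> (f x) - u x)"
          using norm_triangle_ineq[of "\<phi> (s i x) - \<phi> (f x)" "\<phi> (f x) - u x"] by simp
        from ennreal_leI[OF this]
        have "ennreal (cmod (\<phi> (s i x) - u x)) \<le> ennreal (C * N (f x - s i x)) + ennreal (cmod (\<phi> (f x) - u x))"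
          using C N_nonneg[of "f x - s i x"] by simp
        also have "\<dots> \<le> ennreal C * k x + h x"
          using elim(1,2) C N_nonneg by (intro add_mono) (simp_all add: ennreal_mult)
        finally show ?case .
      qed
    qed
    also have "\<dots> = ennreal C * ?d i + (\<integral>\<^sup>+x. h x \<partial>M)"
      using k(1) h(1) nn_integral_cong_AE[OF k(2)] by (simp add: nn_integral_add nn_integral_cmult)
    finally have 1: "ennreal (cmod (\<phi> (sbi (s i)) - integral\<^sup>L M u)) \<le> ennreal C * ?d i + (\<integral>\<^sup>+x. h x \<partial>M)" .
    have "cmod (\<phi> (sbi (s i)) - \<phi> I) \<le> C * N (sbi (s i) - I)"
      using \<phi>(2)[OF diff_mem[OF sbi_mem[OF s(1)] s(4)]] by (simp add: \<phi>.diff)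
    then have "cmod (\<phi> I - integral\<^sup>L M u) \<le> C * N (sbi (s i) - I) + cmod (\<phi> (sbi (s i)) - integral\<^sup>L M u)"
      using norm_triangle_ineq[of "\<phi> I - \<phi> (sbi (s i))" "\<phi> (sbi (s i)) - integral\<^sup>L M u"]
      by (simp add: norm_minus_commute)
    from ennreal_leI[OF this]
    have "ennreal (cmod (\<phi> I - integral\<^sup>L M u)) \<le> ennreal (C * N (sbi (s i) - I)) + ennreal (cmod (\<phi> (sbi (s i)) - integral\<^sup>L M u))"
      using C N_nonneg[of "sbi (s i) - I"] by simp
    then show ?thesis using 1 by (meson add_left_mono order_trans)
  qed
  have "(\<lambda>i. ennreal (C * N (sbi (s i) - I))) \<longlonglongrightarrow> ennreal (C * 0)"
    by (intro tendsto_ennrealI tendsto_mult tendsto_const s(3))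
  moreover have "(\<lambda>i. ennreal C * ?d i) \<longlonglongrightarrow> ennreal C * 0"
    by (intro tendsto_mult_ennreal tendsto_const s(2)) auto
  ultimately have "(\<lambda>i. ennreal (C * N (sbi (s i) - I)) + (ennreal C * ?d i + (\<integral>\<^sup>+x. h x \<partial>M)))
      \<longlonglongrightarrow> ennreal (C * 0) + (ennreal C * 0 + (\<integral>\<^sup>+x. h x \<partial>M))"
    by (intro tendsto_add tendsto_const)
  from LIMSEQ_le_const[OF this, of "ennreal (cmod (\<phi> I - integral\<^sup>L M u))"] show ?thesis using le by auto
qed

end

section \<open>Characters\<close>

lemma borel_measurable_cnj [measurable]:
  "f \<in> borel_measurable M \<Longrightarrow> (\<lambda>x. cnj (f x)) \<in> borel_measurable M"
  by (rule measurable_compose[OF _ borel_measurable_continuous_onI[OF continuous_on_cnj[OF continuous_on_id]]])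

lemma dual_group_measurable:
  assumes "k \<in> dual_group" "sets M = sets borel"
  shows "k \<in> borel_measurable M"
proof -
  have "k \<in> borel_measurable borel"
    using assms(1) by (intro borel_measurable_continuous_onI) (simp add: dual_group_def)
  then show ?thesis by (simp cong: measurable_cong_sets add: assms(2))
qed

lemma haar_prob: "normalized_haar_measure M \<Longrightarrow> space M = UNIV" "normalized_haar_measure M \<Longrightarrow> finite_measure M"
  "normalized_haar_measure M \<Longrightarrow> measure M UNIV = 1"
proof -
  assume M: "normalized_haar_measure M"
  then have "sets M = sets borel" by (simp add: normalized_haar_measure_def)
  from sets_eq_imp_space_eq[OF this] show sp: "space M = UNIV" by simp
  show "finite_measure M" using M by (intro finite_measureI) (simp add: sp normalized_haar_measure_def)
  show "measure M UNIV = 1" using M by (simp add: normalized_haar_measure_def measure_def)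
qed

lemma haar_translation:
  fixes M :: "'g::topological_ab_group_add measure" and f :: "'g \<Rightarrow> complex"
  assumes M: "normalized_haar_measure M" and f: "f \<in> borel_measurable M"
  shows "integral\<^sup>L M (\<lambda>x. f (a + x)) = integral\<^sup>L M f"
proof -
  have sets: "sets M = sets borel" using M by (simp add: normalized_haar_measure_def)
  have "(\<lambda>x. a + x) \<in> borel_measurable borel"
    by (intro borel_measurable_continuous_onI continuous_intros)
  then have meas: "(+) a \<in> measurable M M" by (simp cong: measurable_cong_sets add: sets)
  have "distr M M ((+) a) = M"
  proof (rule measure_eqI)
    have "\<forall>a. \<forall>E\<in>sets borel. emeasure M ((+) a ` E) = emeasure M E"
      using M unfolding normalized_haar_measure_def by (elim conjE)
    then have inv: "E \<in> sets borel \<Longrightarrow> emeasure M ((+) a ` E) = emeasure M E" for a E by simp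
    fix E assume "E \<in> sets (distr M M ((+) a))"
    then have E: "E \<in> sets M" by simp
    have "(+) a -` E = (+) (- a) ` E"
    proof safe
      fix x assume "a + x \<in> E"
      then show "x \<in> (+) (- a) ` E" by (intro image_eqI[of _ _ "a + x"]) auto
    qed simp
    then have "emeasure (distr M M ((+) a)) E = emeasure M ((+) (- a) ` E)"
      using E meas by (simp add: emeasure_distr haar_prob(1)[OF M])
    also have "\<dots> = emeasure M E" using E unfolding sets by (rule inv)
    finally show "emeasure (distr M M ((+) a)) E = emeasure M E" .
  qed simp
  then show ?thesis using integral_distr[OF meas f] by simp
qed

lemma dual_group_norm: "k \<in> dual_group \<Longrightarrow> cmod (k x) = 1"
  by (simp add: dual_group_def)

text \<open>Translation by \<open>a\<close> multiplies the integral by the value at \<open>a\<close> of the character \<open>cnj k \<cdot> l\<close>, which is not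
  one for a suitable \<open>a\<close> if \<open>k \<noteq> l\<close>.\<close>
lemma dual_orthogonal:
  fixes M :: "'g::topological_ab_group_add measure"
  assumes M: "normalized_haar_measure M" and k: "k \<in> dual_group" and l: "l \<in> dual_group"
  shows "integral\<^sup>L M (\<lambda>x. cnj (k x) * l x) = (if k = l then 1 else 0)"
proof (cases "k = l")
  case True
  have "cnj (k x) * k x = 1" for x using dual_group_norm[OF k] by (simp add: cnj_mult_self)
  then show ?thesis using True haar_prob[OF M] by simp
next
  case False
  have sets: "sets M = sets borel" using M by (simp add: normalized_haar_measure_def)
  have kl: "k (x + y) = k x * k y" "l (x + y) = l x * l y" for x y using k l by (auto simp: dual_group_def)
  obtain a where a: "k a \<noteq> l a" using False by auto
  let ?I = "integral\<^sup>L M (\<lambda>x. cnj (k x) * l x)"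
  have "?I = integral\<^sup>L M (\<lambda>x. cnj (k (a + x)) * l (a + x))"
    using dual_group_measurable[OF k sets] dual_group_measurable[OF l sets]
    by (intro haar_translation[OF M, symmetric]) measurable
  also have "\<dots> = integral\<^sup>L M (\<lambda>x. (cnj (k a) * l a) * (cnj (k x) * l x))"
    by (simp add: kl mult_ac)
  also have "\<dots> = (cnj (k a) * l a) * ?I" by simp
  finally have "(1 - cnj (k a) * l a) * ?I = 0" by (simp add: algebra_simps)
  moreover have "cnj (k a) * l a \<noteq> 1"
  proof
    assume "cnj (k a) * l a = 1"
    then have "k a * (cnj (k a) * l a) = k a" by simp
    moreover have "k a * cnj (k a) = 1" using dual_group_norm[OF k, of a] cnj_mult_self[of "k a"] by (simp add: mult.commute)
    ultimately have "l a = k a" by (simp flip: mult.assoc)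
    then show False using a by simp
  qed
  ultimately show ?thesis using False by simp
qed

text \<open>The squared \<open>L\<^sup>2\<close> distance from \<open>u\<close> to the partial Fourier sum \<open>P\<close> is nonnegative.\<close>
lemma haar_bessel:
  fixes M :: "'g::topological_ab_group_add measure"
  assumes M: "normalized_haar_measure M" and F: "finite F" "F \<subseteq> dual_group"
    and u: "u \<in> borel_measurable M" "\<And>x. cmod (u x) \<le> B"
  shows "(\<Sum>k\<in>F. (cmod (integral\<^sup>L M (\<lambda>x. cnj (k x) * u x)))\<^sup>2) \<le> integral\<^sup>L M (\<lambda>x. (cmod (u x))\<^sup>2)"
proof -
  interpret finite_measure M by (rule haar_prob(2)[OF M])
  have sets: "sets M = sets borel" using M by (simp add: normalized_haar_measure_def)
  have k: "k \<in> borel_measurable M" "cmod (k x) = 1" if "k \<in> F" for k x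
    using that F dual_group_measurable[OF _ sets] dual_group_norm by blast+
  have bdd: "integrable M f" if "f \<in> borel_measurable M" "\<And>x. cmod (f x) \<le> C" for f :: "'g \<Rightarrow> complex" and C
    using that by (intro integrable_const_bound[of _ C]) auto
  define c where "c k = integral\<^sup>L M (\<lambda>x. cnj (k x) * u x)" for k
  define P where "P x = (\<Sum>k\<in>F. c k * k x)" for x
  have P: "P \<in> borel_measurable M" unfolding P_def using k(1) by measurable
  have Pb: "cmod (P x) \<le> (\<Sum>k\<in>F. cmod (c k))" for x
    unfolding P_def using k(2) by (intro sum_norm_le) (simp add: norm_mult)
  have B0: "B \<ge> 0" using u(2) norm_ge_zero order_trans by blast
  have iku: "integrable M (\<lambda>x. cnj (k x) * u x)" if "k \<in> F" for k
    using k[OF that] u by (intro bdd[of _ B]) (auto simp: norm_mult)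
  have iuu: "integrable M (\<lambda>x. cnj (u x) * u x)"
    using u B0 by (intro bdd[of _ "B * B"]) (auto simp: norm_mult intro: mult_mono)
  have ikP: "integrable M (\<lambda>x. cnj (k x) * P x)" if "k \<in> F" for k
    using k[OF that] P Pb by (intro bdd[of _ "\<Sum>k\<in>F. cmod (c k)"]) (auto simp: norm_mult)
  have ikl: "integrable M (\<lambda>x. cnj (k x) * l x)" if "k \<in> F" "l \<in> F" for k l
    using k[OF that(1)] k[OF that(2)] by (intro bdd[of _ 1]) (auto simp: norm_mult)
  have kP: "integral\<^sup>L M (\<lambda>x. cnj (k x) * P x) = c k" if "k \<in> F" for k
  proof -
    have "integral\<^sup>L M (\<lambda>x. cnj (k x) * P x) = integral\<^sup>L M (\<lambda>x. \<Sum>l\<in>F. c l * (cnj (k x) * l x))"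
      by (simp add: P_def sum_distrib_left mult_ac)
    also have "\<dots> = (\<Sum>l\<in>F. c l * integral\<^sup>L M (\<lambda>x. cnj (k x) * l x))"
      using ikl that by (subst Bochner_Integration.integral_sum) auto
    also have "\<dots> = (\<Sum>l\<in>F. if l = k then c k else 0)"
    proof (rule sum.cong[OF refl])
      fix l assume "l \<in> F"
      then have "k \<in> dual_group" "l \<in> dual_group" using that F(2) by blast+
      then show "c l * integral\<^sup>L M (\<lambda>x. cnj (k x) * l x) = (if l = k then c k else 0)"
        by (simp add: dual_orthogonal[OF M])
    qed
    finally show ?thesis using that F by simp
  qed
  let ?S = "\<Sum>k\<in>F. cnj (c k) * c k"
  have PP: "integral\<^sup>L M (\<lambda>x. cnj (P x) * P x) = ?S" and iPP: "integrable M (\<lambda>x. cnj (P x) * P x)"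
    and Pu: "integral\<^sup>L M (\<lambda>x. cnj (P x) * u x) = ?S" and iPu: "integrable M (\<lambda>x. cnj (P x) * u x)"
  proof -
    have *: "cnj (P x) * v = (\<Sum>k\<in>F. cnj (c k) * (cnj (k x) * v))" for x v
      by (simp add: P_def sum_distrib_left sum_distrib_right mult_ac)
    show "integral\<^sup>L M (\<lambda>x. cnj (P x) * P x) = ?S" "integrable M (\<lambda>x. cnj (P x) * P x)"
      unfolding * using ikP kP by (auto simp: Bochner_Integration.integral_sum)
    show "integral\<^sup>L M (\<lambda>x. cnj (P x) * u x) = ?S" "integrable M (\<lambda>x. cnj (P x) * u x)"
      unfolding * using iku by (auto simp: Bochner_Integration.integral_sum c_def)
  qed
  have S: "?S = of_real (\<Sum>k\<in>F. (cmod (c k))\<^sup>2)" by (simp only: cnj_mult_self of_real_sum)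
  have uP: "integral\<^sup>L M (\<lambda>x. cnj (u x) * P x) = ?S" and iuP: "integrable M (\<lambda>x. cnj (u x) * P x)"
  proof -
    have e: "(\<lambda>x. cnj (u x) * P x) = (\<lambda>x. cnj (cnj (P x) * u x))" by (simp add: mult.commute)
    show "integrable M (\<lambda>x. cnj (u x) * P x)" unfolding e using iPu by (rule integrable_cnj)
    have "integral\<^sup>L M (\<lambda>x. cnj (u x) * P x) = cnj ?S" unfolding e integral_bounded_linear[OF bounded_linear_cnj iPu] Pu ..
    then show "integral\<^sup>L M (\<lambda>x. cnj (u x) * P x) = ?S" unfolding S by simp
  qed
  have nonneg: "0 \<le> integral\<^sup>L M (\<lambda>x. (cmod (u x - P x))\<^sup>2)" by (rule integral_nonneg_AE) simp
  have "complex_of_real (integral\<^sup>L M (\<lambda>x. (cmod (u x - P x))\<^sup>2)) = integral\<^sup>L M (\<lambda>x. cnj (u x - P x) * (u x - P x))"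
    by (simp only: cnj_mult_self integral_complex_of_real)
  also have "\<dots> = integral\<^sup>L M (\<lambda>x. cnj (u x) * u x - cnj (u x) * P x - (cnj (P x) * u x - cnj (P x) * P x))"
    by (simp add: algebra_simps)
  also have "\<dots> = integral\<^sup>L M (\<lambda>x. cnj (u x) * u x) - ?S"
    using iuu iuP iPu iPP by (simp add: uP Pu PP)
  also have "\<dots> = of_real (integral\<^sup>L M (\<lambda>x. (cmod (u x))\<^sup>2) - (\<Sum>k\<in>F. (cmod (c k))\<^sup>2))"
    unfolding S by (simp only: cnj_mult_self integral_complex_of_real of_real_diff)
  finally have "integral\<^sup>L M (\<lambda>x. (cmod (u x - P x))\<^sup>2)
      = integral\<^sup>L M (\<lambda>x. (cmod (u x))\<^sup>2) - (\<Sum>k\<in>F. (cmod (c k))\<^sup>2)"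
    by (simp only: of_real_eq_iff)
  then show ?thesis using nonneg by (simp add: c_def)
qed

section \<open>The operator-valued interpolation estimate\<close>

text \<open>The case \<open>p = 2\<close>. On the span of \<open>E\<close> the operators \<open>\<Sum> c k y D y\<close> have finitely many matrix coefficients
  \<open>\<zeta> k b b'\<close>. Bessel's inequality for \<open>e k\<close> bounds the left-hand side by their square sum, and the hypothesis on
  \<open>c\<close> applies to each matrix position \<open>(b, b')\<close> separately.\<close>
lemma hilbert_schmidt_estimate:
  fixes e f :: "'k \<Rightarrow> 'i \<Rightarrow> 'h::complex_hilbert_space" and D :: "'y \<Rightarrow> 'h \<Rightarrow> 'h"
  assumes E: "finite_ortho E" and K: "finite K" and Y: "finite Y"
    and e: "\<And>k. k \<in> K \<Longrightarrow> bessel (I k) (e k)" and f: "\<And>k. k \<in> K \<Longrightarrow> bessel (I k) (f k)"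
    and c2: "\<And>d. (\<Sum>k\<in>K. (cmod (\<Sum>y\<in>Y. c k y * d y))\<^sup>2) \<le> (\<Sum>y\<in>Y. m y * (cmod (d y))\<^sup>2)"
    and m: "\<And>y. y \<in> Y \<Longrightarrow> 0 \<le> m y"
  shows "(\<Sum>k\<in>K. \<Sum>i\<in>I k. (cmod (\<Sum>b\<in>E. cinner b (e k i) * cinner (f k i) (\<Sum>y\<in>Y. c k y *\<^sub>C D y b)))\<^sup>2)
    \<le> (\<Sum>y\<in>Y. m y * (\<Sum>b\<in>E. (norm (D y b))\<^sup>2))"
proof -
  let ?L = "\<lambda>k i. \<Sum>b\<in>E. cinner b (e k i) * cinner (f k i) (\<Sum>y\<in>Y. c k y *\<^sub>C D y b)"
  have finE: "finite E" using E by (simp add: finite_ortho_def)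
  obtain E' where E': "finite_ortho E'" "\<And>x. x \<in> (\<lambda>(y, b). D y b) ` (Y \<times> E) \<Longrightarrow> proj E' x = x"
    using ortho_containing[of "(\<lambda>(y, b). D y b) ` (Y \<times> E)"] finE Y by blast
  have D: "D y b = (\<Sum>b'\<in>E'. cinner b' (D y b) *\<^sub>C b')" if "y \<in> Y" "b \<in> E" for y b
    using E'(2)[of "D y b"] that by (force simp: proj_def)
  define \<zeta> where "\<zeta> k b b' = (\<Sum>y\<in>Y. c k y * cinner b' (D y b))" for k b b'
  have "(\<Sum>i\<in>I k. (cmod (?L k i))\<^sup>2)
      \<le> (\<Sum>b'\<in>E'. \<Sum>b\<in>E. (cmod (\<zeta> k b b'))\<^sup>2)" if k: "k \<in> K" for k
  proof -
    let ?\<eta> = "\<lambda>b'. \<Sum>b\<in>E. cnj (\<zeta> k b b') *\<^sub>C b"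
    have z: "(\<Sum>y\<in>Y. c k y *\<^sub>C D y b) = (\<Sum>b'\<in>E'. \<zeta> k b b' *\<^sub>C b')" if b: "b \<in> E" for b
    proof -
      have "(\<Sum>y\<in>Y. c k y *\<^sub>C D y b) = (\<Sum>y\<in>Y. \<Sum>b'\<in>E'. (c k y * cinner b' (D y b)) *\<^sub>C b')"
      proof (intro sum.cong refl)
        fix y assume "y \<in> Y"
        show "c k y *\<^sub>C D y b = (\<Sum>b'\<in>E'. (c k y * cinner b' (D y b)) *\<^sub>C b')"
          by (subst D[OF \<open>y \<in> Y\<close> b]) (simp add: clinear_scaleC_sum scaleC_scaleC)
      qed
      also have "\<dots> = (\<Sum>b'\<in>E'. \<Sum>y\<in>Y. (c k y * cinner b' (D y b)) *\<^sub>C b')" by (rule sum.swap)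
      also have "\<dots> = (\<Sum>b'\<in>E'. \<zeta> k b b' *\<^sub>C b')"
      proof (intro sum.cong refl)
        fix b' :: 'h
        have "(\<Sum>i\<in>J. g i *\<^sub>C b') = (\<Sum>i\<in>J. g i) *\<^sub>C b'" for g :: "'y \<Rightarrow> complex" and J
          by (induction J rule: infinite_finite_induct) (auto simp: scaleC_add_left)
        then show "(\<Sum>y\<in>Y. (c k y * cinner b' (D y b)) *\<^sub>C b') = \<zeta> k b b' *\<^sub>C b'" by (simp add: \<zeta>_def)
      qed
      finally show ?thesis .
    qed
    have "(cmod (?L k i))\<^sup>2
        \<le> (\<Sum>b'\<in>E'. (cmod (cinner (e k i) (?\<eta> b')))\<^sup>2)" if i: "i \<in> I k" for i
    proof -
      have "?L k i
          = (\<Sum>b\<in>E. \<Sum>b'\<in>E'. cinner b (e k i) * (\<zeta> k b b' * cinner (f k i) b'))"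
        by (intro sum.cong refl) (simp add: z cinner.sum_right cinner_scaleC_right sum_distrib_left)
      also have "\<dots> = (\<Sum>b'\<in>E'. cinner (?\<eta> b') (e k i) * cinner (f k i) b')"
        by (subst sum.swap) (simp add: cinner.sum_left cinner_scaleC_left sum_distrib_left sum_distrib_right mult_ac)
      also have "\<dots> = cinner (f k i) (\<Sum>b'\<in>E'. cinner (?\<eta> b') (e k i) *\<^sub>C b')"
        by (simp add: cinner.sum_right cinner_scaleC_right)
      finally have "cmod (?L k i)
          \<le> norm (f k i) * norm (\<Sum>b'\<in>E'. cinner (?\<eta> b') (e k i) *\<^sub>C b')"
        by (simp add: norm_cinner_le)
      also have "\<dots> \<le> 1 * norm (\<Sum>b'\<in>E'. cinner (?\<eta> b') (e k i) *\<^sub>C b')"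
        by (intro mult_right_mono bessel_norm[OF f[OF k] i]) auto
      finally have "(cmod (?L k i))\<^sup>2
          \<le> (norm (\<Sum>b'\<in>E'. cinner (?\<eta> b') (e k i) *\<^sub>C b'))\<^sup>2"
        by (intro power_mono) auto
      also have "\<dots> = (\<Sum>b'\<in>E'. (cmod (cinner (e k i) (?\<eta> b')))\<^sup>2)"
        unfolding norm_ortho_sum[OF E'(1)]
        by (intro sum.cong refl arg_cong[of _ _ "\<lambda>t. t\<^sup>2"] cmod_cinner_commute)
      finally show ?thesis .
    qed
    then have "(\<Sum>i\<in>I k. (cmod (?L k i))\<^sup>2)
        \<le> (\<Sum>i\<in>I k. \<Sum>b'\<in>E'. (cmod (cinner (e k i) (?\<eta> b')))\<^sup>2)" by (rule sum_mono)
    also have "\<dots> = (\<Sum>b'\<in>E'. \<Sum>i\<in>I k. (cmod (cinner (e k i) (?\<eta> b')))\<^sup>2)" by (rule sum.swap)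
    also have "\<dots> \<le> (\<Sum>b'\<in>E'. (norm (?\<eta> b'))\<^sup>2)" by (intro sum_mono besselD[OF e[OF k]])
    also have "\<dots> = (\<Sum>b'\<in>E'. \<Sum>b\<in>E. (cmod (\<zeta> k b b'))\<^sup>2)" by (simp add: norm_ortho_sum[OF E])
    finally show ?thesis .
  qed
  then have "(\<Sum>k\<in>K. \<Sum>i\<in>I k. (cmod (?L k i))\<^sup>2)
      \<le> (\<Sum>k\<in>K. \<Sum>b'\<in>E'. \<Sum>b\<in>E. (cmod (\<zeta> k b b'))\<^sup>2)" by (rule sum_mono)
  also have "\<dots> = (\<Sum>b'\<in>E'. \<Sum>b\<in>E. \<Sum>k\<in>K. (cmod (\<zeta> k b b'))\<^sup>2)"
    by (subst sum.swap, rule sum.cong[OF refl], rule sum.swap)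
  also have "\<dots> \<le> (\<Sum>b'\<in>E'. \<Sum>b\<in>E. \<Sum>y\<in>Y. m y * (cmod (cinner b' (D y b)))\<^sup>2)"
    unfolding \<zeta>_def by (intro sum_mono c2)
  also have "\<dots> = (\<Sum>b\<in>E. \<Sum>y\<in>Y. \<Sum>b'\<in>E'. m y * (cmod (cinner b' (D y b)))\<^sup>2)"
    by (subst sum.swap, rule sum.cong[OF refl], rule sum.swap)
  also have "\<dots> = (\<Sum>y\<in>Y. \<Sum>b\<in>E. m y * (\<Sum>b'\<in>E'. (cmod (cinner b' (D y b)))\<^sup>2))"
    by (subst sum.swap) (simp add: sum_distrib_left)
  also have "\<dots> \<le> (\<Sum>y\<in>Y. \<Sum>b\<in>E. m y * (norm (D y b))\<^sup>2)"
    by (intro sum_mono mult_left_mono bessel_ineq E' m)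
  finally show ?thesis by (simp add: sum_distrib_left)
qed

text \<open>Here \<open>c k y\<close> stands for the Fourier coefficient at \<open>k\<close> of the indicator function of the set where a step
  function has the value \<open>y\<close>, and \<open>m y\<close> for the measure of this set. All \<open>e k i\<close> lie in the span of a finite
  orthonormal set \<open>E\<close>, where \<open>y\<close> has singular vectors \<open>v\<close> and \<open>u y v\<close>. The pairs \<open>(y, v)\<close> are the columns of the
  matrix to which \<open>mixed_norm_interpolation\<close> is applied, and the input vector \<open>a\<close> consists of the singular
  values. The sum of their \<open>p\<close>-th powers is at most the \<open>p\<close>-th power of the Schatten norm of \<open>y\<close>.\<close>
lemma operator_interpolation:
  fixes e f :: "'k \<Rightarrow> 'i \<Rightarrow> 'h::complex_hilbert_space" and Y :: "('h \<Rightarrow>\<^sub>L 'h) set"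
  assumes p: "1 < p" "p \<le> 2" and q: "q = p / (p - 1)" and K: "finite K" and Y: "finite Y" "Y \<subseteq> schatten_class p"
    and e: "\<And>k. k \<in> K \<Longrightarrow> bessel (I k) (e k)" and f: "\<And>k. k \<in> K \<Longrightarrow> bessel (I k) (f k)"
    and c1: "\<And>k y. k \<in> K \<Longrightarrow> y \<in> Y \<Longrightarrow> cmod (c k y) \<le> m y"
    and c2: "\<And>d. (\<Sum>k\<in>K. (cmod (\<Sum>y\<in>Y. c k y * d y))\<^sup>2) \<le> (\<Sum>y\<in>Y. m y * (cmod (d y))\<^sup>2)"
    and m: "\<And>y. y \<in> Y \<Longrightarrow> 0 \<le> m y"
  shows "(\<Sum>k\<in>K. (\<Sum>i\<in>I k. cmod (\<Sum>y\<in>Y. c k y * cinner (f k i) (y (e k i))) powr p) powr (q / p))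
    \<le> (\<Sum>y\<in>Y. m y * schatten_norm p y powr p) powr (q / p)"
proof -
  have lin: "clinear_op y" if "y \<in> Y" for y using that Y schatten_class_clinear by blast
  have finI: "finite (I k)" if "k \<in> K" for k using bessel_finite[OF e[OF that]] .
  have "finite ((\<lambda>(k, i). e k i) ` Sigma K I)" using K finI by blast
  from ortho_containing[OF this] obtain E where E: "finite_ortho E"
    and "\<forall>x\<in>(\<lambda>(k, i). e k i) ` Sigma K I. proj E x = x" by blast
  then have eE: "proj E (e k i) = e k i" if "k \<in> K" "i \<in> I k" for k i using that by blast
  define Q where "Q y V u \<longleftrightarrow> finite_ortho V \<and> (\<forall>x. proj V x = proj E x) \<and> bessel V u \<and>
    (\<forall>v\<in>V. y v = of_real (norm (y v)) *\<^sub>C u v) \<and> (\<forall>v\<in>V. cinner (u v) (y v) = of_real (norm (y v)))"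
    for y :: "'h \<Rightarrow>\<^sub>L 'h" and V u
  have "\<exists>V u. Q y V u" if "y \<in> Y" for y
    unfolding Q_def by (rule singular_decomposition[OF lin[OF that] E]) blast
  then obtain V u where Q: "\<And>y. y \<in> Y \<Longrightarrow> Q y (V y) (u y)" by metis
  have V: "finite_ortho (V y)" "\<And>x. proj (V y) x = proj E x" "bessel (V y) (u y)"
    and yv: "\<And>v. v \<in> V y \<Longrightarrow> y v = of_real (norm (y v)) *\<^sub>C u y v"
    and uy: "\<And>v. v \<in> V y \<Longrightarrow> cinner (u y v) (y v) = of_real (norm (y v))" if "y \<in> Y" for y
    using Q[OF that] unfolding Q_def by blast+
  have finV: "finite (V y)" if "y \<in> Y" for y using V(1)[OF that] by (simp add: finite_ortho_def)
  let ?X = "Sigma Y V"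
  define M where "M k i = (\<lambda>(y, v). c k y * (cinner (f k i) (u y v) * cinner v (e k i)))" for k i
  define w :: "('h \<Rightarrow>\<^sub>L 'h) \<times> 'h \<Rightarrow> real" where "w = (\<lambda>(y, v). m y)"
  define a :: "('h \<Rightarrow>\<^sub>L 'h) \<times> 'h \<Rightarrow> complex" where "a = (\<lambda>(y, v). of_real (norm (y v)))"
  have finX: "finite ?X" using Y(1) finV by blast
  have sumX: "(\<Sum>x\<in>?X. g x) = (\<Sum>y\<in>Y. \<Sum>v\<in>V y. g (y, v))" for g :: "_ \<Rightarrow> 'z::comm_monoid_add"
    using sum.Sigma[of Y V "\<lambda>y v. g (y, v)"] Y(1) finV by (simp add: case_prod_unfold)
  have Ma: "(\<Sum>x\<in>?X. M k i x * a x) = (\<Sum>y\<in>Y. c k y * cinner (f k i) (y (e k i)))" if "k \<in> K" "i \<in> I k" for k i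
    unfolding sumX
  proof (rule sum.cong[OF refl])
    fix y assume y: "y \<in> Y"
    have "e k i = (\<Sum>v\<in>V y. cinner v (e k i) *\<^sub>C v)" using eE[OF that] V(2)[OF y, of "e k i"] by (simp add: proj_def)
    from arg_cong[OF this, of "blinfun_apply y"]
    have "y (e k i) = (\<Sum>v\<in>V y. cinner v (e k i) *\<^sub>C y v)" by (simp only: clinear_op_sum[OF lin[OF y]])
    also have "\<dots> = (\<Sum>v\<in>V y. (cinner v (e k i) * of_real (norm (y v))) *\<^sub>C u y v)"
    proof (rule sum.cong[OF refl])
      fix v assume "v \<in> V y"
      from arg_cong[OF yv[OF y this], of "\<lambda>z. cinner v (e k i) *\<^sub>C z"]
      show "cinner v (e k i) *\<^sub>C y v = (cinner v (e k i) * of_real (norm (y v))) *\<^sub>C u y v"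
        by (simp only: scaleC_scaleC)
    qed
    finally have "cinner (f k i) (y (e k i)) = (\<Sum>v\<in>V y. (cinner v (e k i) * of_real (norm (y v))) * cinner (f k i) (u y v))"
      by (simp add: cinner.sum_right cinner_scaleC_right)
    then show "(\<Sum>v\<in>V y. M k i (y, v) * a (y, v)) = c k y * cinner (f k i) (y (e k i))"
      by (simp add: M_def a_def sum_distrib_left mult_ac)
  qed
  have E1: "(\<Sum>i\<in>I k. cmod (M k i x)) \<le> w x" if "k \<in> K" "x \<in> ?X" for k x
  proof -
    from that(2) obtain y v where x: "x = (y, v)" "y \<in> Y" "v \<in> V y" by blast
    have "(\<Sum>i\<in>I k. cmod (cinner (f k i) (u y v)) * cmod (cinner v (e k i)))
        \<le> L2_set (\<lambda>i. cmod (cinner (f k i) (u y v))) (I k) * L2_set (\<lambda>i. cmod (cinner v (e k i))) (I k)"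
      using L2_set_mult_ineq[of "\<lambda>i. cmod (cinner (f k i) (u y v))" "\<lambda>i. cmod (cinner v (e k i))" "I k"] by simp
    also have "\<dots> \<le> 1 * 1"
    proof (intro mult_mono)
      have "(\<Sum>i\<in>I k. (cmod (cinner (f k i) (u y v)))\<^sup>2) \<le> (norm (u y v))\<^sup>2" by (rule besselD[OF f[OF that(1)]])
      also have "\<dots> \<le> 1" using bessel_norm[OF V(3)[OF x(2)] x(3)] by (simp add: power_le_one)
      finally show "L2_set (\<lambda>i. cmod (cinner (f k i) (u y v))) (I k) \<le> 1" by (simp add: L2_set_def)
      have "(\<Sum>i\<in>I k. (cmod (cinner v (e k i)))\<^sup>2) \<le> (norm v)\<^sup>2"
        using besselD[OF e[OF that(1)], of v] by (simp add: cmod_cinner_commute[of v])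
      also have "\<dots> = 1" using norm_ortho[OF V(1)[OF x(2)] x(3)] by simp
      finally show "L2_set (\<lambda>i. cmod (cinner v (e k i))) (I k) \<le> 1" by (simp add: L2_set_def)
    qed (auto simp: L2_set_nonneg)
    finally have "cmod (c k y) * (\<Sum>i\<in>I k. cmod (cinner (f k i) (u y v)) * cmod (cinner v (e k i))) \<le> m y * 1"
      using c1[OF that(1) x(2)] m[OF x(2)] by (intro mult_mono) (auto intro: sum_nonneg)
    then show ?thesis by (simp add: M_def w_def x(1) norm_mult sum_distrib_left)
  qed
  have E2: "(\<Sum>k\<in>K. \<Sum>i\<in>I k. (cmod (\<Sum>x\<in>?X. M k i x * \<alpha> x))\<^sup>2) \<le> (\<Sum>x\<in>?X. w x * (cmod (\<alpha> x))\<^sup>2)" for \<alpha>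
  proof -
    define D where "D y b = (\<Sum>v\<in>V y. (\<alpha> (y, v) * cinner v b) *\<^sub>C u y v)" for y b
    have "(\<Sum>x\<in>?X. M k i x * \<alpha> x) = (\<Sum>b\<in>E. cinner b (e k i) * cinner (f k i) (\<Sum>y\<in>Y. c k y *\<^sub>C D y b))"
      if "k \<in> K" "i \<in> I k" for k i
    proof -
      have ve: "cinner v (e k i) = (\<Sum>b\<in>E. cinner b (e k i) * cinner v b)" for v
      proof -
        have "cinner v (e k i) = cinner v (\<Sum>b\<in>E. cinner b (e k i) *\<^sub>C b)"
          using eE[OF that] by (simp add: proj_def)
        then show ?thesis by (simp add: cinner.sum_right cinner_scaleC_right)
      qed
      have "(\<Sum>x\<in>?X. M k i x * \<alpha> x) = (\<Sum>y\<in>Y. \<Sum>v\<in>V y. \<Sum>b\<in>E. cinner b (e k i) * (c k y * (\<alpha> (y, v) * cinner v b * cinner (f k i) (u y v))))"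
        unfolding sumX M_def prod.case
        by (intro sum.cong refl, subst ve) (simp add: sum_distrib_left sum_distrib_right mult_ac)
      also have "\<dots> = (\<Sum>y\<in>Y. \<Sum>b\<in>E. \<Sum>v\<in>V y. cinner b (e k i) * (c k y * (\<alpha> (y, v) * cinner v b * cinner (f k i) (u y v))))"
        by (rule sum.cong[OF refl], rule sum.swap)
      also have "\<dots> = (\<Sum>b\<in>E. \<Sum>y\<in>Y. \<Sum>v\<in>V y. cinner b (e k i) * (c k y * (\<alpha> (y, v) * cinner v b * cinner (f k i) (u y v))))"
        by (rule sum.swap)
      also have "\<dots> = (\<Sum>b\<in>E. cinner b (e k i) * cinner (f k i) (\<Sum>y\<in>Y. c k y *\<^sub>C D y b))"
        by (simp add: D_def cinner.sum_right cinner_scaleC_right sum_distrib_left)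
      finally show ?thesis .
    qed
    then have "(\<Sum>k\<in>K. \<Sum>i\<in>I k. (cmod (\<Sum>x\<in>?X. M k i x * \<alpha> x))\<^sup>2)
        = (\<Sum>k\<in>K. \<Sum>i\<in>I k. (cmod (\<Sum>b\<in>E. cinner b (e k i) * cinner (f k i) (\<Sum>y\<in>Y. c k y *\<^sub>C D y b)))\<^sup>2)"
      by (intro sum.cong refl) simp
    also have "\<dots> \<le> (\<Sum>y\<in>Y. m y * (\<Sum>b\<in>E. (norm (D y b))\<^sup>2))"
      by (rule hilbert_schmidt_estimate[OF E K Y(1) e f c2 m])
    also have "\<dots> \<le> (\<Sum>y\<in>Y. m y * (\<Sum>v\<in>V y. (cmod (\<alpha> (y, v)))\<^sup>2))"
    proof (intro sum_mono mult_left_mono m)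
      fix y assume y: "y \<in> Y"
      have "(\<Sum>b\<in>E. (norm (D y b))\<^sup>2) \<le> (\<Sum>b\<in>E. \<Sum>v\<in>V y. (cmod (\<alpha> (y, v)))\<^sup>2 * (cmod (cinner b v))\<^sup>2)"
      proof (rule sum_mono)
        fix b
        have "(norm (D y b))\<^sup>2 \<le> (\<Sum>v\<in>V y. (cmod (\<alpha> (y, v) * cinner v b))\<^sup>2)"
          unfolding D_def by (rule bessel_synthesis[OF V(3)[OF y]])
        also have "\<dots> = (\<Sum>v\<in>V y. (cmod (\<alpha> (y, v)))\<^sup>2 * (cmod (cinner b v))\<^sup>2)"
          by (intro sum.cong refl) (simp add: norm_mult power_mult_distrib cmod_cinner_commute[of b])
        finally show "(norm (D y b))\<^sup>2 \<le> (\<Sum>v\<in>V y. (cmod (\<alpha> (y, v)))\<^sup>2 * (cmod (cinner b v))\<^sup>2)" .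
      qed
      also have "\<dots> = (\<Sum>v\<in>V y. (cmod (\<alpha> (y, v)))\<^sup>2 * (\<Sum>b\<in>E. (cmod (cinner b v))\<^sup>2))"
        by (subst sum.swap) (simp add: sum_distrib_left)
      also have "\<dots> \<le> (\<Sum>v\<in>V y. (cmod (\<alpha> (y, v)))\<^sup>2 * 1)"
      proof (intro sum_mono mult_left_mono)
        fix v assume "v \<in> V y"
        then show "(\<Sum>b\<in>E. (cmod (cinner b v))\<^sup>2) \<le> 1"
          using bessel_ineq[OF E, of v] norm_ortho[OF V(1)[OF y], of v] by simp
      qed simp
      finally show "(\<Sum>b\<in>E. (norm (D y b))\<^sup>2) \<le> (\<Sum>v\<in>V y. (cmod (\<alpha> (y, v)))\<^sup>2)" by simp
    qed
    also have "\<dots> = (\<Sum>x\<in>?X. w x * (cmod (\<alpha> x))\<^sup>2)" by (simp add: sumX w_def sum_distrib_left)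
    finally show ?thesis .
  qed
  have w0: "0 \<le> w x" if "x \<in> ?X" for x using that m by (auto simp: w_def)
  have "(\<Sum>k\<in>K. (\<Sum>i\<in>I k. cmod (\<Sum>x\<in>?X. M k i x * a x) powr p) powr (q / p))
      \<le> (\<Sum>x\<in>?X. w x * cmod (a x) powr p) powr (q / p)"
  proof (cases "p = 2")
    case True
    have nn: "0 \<le> (\<Sum>x\<in>?X. w x * (cmod (a x))\<^sup>2)" using w0 by (intro sum_nonneg) auto
    have sq: "r powr 2 = r\<^sup>2" if "r \<ge> 0" for r :: real using that by (simp add: powr_numeral)
    show ?thesis using E2[of a] nn True q by (simp add: sq sum_nonneg)
  next
    case False
    then show ?thesis
      using p by (intro mixed_norm_interpolation q K finI finX w0 E1 E2) auto
  qed
  also have "(\<Sum>x\<in>?X. w x * cmod (a x) powr p) \<le> (\<Sum>y\<in>Y. m y * schatten_norm p y powr p)"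
  proof -
    have "(\<Sum>x\<in>?X. w x * cmod (a x) powr p) = (\<Sum>y\<in>Y. m y * (\<Sum>v\<in>V y. norm (y v) powr p))"
      by (simp add: sumX w_def a_def sum_distrib_left)
    also have "\<dots> \<le> (\<Sum>y\<in>Y. m y * schatten_norm p y powr p)"
    proof (intro sum_mono mult_left_mono m)
      fix y assume y: "y \<in> Y"
      have "(\<Sum>v\<in>V y. norm (y v) powr p) = (\<Sum>v\<in>V y. cmod (cinner (u y v) (y v)) powr p)"
        using uy[OF y] by (intro sum.cong refl) simp
      also have "\<dots> \<le> schatten_norm p y powr p"
        using p y Y by (intro bessel_sum_le_schatten_norm bessel_finite_ortho V) auto
      finally show "(\<Sum>v\<in>V y. norm (y v) powr p) \<le> schatten_norm p y powr p" .
    qed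
    finally show ?thesis .
  qed
  then have "(\<Sum>x\<in>?X. w x * cmod (a x) powr p) powr (q / p) \<le> (\<Sum>y\<in>Y. m y * schatten_norm p y powr p) powr (q / p)"
    using p w0 unfolding q by (intro powr_mono2 sum_nonneg) auto
  finally show ?thesis by (simp add: Ma cong: sum.cong)
qed

section \<open>The Hausdorff-Young inequality\<close>

lemma bochner_subspace_schatten:
  assumes M: "normalized_haar_measure M" and p: "1 \<le> p"
  shows "bochner_subspace (schatten_class p :: ('h::complex_hilbert_space \<Rightarrow>\<^sub>L 'h) set) (schatten_norm p) M"
proof -
  interpret finite_measure M by (rule haar_prob(2)[OF M])
  show ?thesis
  proof
    show "(0 :: 'h \<Rightarrow>\<^sub>L 'h) \<in> schatten_class p" by (rule schatten_zero(1)[OF p])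
    fix x y :: "'h \<Rightarrow>\<^sub>L 'h" and r :: real
    assume x: "x \<in> schatten_class p"
    show "r *\<^sub>R x \<in> schatten_class p" "schatten_norm p (r *\<^sub>R x) = \<bar>r\<bar> * schatten_norm p x"
      unfolding scaleR_scaleC_op using schatten_scaleC[OF p x] by simp_all
    show "x = 0" if "schatten_norm p x = 0" using norm_le_schatten_norm[OF p x] that by simp
    assume y: "y \<in> schatten_class p"
    show "x + y \<in> schatten_class p" "schatten_norm p (x + y) \<le> schatten_norm p x + schatten_norm p y"
      by (rule schatten_add[OF p x y])+
  next
    fix T :: "nat \<Rightarrow> 'h \<Rightarrow>\<^sub>L 'h"
    assume "\<And>n. T n \<in> schatten_class p"
      and "\<And>e. e > 0 \<Longrightarrow> \<exists>K. \<forall>m\<ge>K. \<forall>n\<ge>K. schatten_norm p (T m - T n) < e"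
    then show "\<exists>L\<in>schatten_class p. (\<lambda>n. schatten_norm p (T n - L)) \<longlonglongrightarrow> 0"
      by (rule schatten_complete[OF p])
  qed (rule schatten_norm_nonneg)
qed

text \<open>Multiply simple approximations of the two factors.\<close>
lemma strongly_measurable_scaleC:
  fixes A :: "'g \<Rightarrow> ('h::complex_hilbert_space \<Rightarrow>\<^sub>L 'h)"
  assumes p: "1 \<le> p" and A: "strongly_measurable_in M (schatten_class p) (schatten_norm p) A"
    and k: "k \<in> borel_measurable M"
  shows "strongly_measurable_in M (schatten_class p) (schatten_norm p) (\<lambda>x. scaleC_op (k x) (A x))"
proof -
  let ?V = "schatten_class p :: ('h \<Rightarrow>\<^sub>L 'h) set" and ?N = "schatten_norm p :: ('h \<Rightarrow>\<^sub>L 'h) \<Rightarrow> real"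
  obtain s where s: "\<And>i. simple_function M (s i)" "\<And>i. s i \<in> space M \<rightarrow> ?V"
    and lim: "AE x in M. (\<lambda>i. ?N (A x - s i x)) \<longlonglongrightarrow> 0" and AV: "A \<in> space M \<rightarrow> ?V"
    using A unfolding strongly_measurable_in_def by auto
  obtain t where t: "\<And>i. simple_function M (t i)" "\<And>x. x \<in> space M \<Longrightarrow> (\<lambda>i. t i x) \<longlonglongrightarrow> k x"
    using borel_measurable_implies_sequence_metric[OF k, of 0] by blast
  have diff: "S - T \<in> ?V" if "S \<in> ?V" "T \<in> ?V" for S T
  proof -
    have "S - T = S + scaleC_op (- 1) T"
      by (rule blinfun_eqI) (simp add: blinfun.diff_left blinfun.add_left scaleC_minus_left)
    then show ?thesis using schatten_add(1)[OF p] schatten_scaleC(1)[OF p] that by metis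
  qed
  show ?thesis
    unfolding strongly_measurable_in_def
  proof (intro conjI exI[of _ "\<lambda>i x. scaleC_op (t i x) (s i x)"] allI)
    show "(\<lambda>x. scaleC_op (k x) (A x)) \<in> space M \<rightarrow> ?V" using AV schatten_scaleC(1)[OF p] by blast
    show "simple_function M (\<lambda>x. scaleC_op (t i x) (s i x))" for i by (rule simple_function_compose2[OF t(1) s(1)])
    show "(\<lambda>x. scaleC_op (t i x) (s i x)) \<in> space M \<rightarrow> ?V" for i using s(2) schatten_scaleC(1)[OF p] by blast
    show "AE x in M. (\<lambda>i. ?N (scaleC_op (k x) (A x) - scaleC_op (t i x) (s i x))) \<longlonglongrightarrow> 0"
      using lim AE_space
    proof eventually_elim
      case (elim x)
      have Ax: "A x \<in> ?V" and sx: "s i x \<in> ?V" for i using elim(2) AV s(2) by blast+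
      have bound: "?N (scaleC_op (k x) (A x) - scaleC_op (t i x) (s i x))
          \<le> cmod (t i x) * ?N (A x - s i x) + cmod (k x - t i x) * ?N (A x)" for i
      proof -
        have "scaleC_op (k x) (A x) - scaleC_op (t i x) (s i x)
            = scaleC_op (t i x) (A x - s i x) + scaleC_op (k x - t i x) (A x)"
          by (rule blinfun_eqI) (simp add: blinfun.diff_left blinfun.add_left scaleC_diff_left
              scaleC_diff_right)
        then show ?thesis
          using schatten_add(2)[OF p schatten_scaleC(1)[OF p diff[OF Ax sx]] schatten_scaleC(1)[OF p Ax], of "t i x" i "k x - t i x"]
          by (simp add: schatten_scaleC(2)[OF p Ax] schatten_scaleC(2)[OF p diff[OF Ax sx]])
      qed
      have "(\<lambda>i. cmod (t i x) * ?N (A x - s i x) + cmod (k x - t i x) * ?N (A x)) \<longlonglongrightarrow> cmod (k x) * 0 + cmod (k x - k x) * ?N (A x)"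
        by (intro tendsto_intros t(2) elim)
      then have lim0: "(\<lambda>i. cmod (t i x) * ?N (A x - s i x) + cmod (k x - t i x) * ?N (A x)) \<longlonglongrightarrow> 0" by simp
      show ?case
        by (rule tendsto_sandwich[OF _ _ tendsto_const lim0]) (use bound in \<open>auto intro!: always_eventually\<close>)
    qed
  qed
qed

context
  fixes M :: "'g::topological_ab_group_add measure" and p :: real
    and A :: "'g \<Rightarrow> ('h::complex_hilbert_space \<Rightarrow>\<^sub>L 'h)"
  assumes M: "normalized_haar_measure M" and p: "1 \<le> p" and A: "A \<in> Lp_schatten M p"
begin

interpretation B: bochner_subspace "schatten_class p :: ('h \<Rightarrow>\<^sub>L 'h) set" "schatten_norm p" M
  by (rule bochner_subspace_schatten[OF M p])

abbreviation A_hat where "A_hat \<equiv> schatten_fourier M p A"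

abbreviation A_moment where "A_moment \<equiv> \<integral>\<^sup>+x. ennreal (schatten_norm p (A x) powr p) \<partial>M"

abbreviation level where "level s y \<equiv> measure M {x. s x = y}"

abbreviation step_moment where "step_moment s \<equiv> \<Sum>y\<in>range s. level s y * schatten_norm p y powr p"

lemma sets_haar: "sets M = sets borel"
  using M by (simp add: normalized_haar_measure_def)

lemma Lp_schattenD:
  "strongly_measurable_in M (schatten_class p) (schatten_norm p) A"
  "A_moment < \<infinity>"
  using A by (auto simp: Lp_schatten_def)

lemma schatten_fourier_integral:
  assumes k: "k \<in> dual_group"
  shows "has_bochner_integral_in M (schatten_class p) (schatten_norm p) (\<lambda>x. scaleC_op (cnj (k x)) (A x)) (A_hat k)"
  unfolding schatten_fourier_def
proof (rule B.has_bochner_integral_in_integral)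
  have "(\<lambda>x. cnj (k x)) \<in> borel_measurable M" using dual_group_measurable[OF k sets_haar] by measurable
  then show "strongly_measurable_in M (schatten_class p) (schatten_norm p) (\<lambda>x. scaleC_op (cnj (k x)) (A x))"
    by (rule strongly_measurable_scaleC[OF p Lp_schattenD(1)])
  have "A x \<in> schatten_class p" if "x \<in> space M" for x
    using Lp_schattenD(1) that by (auto simp: strongly_measurable_in_def)
  then have "(\<integral>\<^sup>+x. ennreal (schatten_norm p (scaleC_op (cnj (k x)) (A x))) \<partial>M) = (\<integral>\<^sup>+x. ennreal (schatten_norm p (A x)) \<partial>M)"
    by (intro nn_integral_cong) (simp add: schatten_scaleC(2)[OF p] dual_group_norm[OF k])
  also have "\<dots> < \<infinity>" by (rule B.nn_integral_N_finite[OF Lp_schattenD(1) p Lp_schattenD(2)])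
  finally show "(\<integral>\<^sup>+x. ennreal (schatten_norm p (scaleC_op (cnj (k x)) (A x))) \<partial>M) < \<infinity>" .
qed

text \<open>The Fourier coefficient at \<open>k\<close> of the indicator function of the set where the step function \<open>s\<close> has the
  value \<open>y\<close>.\<close>
definition simple_coeff :: "('g \<Rightarrow> 'v) \<Rightarrow> ('g \<Rightarrow> complex) \<Rightarrow> 'v \<Rightarrow> complex" where
  "simple_coeff s k y = integral\<^sup>L M (\<lambda>x. cnj (k x) * indicator {x. s x = y} x)"

text \<open>For an operator-valued step function \<open>s\<close> this is the matrix coefficient of its Fourier coefficient at \<open>k\<close>.\<close>
abbreviation step_pairing where
  "step_pairing s k e f \<equiv> \<Sum>y\<in>range s. simple_coeff s k y * cinner f (blinfun_apply y e)"

lemma space_haar: "space M = UNIV" by (rule haar_prob(1)[OF M])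

lemma simple_range: "simple_function M s \<Longrightarrow> finite (range s)"
  by (simp add: simple_function_def space_haar)

lemma simple_level: "simple_function M s \<Longrightarrow> {x. s x = y} \<in> sets M"
  using simple_functionD(2)[of M s "{y}"] by (simp add: space_haar vimage_def)

lemma integral_simple_function:
  fixes g :: "'v \<Rightarrow> 'b::{banach, second_countable_topology}"
  assumes s: "simple_function M s"
  shows "integral\<^sup>L M (\<lambda>x. g (s x)) = (\<Sum>y\<in>range s. level s y *\<^sub>R g y)"
proof -
  have sb: "Bochner_Integration.simple_bochner_integrable M (\<lambda>x. g (s x))"
    using B.emeasure_finite simple_function_compose1[OF s]
    by (intro Bochner_Integration.simple_bochner_integrable.intros) auto
  have "integral\<^sup>L M (\<lambda>x. g (s x)) = Bochner_Integration.simple_bochner_integral M (\<lambda>x. g (s x))"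
    by (rule simple_bochner_integrable_eq_integral[OF sb, symmetric])
  also have "\<dots> = (\<Sum>y\<in>s ` space M. measure M {x \<in> space M. s x = y} *\<^sub>R g y)"
    by (rule Bochner_Integration.simple_bochner_integral_partition[OF sb s]) auto
  finally show ?thesis by (simp add: space_haar)
qed

lemma simple_coeff_le:
  assumes k: "k \<in> dual_group" and s: "simple_function M s"
  shows "cmod (simple_coeff s k y) \<le> level s y"
proof -
  have "cmod (simple_coeff s k y) \<le> integral\<^sup>L M (\<lambda>x. cmod (cnj (k x) * indicator {x. s x = y} x))"
    unfolding simple_coeff_def by (rule integral_norm_bound)
  also have "\<dots> = integral\<^sup>L M (\<lambda>x. indicator {x. s x = y} x)"
    by (intro Bochner_Integration.integral_cong refl) (simp add: norm_mult dual_group_norm[OF k] indicator_def)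
  also have "\<dots> = level s y" using simple_level[OF s] by (simp add: space_haar)
  finally show ?thesis .
qed

lemma simple_coeff_integrable:
  assumes k: "k \<in> dual_group" and s: "simple_function M s"
  shows "integrable M (\<lambda>x. cnj (k x) * g (s x))"
proof (rule B.integrable_const_bound)
  have "g y = 0 \<or> True" for y by simp
  have "finite ((\<lambda>y. cmod (g y)) ` range s)" using simple_range[OF s] by simp
  then have "cmod (g (s x)) \<le> Max ((\<lambda>y. cmod (g y)) ` range s)" for x by (intro Max_ge) auto
  then show "AE x in M. cmod (cnj (k x) * g (s x)) \<le> Max ((\<lambda>y. cmod (g y)) ` range s)"
    by (simp add: norm_mult dual_group_norm[OF k])
  have "(\<lambda>x. g (s x)) \<in> borel_measurable M"
    by (rule borel_measurable_simple_function[OF simple_function_compose1[OF s]])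
  then show "(\<lambda>x. cnj (k x) * g (s x)) \<in> borel_measurable M"
    using dual_group_measurable[OF k sets_haar] by measurable
qed

lemma integral_simple_coeff:
  assumes k: "k \<in> dual_group" and s: "simple_function M s"
  shows "integral\<^sup>L M (\<lambda>x. cnj (k x) * g (s x)) = (\<Sum>y\<in>range s. simple_coeff s k y * g y)"
proof -
  have int: "integrable M (\<lambda>x. cnj (k x) * indicator {x. s x = y} x)" for y
    using simple_coeff_integrable[OF k s, of "\<lambda>z. of_bool (z = y)"] by (simp add: indicator_def)
  have "g (s x) = (\<Sum>y\<in>range s. indicator {x. s x = y} x * g y)" for x
  proof -
    have "(\<Sum>y\<in>range s. indicator {x. s x = y} x * g y) = (\<Sum>y\<in>range s. if y = s x then g y else 0)"
      by (intro sum.cong) (auto simp: indicator_def)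
    then show ?thesis using simple_range[OF s] by simp
  qed
  then have "integral\<^sup>L M (\<lambda>x. cnj (k x) * g (s x)) = integral\<^sup>L M (\<lambda>x. \<Sum>y\<in>range s. (cnj (k x) * indicator {x. s x = y} x) * g y)"
    by (simp add: sum_distrib_left mult.assoc)
  also have "\<dots> = (\<Sum>y\<in>range s. simple_coeff s k y * g y)"
    using int by (subst Bochner_Integration.integral_sum) (auto simp: simple_coeff_def)
  finally show ?thesis .
qed

lemma simple_coeff_bessel:
  assumes F: "finite F" "F \<subseteq> dual_group" and s: "simple_function M s"
  shows "(\<Sum>k\<in>F. (cmod (\<Sum>y\<in>range s. simple_coeff s k y * d y))\<^sup>2) \<le> (\<Sum>y\<in>range s. level s y * (cmod (d y))\<^sup>2)"
proof -
  have "finite ((\<lambda>y. cmod (d y)) ` range s)" using simple_range[OF s] by simp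
  then have bd: "cmod (d (s x)) \<le> Max ((\<lambda>y. cmod (d y)) ` range s)" for x by (intro Max_ge) auto
  have ms: "(\<lambda>x. d (s x)) \<in> borel_measurable M"
    by (rule borel_measurable_simple_function[OF simple_function_compose1[OF s]])
  have "(\<Sum>k\<in>F. (cmod (\<Sum>y\<in>range s. simple_coeff s k y * d y))\<^sup>2)
      = (\<Sum>k\<in>F. (cmod (integral\<^sup>L M (\<lambda>x. cnj (k x) * d (s x))))\<^sup>2)"
    using F by (intro sum.cong refl) (simp add: integral_simple_coeff[OF _ s] subset_iff)
  also have "\<dots> \<le> integral\<^sup>L M (\<lambda>x. (cmod (d (s x)))\<^sup>2)"
    by (rule haar_bessel[OF M F ms bd])
  also have "\<dots> = (\<Sum>y\<in>range s. level s y * (cmod (d y))\<^sup>2)"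
    using integral_simple_function[OF s, of "\<lambda>y. (cmod (d y))\<^sup>2"] by simp
  finally show ?thesis .
qed

lemma nn_integral_simple_norm:
  assumes s: "simple_function M s"
  shows "(\<integral>\<^sup>+x. ennreal (schatten_norm p (s x) powr p) \<partial>M)
    = ennreal (step_moment s)"
proof -
  have "simple_function M (\<lambda>x. schatten_norm p (s x) powr p)"
    by (rule simple_function_compose1[OF s, of "\<lambda>y. schatten_norm p y powr p"])
  then have sb: "Bochner_Integration.simple_bochner_integrable M (\<lambda>x. schatten_norm p (s x) powr p)"
    using B.emeasure_finite by (intro Bochner_Integration.simple_bochner_integrable.intros) auto
  have "(\<integral>\<^sup>+x. ennreal (schatten_norm p (s x) powr p) \<partial>M)
      = ennreal (Bochner_Integration.simple_bochner_integral M (\<lambda>x. schatten_norm p (s x) powr p))"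
    by (rule Bochner_Integration.simple_bochner_integral_eq_nn_integral[OF sb, symmetric]) simp
  also have "Bochner_Integration.simple_bochner_integral M (\<lambda>x. schatten_norm p (s x) powr p)
      = (\<Sum>y\<in>s ` space M. measure M {x \<in> space M. s x = y} *\<^sub>R schatten_norm p y powr p)"
    by (rule Bochner_Integration.simple_bochner_integral_partition[OF sb s]) auto
  finally show ?thesis by (simp add: space_haar)
qed

text \<open>The step functions converge to \<open>A\<close> in the \<open>L\<^sup>1\<close> sense, with convergence of their \<open>p\<close>-th moments. The former
  gives convergence of all matrix coefficients of all Fourier coefficients, since a functional
  \<open>T \<mapsto> \<langle>f, T e\<rangle>\<close> is bounded by the Schatten norm.\<close>
lemma schatten_fourier_approx:
  obtains s :: "nat \<Rightarrow> 'g \<Rightarrow> ('h \<Rightarrow>\<^sub>L 'h)" where "\<And>n. simple_function M (s n)" "\<And>n. range (s n) \<subseteq> schatten_class p"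
    "(\<lambda>n. step_moment (s n))
      \<longlonglongrightarrow> enn2real A_moment"
    "\<And>k e f. k \<in> dual_group \<Longrightarrow> (\<lambda>n. step_pairing (s n) k e f)
      \<longlonglongrightarrow> cinner f (A_hat k e)"
proof -
  obtain s where s: "\<And>n. B.simple_in (s n)"
    and lim1: "(\<lambda>n. \<integral>\<^sup>+x. ennreal (schatten_norm p (A x - s n x)) \<partial>M) \<longlonglongrightarrow> 0"
    and limp: "(\<lambda>n. \<integral>\<^sup>+x. ennreal (schatten_norm p (s n x) powr p) \<partial>M) \<longlonglongrightarrow> A_moment"
    by (rule B.simple_approximation[OF Lp_schattenD(1) p Lp_schattenD(2)]) blast
  have sf: "simple_function M (s n)" and sV: "s n x \<in> schatten_class p" for n x
    using s[of n] by (auto simp: B.simple_in_def space_haar)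
  show thesis
  proof (rule that[of s])
    show "simple_function M (s n)" for n by (rule sf)
    show "range (s n) \<subseteq> schatten_class p" for n using sV by blast
    have "(\<lambda>n. enn2real (ennreal (step_moment (s n))))
      \<longlonglongrightarrow> enn2real A_moment"
      unfolding nn_integral_simple_norm[OF sf, symmetric]
      by (rule tendsto_enn2real) (use limp Lp_schattenD(2) in auto)
    then show "(\<lambda>n. step_moment (s n))
      \<longlonglongrightarrow> enn2real A_moment"
      by (simp add: sum_nonneg)
    fix k :: "'g \<Rightarrow> complex" and e f :: 'h assume k: "k \<in> dual_group"
    let ?phi = "\<lambda>T :: 'h \<Rightarrow>\<^sub>L 'h. cinner f (T e)"
    let ?I = "A_hat k"
    have lin: "linear ?phi"
      by (rule linearI) (simp_all add: blinfun.add_left blinfun.scaleR_left cinner_simps cinner.scaleR_right)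
    define C where "C = norm f * norm e"
    have phi: "cmod (?phi T) \<le> C * schatten_norm p T" if "T \<in> schatten_class p" for T
    proof -
      have "cmod (?phi T) \<le> norm f * norm (T e)" by (rule norm_cinner_le)
      also have "\<dots> \<le> norm f * (norm T * norm e)" by (intro mult_left_mono norm_blinfun) auto
      also have "\<dots> \<le> norm f * (schatten_norm p T * norm e)"
        by (intro mult_left_mono mult_right_mono norm_le_schatten_norm p that) auto
      finally show ?thesis by (simp add: C_def mult_ac)
    qed
    have est: "ennreal (cmod (?phi ?I - step_pairing (s n) k e f))
        \<le> ennreal C * (\<integral>\<^sup>+x. ennreal (schatten_norm p (A x - s n x)) \<partial>M)" for n
    proof -
      obtain h where h: "h \<in> borel_measurable M" "AE x in M. h x = ennreal (schatten_norm p (A x - s n x))"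
        using B.measurable_version[OF Lp_schattenD(1) s] by blast
      have "ennreal (cmod (?phi ?I - integral\<^sup>L M (\<lambda>x. cnj (k x) * ?phi (s n x)))) \<le> (\<integral>\<^sup>+x. ennreal C * h x \<partial>M)"
      proof (rule B.functional_integral_estimate[OF schatten_fourier_integral[OF k] lin phi])
        show "integrable M (\<lambda>x. cnj (k x) * ?phi (s n x))" by (rule simple_coeff_integrable[OF k sf])
        show "(\<lambda>x. ennreal C * h x) \<in> borel_measurable M" using h(1) by measurable
        show "AE x in M. ennreal (cmod (?phi (scaleC_op (cnj (k x)) (A x)) - cnj (k x) * ?phi (s n x))) \<le> ennreal C * h x"
          using h(2)
        proof eventually_elim
          case (elim x)
          have "A x \<in> schatten_class p" using Lp_schattenD(1) by (auto simp: strongly_measurable_in_def space_haar)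
          then have m: "A x - s n x \<in> schatten_class p" using sV by (rule B.diff_mem)
          have "?phi (scaleC_op (cnj (k x)) (A x)) - cnj (k x) * ?phi (s n x) = cnj (k x) * ?phi (A x - s n x)"
            by (simp add: cinner_simps blinfun.diff_left algebra_simps)
          then have "cmod (?phi (scaleC_op (cnj (k x)) (A x)) - cnj (k x) * ?phi (s n x)) \<le> C * schatten_norm p (A x - s n x)"
            using phi[OF m] by (simp add: norm_mult dual_group_norm[OF k])
          then show ?case unfolding elim by (simp add: C_def ennreal_leI flip: ennreal_mult)
        qed
      qed (simp_all add: C_def)
      also have "\<dots> = ennreal C * (\<integral>\<^sup>+x. ennreal (schatten_norm p (A x - s n x)) \<partial>M)"
        using h(1) nn_integral_cong_AE[OF h(2)] by (simp add: nn_integral_cmult)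
      finally show ?thesis by (simp add: integral_simple_coeff[OF k sf, of ?phi])
    qed
    have "(\<lambda>n. ennreal (cmod (?phi ?I - step_pairing (s n) k e f))) \<longlonglongrightarrow> 0"
    proof (rule tendsto_sandwich[OF _ _ tendsto_const])
      have "(\<lambda>n. ennreal C * (\<integral>\<^sup>+x. ennreal (schatten_norm p (A x - s n x)) \<partial>M)) \<longlonglongrightarrow> ennreal C * 0"
        by (intro tendsto_mult_ennreal tendsto_const lim1) auto
      then show "(\<lambda>n. ennreal C * (\<integral>\<^sup>+x. ennreal (schatten_norm p (A x - s n x)) \<partial>M)) \<longlonglongrightarrow> 0" by simp
    qed (use est in \<open>auto intro!: always_eventually\<close>)
    then have "(\<lambda>n. cmod (?phi ?I - step_pairing (s n) k e f)) \<longlonglongrightarrow> 0"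
      by (simp add: ennreal_tendsto_0_iff)
    then have "(\<lambda>n. ?phi ?I - step_pairing (s n) k e f) \<longlonglongrightarrow> 0"
      by (rule tendsto_norm_zero_cancel)
    from tendsto_diff[OF tendsto_const[of "?phi ?I"] this]
    show "(\<lambda>n. step_pairing (s n) k e f) \<longlonglongrightarrow> cinner f (?I e)" by simp
  qed
qed

lemma schatten_fourier_mem: "k \<in> dual_group \<Longrightarrow> A_hat k \<in> schatten_class p"
  using schatten_fourier_integral by (simp add: has_bochner_integral_in_def)

lemma hausdorff_young_one:
  assumes k: "k \<in> dual_group" and p1: "p = 1"
  shows "ennreal (schatten_norm 1 (schatten_fourier M 1 A k)) \<le> (\<integral>\<^sup>+x. ennreal (schatten_norm 1 (A x)) \<partial>M)"
proof -
  let ?R = "A_moment"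
  obtain s where s: "\<And>n. simple_function M (s n)" "\<And>n. range (s n) \<subseteq> schatten_class p"
    and lim: "(\<lambda>n. step_moment (s n)) \<longlonglongrightarrow> enn2real ?R"
    and coeff: "\<And>k e f. k \<in> dual_group \<Longrightarrow> (\<lambda>n. step_pairing (s n) k e f)
      \<longlonglongrightarrow> cinner f (A_hat k e)"
    by (rule schatten_fourier_approx) blast
  have "schatten_norm p (A_hat k) \<le> enn2real ?R"
  proof (rule schatten_norm_leI(2)[OF p schatten_class_clinear[OF schatten_fourier_mem[OF k]]])
    fix I :: "nat set" and e f :: "nat \<Rightarrow> 'h" assume ef: "bessel I e" "bessel I f"
    have "(\<Sum>i\<in>I. cmod (cinner (f i) (A_hat k (e i)))) \<le> enn2real ?R"
    proof (rule LIMSEQ_le[OF _ lim])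
      show "(\<lambda>n. \<Sum>i\<in>I. cmod (step_pairing (s n) k (e i) (f i)))
          \<longlonglongrightarrow> (\<Sum>i\<in>I. cmod (cinner (f i) (A_hat k (e i))))"
        by (intro tendsto_sum tendsto_norm coeff k)
      have "(\<Sum>i\<in>I. cmod (step_pairing (s n) k (e i) (f i)))
          \<le> step_moment (s n)" for n
      proof -
        have "(\<Sum>i\<in>I. cmod (step_pairing (s n) k (e i) (f i)))
            \<le> (\<Sum>i\<in>I. \<Sum>y\<in>range (s n). level (s n) y * cmod (cinner (f i) (y (e i))))"
          using simple_coeff_le[OF k s(1)]
          by (intro sum_mono sum_norm_le) (auto simp: norm_mult intro!: mult_right_mono)
        also have "\<dots> = (\<Sum>y\<in>range (s n). level (s n) y * (\<Sum>i\<in>I. cmod (cinner (f i) (y (e i))) powr p))"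
          by (subst sum.swap) (simp add: sum_distrib_left p1)
        also have "\<dots> \<le> step_moment (s n)"
          using s(2) by (intro sum_mono mult_left_mono bessel_sum_le_schatten_norm p ef) auto
        finally show ?thesis .
      qed
      then show "\<exists>N. \<forall>n\<ge>N. (\<Sum>i\<in>I. cmod (step_pairing (s n) k (e i) (f i)))
          \<le> step_moment (s n)" by blast
    qed
    then show "(\<Sum>i\<in>I. cmod (cinner (f i) (A_hat k (e i))) powr p) \<le> enn2real ?R powr p"
      by (simp add: p1)
  qed simp
  then have "ennreal (schatten_norm p (A_hat k)) \<le> ennreal (enn2real ?R)" by (rule ennreal_leI)
  also have "\<dots> = ?R" using Lp_schattenD(2) by simp
  finally show ?thesis by (simp add: p1)
qed

text \<open>Pass to the limit in \<open>operator_interpolation\<close>; only finitely many matrix coefficients occur.\<close>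
lemma hausdorff_young_bessel:
  assumes p12: "1 < p" "p \<le> 2" and q: "q = p / (p - 1)" and F: "finite F" "F \<subseteq> dual_group"
    and e: "\<And>k. k \<in> F \<Longrightarrow> bessel (I k) (e k)" and f: "\<And>k. k \<in> F \<Longrightarrow> bessel (I k) (f k)"
  shows "(\<Sum>k\<in>F. (\<Sum>i\<in>I k. cmod (cinner (f k i) (A_hat k (e k i))) powr p) powr (q / p))
    \<le> enn2real A_moment powr (q / p)"
proof -
  have qp: "q / p > 0" using p12 by (simp add: q)
  obtain s where s: "\<And>n. simple_function M (s n)" "\<And>n. range (s n) \<subseteq> schatten_class p"
    and lim: "(\<lambda>n. step_moment (s n))
      \<longlonglongrightarrow> enn2real A_moment"
    and coeff: "\<And>k e f. k \<in> dual_group \<Longrightarrow> (\<lambda>n. step_pairing (s n) k e f)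
      \<longlonglongrightarrow> cinner f (A_hat k e)"
    by (rule schatten_fourier_approx) blast
  show ?thesis
  proof (rule LIMSEQ_le)
    show "(\<lambda>n. \<Sum>k\<in>F. (\<Sum>i\<in>I k. cmod (step_pairing (s n) k (e k i) (f k i)) powr p) powr (q / p))
      \<longlonglongrightarrow> (\<Sum>k\<in>F. (\<Sum>i\<in>I k. cmod (cinner (f k i) (A_hat k (e k i))) powr p) powr (q / p))"
      using F qp p12 by (intro tendsto_sum tendsto_powr' tendsto_norm coeff tendsto_const)
        (auto intro!: always_eventually sum_nonneg)
    show "(\<lambda>n. step_moment (s n) powr (q / p))
      \<longlonglongrightarrow> enn2real A_moment powr (q / p)"
      using qp by (intro tendsto_powr' lim tendsto_const) (auto intro!: always_eventually sum_nonneg)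
    have "(\<Sum>k\<in>F. (\<Sum>i\<in>I k. cmod (step_pairing (s n) k (e k i) (f k i)) powr p) powr (q / p))
      \<le> step_moment (s n) powr (q / p)" for n
      by (rule operator_interpolation[OF p12 q F(1) simple_range[OF s(1)] s(2) e f])
        (use F simple_coeff_le[OF _ s(1)] simple_coeff_bessel[OF F s(1)] in auto)
    then show "\<exists>N. \<forall>n\<ge>N. (\<Sum>k\<in>F. (\<Sum>i\<in>I k. cmod (step_pairing (s n) k (e k i) (f k i)) powr p) powr (q / p))
      \<le> step_moment (s n) powr (q / p)" by blast
  qed
qed

text \<open>For each character choose Bessel families that attain the \<open>p\<close>-th power of the Schatten norm up to \<open>d\<close>, and
  let \<open>d\<close> tend to zero.\<close>
lemma hausdorff_young_finite:
  assumes p12: "1 < p" "p \<le> 2" and q: "q = p / (p - 1)" and F: "finite F" "F \<subseteq> dual_group"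
  shows "(\<Sum>k\<in>F. schatten_norm p (A_hat k) powr q)
    \<le> enn2real A_moment powr (q / p)"
    (is "_ \<le> ?R")
proof -
  have qp: "q / p > 0" using p12 by (simp add: q)
  let ?N = "\<lambda>k. schatten_norm p (A_hat k) powr p"
  have approx: "(\<Sum>k\<in>F. (max 0 (?N k - d)) powr (q / p)) \<le> ?R" if d: "d > 0" for d
  proof -
    define Q where "Q k I e f \<longleftrightarrow> bessel I e \<and> bessel I f \<and>
        ?N k - d \<le> (\<Sum>i\<in>I. cmod (cinner (f i) (A_hat k (e i))) powr p)"
      for k and I :: "nat set" and e f
    have "\<exists>I e f. Q k I e f" if k: "k \<in> F" for k
    proof (rule ccontr)
      assume no: "\<not> (\<exists>I e f. Q k I e f)"
      let ?T = "A_hat k"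
      have mem: "?T \<in> schatten_class p" using schatten_fourier_mem F k by blast
      define c where "c = (max 0 (?N k - d)) powr (1 / p)"
      have cp: "c powr p = max 0 (?N k - d)" using p12 by (simp add: c_def powr_powr)
      have "schatten_norm p ?T \<le> c"
      proof (rule schatten_norm_leI(2)[OF p schatten_class_clinear[OF mem]])
        show "(\<Sum>i\<in>I. cmod (cinner (f i) (?T (e i))) powr p) \<le> c powr p"
          if "bessel I e" "bessel I f" for I :: "nat set" and e f
        proof -
          have "\<not> ?N k - d \<le> (\<Sum>i\<in>I. cmod (cinner (f i) (?T (e i))) powr p)" using no that unfolding Q_def by blast
          then show ?thesis unfolding cp by linarith
        qed
      qed (simp add: c_def)
      then have "?N k \<le> max 0 (?N k - d)" using powr_mono2[of p "schatten_norm p ?T" c] p12 by (simp add: cp)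
      then have "?N k = 0" using d by (simp add: max_def split: if_splits)
      then have "?N k - d \<le> (\<Sum>i\<in>{}. cmod (cinner (undefined i) (?T (undefined i))) powr p)" using d by simp
      moreover have "bessel {} (undefined :: nat \<Rightarrow> 'h)" by (simp add: bessel_def)
      ultimately have "Q k {} undefined undefined" unfolding Q_def by blast
      then show False using no by blast
    qed
    then obtain I e f where Q: "\<And>k. k \<in> F \<Longrightarrow> Q k (I k) (e k) (f k)" by metis
    have Ief: "bessel (I k) (e k)" "bessel (I k) (f k)"
      "?N k - d \<le> (\<Sum>i\<in>I k. cmod (cinner (f k i) (A_hat k (e k i))) powr p)" if "k \<in> F" for k
      using Q[OF that] unfolding Q_def by blast+
    have "(\<Sum>k\<in>F. (max 0 (?N k - d)) powr (q / p))
        \<le> (\<Sum>k\<in>F. (\<Sum>i\<in>I k. cmod (cinner (f k i) (A_hat k (e k i))) powr p) powr (q / p))"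
      using qp Ief(3) by (intro sum_mono powr_mono2) (auto intro: sum_nonneg)
    also have "\<dots> \<le> ?R" by (rule hausdorff_young_bessel[OF p12 q F Ief(1,2)])
    finally show ?thesis .
  qed
  have "(\<lambda>n. \<Sum>k\<in>F. (max 0 (?N k - inverse (Suc n))) powr (q / p)) \<longlonglongrightarrow> (\<Sum>k\<in>F. (max 0 (?N k - 0)) powr (q / p))"
    using qp by (intro tendsto_sum tendsto_powr' tendsto_max tendsto_diff tendsto_const LIMSEQ_inverse_real_of_nat) auto
  then have "(\<Sum>k\<in>F. (max 0 (?N k - 0)) powr (q / p)) \<le> ?R"
    by (rule LIMSEQ_le_const2) (use approx in auto)
  then show ?thesis using p12 by (simp add: powr_powr)
qed

end

theorem theorem3p5:
  fixes \<mu> :: "'g::{topological_ab_group_add, t2_space} measure"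
    and A :: "'g \<Rightarrow> ('h::complex_hilbert_space \<Rightarrow>\<^sub>L 'h)"
    and p :: real
  assumes "compact (UNIV :: 'g set)"
    and "normalized_haar_measure \<mu>"
    and "separable_space (euclidean :: 'h topology)"
    and "1 \<le> p" and "p \<le> 2"
    and "A \<in> Lp_schatten \<mu> p"
  shows "(p > 1 \<longrightarrow> (let q = p / (p - 1) in
            (\<Sum>\<^sub>\<infinity>k\<in>dual_group. ennreal (schatten_norm p (schatten_fourier \<mu> p A k) powr q))
              \<le> ennreal (enn2real (\<integral>\<^sup>+\<theta>. ennreal (schatten_norm p (A \<theta>) powr p) \<partial>\<mu>) powr (q / p))))
       \<and> (p = 1 \<longrightarrow>
            (SUP k\<in>dual_group. ennreal (schatten_norm 1 (schatten_fourier \<mu> 1 A k)))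
              \<le> (\<integral>\<^sup>+\<theta>. ennreal (schatten_norm 1 (A \<theta>)) \<partial>\<mu>))"
proof (intro conjI impI)
  assume p1: "1 < p"
  define q where "q = p / (p - 1)"
  have "(\<Sum>\<^sub>\<infinity>k\<in>dual_group. ennreal (schatten_norm p (schatten_fourier \<mu> p A k) powr q))
      \<le> ennreal (enn2real (\<integral>\<^sup>+\<theta>. ennreal (schatten_norm p (A \<theta>) powr p) \<partial>\<mu>) powr (q / p))"
    using hausdorff_young_finite[OF assms(2,4,6) p1 assms(5) q_def]
    by (auto simp: nonneg_infsum_complete sum_ennreal intro!: SUP_least ennreal_leI)
  then show "let q = p / (p - 1) in
            (\<Sum>\<^sub>\<infinity>k\<in>dual_group. ennreal (schatten_norm p (schatten_fourier \<mu> p A k) powr q))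
              \<le> ennreal (enn2real (\<integral>\<^sup>+\<theta>. ennreal (schatten_norm p (A \<theta>) powr p) \<partial>\<mu>) powr (q / p))"
    unfolding Let_def q_def .
next
  assume "p = 1"
  then show "(SUP k\<in>dual_group. ennreal (schatten_norm 1 (schatten_fourier \<mu> 1 A k)))
      \<le> (\<integral>\<^sup>+\<theta>. ennreal (schatten_norm 1 (A \<theta>)) \<partial>\<mu>)"
    by (intro SUP_least hausdorff_young_one[OF assms(2,4,6)])
qed

end
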